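(* Let $e=(1,0,0)\in\mathbb{R}^3$ and let $T>1$. Let $q_1,q_2\in C^{3}(\mathbb{R}^{3})$ be real-valued functions with $q_{1}(x)\geq q_{2}(x)$ for all $x\in\mathbb{R}^{3}$. For $i=1,2$ let $u_{i}(x,t)$ be the solution to the initial value problem $$(\Box-q_{i}(x))u_{i}(x,t)=\delta(x,t),\quad (x,t)\in\mathbb{R}^{3}\times\mathbb{R},\qquad u_{i}(x,t)|_{t<0}=0,\quad x\in\mathbb{R}^{3}.$$ If $u_{1}(e,t)=u_{2}(e,t)$ for all $t\in[0,T]$, then $q_{1}(x)=q_{2}(x)$ for all $x\in\mathbb{R}^3$ with $|e-x|+|x|\leq T$.
   Context: $\Box=\partial_t^2-\Delta_x$ is the wave operator on $\mathbb{R}^3\times\mathbb{R}$, and $\delta(x,t)$ is the Dirac distribution at the origin of $\mathbb{R}^3\times\mathbb{R}$. For real-valued $q\in C^3(\mathbb{R}^3)$, the (distributional) solution of $(\Box-q(x))u=\delta(x,t)$, $u|_{t<0}=0$, is given by $$u(x,t)=\frac{\delta(t-|x|)}{4\pi|x|}+v(x,t),$$ where $v(x,t)=0$ for $t<|x|$ and, in the region $t>|x|$, $v$ is a $C^2$ solution of the characteristic boundary value (Goursat) problem $(\Box-q(x))v(x,t)=0$ for $t>|x|$, $v(x,|x|)=\frac{1}{8\pi}\int_0^1 q(sx)\,ds$ (the boundary value being attained as the limit from $t>|x|$). Writing $u_i=\frac{\delta(t-|x|)}{4\pi|x|}+v_i$ for $q=q_i$, the singular terms of $u_1$ and $u_2$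 coincide, so the condition $u_1(e,t)=u_2(e,t)$ for $t\in[0,T]$ means $v_1(e,t)=v_2(e,t)$ for $t\in[0,T]$ (both vanish for $t<1$). *)

theory Defs
  imports "HOL-Analysis.Analysis"
begin

type_synonym space = "real^3"
type_synonym spacetime = "(real^3) \<times> real"

definition dir_deriv :: "'a::real_normed_vector \<Rightarrow> ('a \<Rightarrow> real) \<Rightarrow> 'a \<Rightarrow> real" where
  "dir_deriv d f p = frechet_derivative f (at p) d"

(* Intended for open S only: f is C^(k+1) iff it is differentiable and all its
   directional derivatives are C^k. *)
primrec Ck_on :: "nat \<Rightarrow> ('a::euclidean_space \<Rightarrow> real) \<Rightarrow> 'a set \<Rightarrow> bool" where
  "Ck_on 0 f S \<longleftrightarrow> continuous_on S f"
| "Ck_on (Suc k) f S \<longleftrightarrow>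
     (\<forall>p\<in>S. f differentiable (at p)) \<and> (\<forall>d. Ck_on k (dir_deriv d f) S)"

definition wave_op :: "(spacetime \<Rightarrow> real) \<Rightarrow> spacetime \<Rightarrow> real" where
  "wave_op f p = dir_deriv (0, 1) (dir_deriv (0, 1) f) p
               - (\<Sum>b\<in>Basis. dir_deriv (b, 0) (dir_deriv (b, 0) f) p)"

definition wave_op_pot :: "(space \<Rightarrow> real) \<Rightarrow> (spacetime \<Rightarrow> real) \<Rightarrow> spacetime \<Rightarrow> real" where
  "wave_op_pot q f p = wave_op f p - q (fst p) * f p"


definition fun_support :: "('a::topological_space \<Rightarrow> real) \<Rightarrow> 'a set" where
  "fun_support f = closure {p. f p \<noteq> 0}"

definition Cc :: "(spacetime \<Rightarrow> real) set" where
  "Cc = {\<phi>. continuous_on UNIV \<phi> \<and> compact (fun_support \<phi>)}"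

definition test_functions :: "(spacetime \<Rightarrow> real) set" where
  "test_functions = {\<phi>. (\<forall>k. Ck_on k \<phi> UNIV) \<and> compact (fun_support \<phi>)}"

(* Distributions of order zero, regarded as functionals on continuous compactly
   supported functions.  Since q is only C^3, the function (Box - q) phi is in general
   not smooth for a test function phi, so that the adjoint equation below needs u on
   more than smooth functions; delta(t - |x|)/(4 pi |x|) + v has order zero. *)
definition distribution0 :: "((spacetime \<Rightarrow> real) \<Rightarrow> real) \<Rightarrow> bool" where
  "distribution0 u \<longleftrightarrow>
     (\<forall>\<phi>\<in>Cc. \<forall>\<psi>\<in>Cc. \<forall>a b. u (\<lambda>p. a * \<phi> p + b * \<psi> p) = a * u \<phi> + b * u \<psi>) \<and>
     (\<forall>K. compact K \<longrightarrow>
        (\<exists>C. \<forall>\<phi>\<in>Cc. \<forall>B. fun_support \<phi> \<subseteq> K \<and> (\<forall>p. \<bar>\<phi> p\<bar> \<le> B) \<longrightarrow> \<bar>u \<phi>\<bar> \<le> C * B))"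

(* (Box - q) u = delta in the sense of distributions (Box - q is formally self-adjoint),
   and u = 0 for t < 0. *)
definition solves_ivp :: "(space \<Rightarrow> real) \<Rightarrow> ((spacetime \<Rightarrow> real) \<Rightarrow> real) \<Rightarrow> bool" where
  "solves_ivp q u \<longleftrightarrow>
     distribution0 u \<and>
     (\<forall>\<phi>\<in>test_functions. u (wave_op_pot q \<phi>) = \<phi> 0) \<and>
     (\<forall>\<phi>\<in>Cc. fun_support \<phi> \<subseteq> {p. snd p < 0} \<longrightarrow> u \<phi> = 0)"


(* The distribution delta(t - |x|) / (4 pi |x|). *)
definition singular_part :: "(spacetime \<Rightarrow> real) \<Rightarrow> real" where
  "singular_part \<phi> = (\<integral>x. \<phi> (x, norm x) / (4 * pi * norm x) \<partial>lborel)"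

definition has_regular_part ::
    "((spacetime \<Rightarrow> real) \<Rightarrow> real) \<Rightarrow> (spacetime \<Rightarrow> real) \<Rightarrow> bool" where
  "has_regular_part u v \<longleftrightarrow>
     (\<forall>\<phi>\<in>Cc. u \<phi> = singular_part \<phi> + (\<integral>p. v p * \<phi> p \<partial>lborel))"

definition light_cone :: "spacetime set" where
  "light_cone = {(x, t). norm x < t}"

definition goursat_data :: "(space \<Rightarrow> real) \<Rightarrow> space \<Rightarrow> real" where
  "goursat_data q x = 1 / (8 * pi) * integral {0..1} (\<lambda>s. q (s *\<^sub>R x))"

(* On t = |x| the function v takes the boundary value, and this is also its limit
   from the open set t > |x|; no regularity of derivatives up to t = |x| is asked for. *)
definition goursat_solution :: "(space \<Rightarrow> real) \<Rightarrow> (spacetime \<Rightarrow> real) \<Rightarrow> bool" where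
  "goursat_solution q v \<longleftrightarrow>
     (\<forall>x t. t < norm x \<longrightarrow> v (x, t) = 0) \<and>
     Ck_on 2 v light_cone \<and>
     (\<forall>p\<in>light_cone. wave_op_pot q v p = 0) \<and>
     (\<forall>x. v (x, norm x) = goursat_data q x) \<and>
     (\<forall>x. (v \<longlongrightarrow> goursat_data q x) (at (x, norm x) within light_cone))"

(* The solution u = delta(t - |x|) / (4 pi |x|) + v of the initial value problem, v being
   the solution of the Goursat problem.  The regular part v is recorded because it gives
   a meaning to the values of u at points: the singular part does not depend on q. *)
definition ivp_solution ::
    "(space \<Rightarrow> real) \<Rightarrow> ((spacetime \<Rightarrow> real) \<Rightarrow> real) \<Rightarrow> (spacetime \<Rightarrow> real) \<Rightarrow> bool" where
  "ivp_solution q u v \<longleftrightarrow> solves_ivp q u \<and> has_regular_part u v \<and> goursat_solution q v"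

end

theory Submission
  imports Defs
begin

text \<open>Let \<open>w = v1 - v2\<close> and \<open>q = q1 - q2 \<ge> 0\<close>. Testing the equations for \<open>u1\<close> and \<open>u2\<close> against
  the backward solution with source at \<open>e\<close>, integrated over the times up to \<open>\<tau>\<close>, expresses
  \<open>w (e, \<cdot>) = 0\<close> as \<open>G \<tau> + remainder = 0\<close>, where \<open>G \<tau>\<close> is a multiple of the integral of
  \<open>q x / (|x| |x - e|)\<close> over the ellipsoid \<open>|x| + |x - e| < \<tau>\<close>.  Expanding the remainder in a
  Neumann series in \<open>q1\<close>, which avoids constructing the fundamental solution at \<open>e\<close>, and using
  that the integral of \<open>1 / (|z| |z - a|)\<close> over \<open>|z| + |z - a| < s\<close> tends to \<open>0\<close> as \<open>s - |a| \<rightarrow> 0\<close>, one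
  finds \<open>|remainder| \<le> G \<tau> / 2\<close> as soon as \<open>q\<close> vanishes on the ellipsoid of size \<open>\<tau> - d\<close> for a small
  fixed \<open>d\<close>.  Hence \<open>G \<tau> = 0\<close>, and as \<open>q \<ge> 0\<close> its zero set grows until it fills the ellipsoid.\<close>

section \<open>Calculus of \<open>C\<^sup>k\<close> functions and cut-offs\<close>

text \<open>The equation is given only in weak form, and \<open>v\<close> has no controlled
  derivatives up to the cone, so integrating by parts inside the cone is out of reach. Everything is
  done by duality: the weak equation is tested with advanced potentials of sources. That these
  potentials invert the free wave operator is itself read off from the hypotheses, through a scaling
  limit. A point source at \<open>e\<close> is replaced by an average over a ball of radius
  \<open>r\<close>. Two-sided bounds of its potential by multiples of 1 / |x - e|, uniform in
  \<open>r\<close>, stand in for an exact formula; the numerical factors in them have no deeper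
  meaning. These sources and their Neumann iterates jump, which forces the passage from test
  functions to bounded Borel functions. The sign of \<open>q\<close> enters twice: the leading term
  cannot cancel, and its integral also dominates the absolute values of all other terms. In the term
  with \<open>v2\<close> and the unperturbed source, smallness comes from finite propagation: only
  times |x| <= t < |x| + d contribute, which yields a factor \<open>d\<close>.\<close>

lemma dir_deriv_eq: "(f has_derivative f') (at p) \<Longrightarrow> dir_deriv d f p = f' d"
  unfolding dir_deriv_def using frechet_derivative_at by metis

lemma has_derivative_dir_deriv:
  "f differentiable at p \<Longrightarrow> (f has_derivative (\<lambda>d. dir_deriv d f p)) (at p)"
  unfolding dir_deriv_def using frechet_derivative_works by blast

lemma Ck_on_SucI:
  assumes "\<And>p. (f has_derivative f' p) (at p)" and "\<And>d. Ck_on k (\<lambda>p. f' p d) UNIV"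
  shows "Ck_on (Suc k) f UNIV"
proof -
  have "dir_deriv d f = (\<lambda>p. f' p d)" for d
    using dir_deriv_eq[OF assms(1)] by auto
  then show ?thesis using assms by (auto simp: differentiable_def)
qed

lemma Ck_on_Suc_has_derivative:
  "Ck_on (Suc k) f UNIV \<Longrightarrow> (f has_derivative (\<lambda>d. dir_deriv d f p)) (at p)"
  by (rule has_derivative_dir_deriv) auto

lemma Ck_on_imp_continuous_on: "Ck_on k f S \<Longrightarrow> continuous_on S f"
proof (cases k)
  case (Suc m)
  then show "Ck_on k f S \<Longrightarrow> continuous_on S f"
    by (metis Ck_on.simps(2) differentiable_at_imp_differentiable_on differentiable_imp_continuous_on)
qed auto

lemma Ck_on_SucD: "Ck_on (Suc k) f S \<Longrightarrow> Ck_on k f S"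
proof (induction k arbitrary: f)
  case 0
  then show ?case using Ck_on_imp_continuous_on[of "Suc 0" f S] by simp
next
  case (Suc k)
  then show ?case by auto
qed

lemma Ck_on_const: "Ck_on k (\<lambda>p. c) UNIV"
proof (induction k arbitrary: c)
  case (Suc k)
  show ?case by (rule Ck_on_SucI[where f' = "\<lambda>p d. 0"]) (auto simp: Suc)
qed auto

lemma Ck_on_add:
  "Ck_on k f UNIV \<Longrightarrow> Ck_on k g UNIV \<Longrightarrow> Ck_on k (\<lambda>p. f p + g p) UNIV"
proof (induction k arbitrary: f g)
  case (Suc k)
  show ?case
    by (rule Ck_on_SucI[where f' = "\<lambda>p d. dir_deriv d f p + dir_deriv d g p"])
      (use Suc in \<open>auto intro!: has_derivative_add Ck_on_Suc_has_derivative[of k]\<close>)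
qed (auto intro: continuous_on_add)

lemma Ck_on_mult:
  "Ck_on k f UNIV \<Longrightarrow> Ck_on k g UNIV \<Longrightarrow> Ck_on k (\<lambda>p. f p * g p) UNIV"
proof (induction k arbitrary: f g)
  case (Suc k)
  show ?case
  proof (rule Ck_on_SucI[where f' = "\<lambda>p d. f p * dir_deriv d g p + dir_deriv d f p * g p"])
    show "((\<lambda>p. f p * g p) has_derivative (\<lambda>d. f p * dir_deriv d g p + dir_deriv d f p * g p)) (at p)" for p
      by (rule has_derivative_mult) (use Suc.prems in \<open>auto intro!: Ck_on_Suc_has_derivative[of k]\<close>)
    show "Ck_on k (\<lambda>p. f p * dir_deriv d g p + dir_deriv d f p * g p) UNIV" for d
      using Suc.prems Suc.prems[THEN Ck_on_SucD] by (intro Ck_on_add Suc.IH) auto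
  qed
qed (auto intro: continuous_on_mult)

lemma Ck_on_cmult: "Ck_on k f UNIV \<Longrightarrow> Ck_on k (\<lambda>p. c * f p) UNIV"
  using Ck_on_mult[OF Ck_on_const] .

lemma Ck_on_diff:
  "Ck_on k f UNIV \<Longrightarrow> Ck_on k g UNIV \<Longrightarrow> Ck_on k (\<lambda>p. f p - g p) UNIV"
  using Ck_on_add[OF _ Ck_on_cmult[of k g "-1"]] by simp

lemma Ck_on_inverse:
  assumes "\<And>p. f p \<noteq> 0"
  shows "Ck_on k f UNIV \<Longrightarrow> Ck_on k (\<lambda>p. inverse (f p)) UNIV"
proof (induction k)
  case (Suc k)
  show ?case
  proof (rule Ck_on_SucI[where f' = "\<lambda>p d. - (inverse (f p) * dir_deriv d f p * inverse (f p))"])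
    show "((\<lambda>p. inverse (f p)) has_derivative (\<lambda>d. - (inverse (f p) * dir_deriv d f p * inverse (f p)))) (at p)" for p
      by (rule Deriv.has_derivative_inverse[OF assms Ck_on_Suc_has_derivative[OF Suc.prems]])
    have "Ck_on k (\<lambda>p. (-1) * (inverse (f p) * dir_deriv d f p * inverse (f p))) UNIV" for d
      using Suc.prems Suc.prems[THEN Ck_on_SucD] by (intro Ck_on_cmult Ck_on_mult Suc.IH) auto
    then show "Ck_on k (\<lambda>p. - (inverse (f p) * dir_deriv d f p * inverse (f p))) UNIV" for d
      by simp
  qed
qed (use assms in \<open>auto intro!: continuous_on_inverse\<close>)

lemma Ck_on_prod:
  "finite I \<Longrightarrow> (\<And>i. i \<in> I \<Longrightarrow> Ck_on k (f i) UNIV) \<Longrightarrow> Ck_on k (\<lambda>p. \<Prod>i\<in>I. f i p) UNIV"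
  by (induction I rule: finite_induct) (auto intro: Ck_on_mult Ck_on_const)

lemma has_derivative_affine_comp:
  assumes "\<And>p. (f has_derivative f' p) (at p)"
  shows "((\<lambda>p. f (c *\<^sub>R p + a)) has_derivative (\<lambda>d. f' (c *\<^sub>R p + a) (c *\<^sub>R d))) (at p)"
  by (rule has_derivative_compose[where g = f and f = "\<lambda>p. c *\<^sub>R p + a"])
    (auto intro!: derivative_eq_intros assms)

lemma dir_deriv_affine_comp:
  assumes "\<And>p. f differentiable at p"
  shows "dir_deriv d (\<lambda>p. f (c *\<^sub>R p + a)) p = c * dir_deriv d f (c *\<^sub>R p + a)"
proof -
  have "((\<lambda>p. f (c *\<^sub>R p + a)) has_derivative (\<lambda>d. dir_deriv (c *\<^sub>R d) f (c *\<^sub>R p + a))) (at p)"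
    by (rule has_derivative_affine_comp[OF has_derivative_dir_deriv[OF assms]])
  moreover have "dir_deriv (c *\<^sub>R d) f q = c * dir_deriv d f q" for q
    using has_derivative_dir_deriv[OF assms, of q]
    by (metis has_derivative_linear linear_cmul real_scaleR_def)
  ultimately show ?thesis using dir_deriv_eq by fastforce
qed

lemma Ck_on_affine_comp:
  "Ck_on k f UNIV \<Longrightarrow> Ck_on k (\<lambda>p. f (c *\<^sub>R p + a)) UNIV"
proof (induction k arbitrary: f)
  case 0
  then show ?case by (auto intro!: continuous_intros continuous_on_compose2[of UNIV f])
next
  case (Suc k)
  have d: "dir_deriv d (\<lambda>p. f (c *\<^sub>R p + a)) = (\<lambda>p. c * dir_deriv d f (c *\<^sub>R p + a))" for d
    using dir_deriv_affine_comp Suc.prems by fastforce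
  have "(\<lambda>p. f (c *\<^sub>R p + a)) differentiable at p" for p
    using has_derivative_affine_comp[OF has_derivative_dir_deriv, of f c a p] Suc.prems
    by (auto simp: differentiable_def)
  then show ?case using Suc by (auto simp: d intro!: Ck_on_cmult)
qed

section \<open>Smooth cut-offs built from exp(-1/x)\<close>

definition flat :: "nat \<Rightarrow> real \<Rightarrow> real" where
  "flat n x = (if x > 0 then exp (- (1 / x)) / x ^ n else 0)"

text \<open>Dividing exp(-1/x) by powers of x produces a family closed under differentiation, so one
  induction over the order gives smoothness of all members. At 0 the right difference quotient is
  y^(n+1) / exp y with y = 1/h, which tends to 0.\<close>

lemma flat_DERIV: "(flat n has_real_derivative (flat (n + 2) x - n * flat (n + 1) x)) (at x)"
proof -
  consider "x > 0" | "x < 0" | "x = 0" by linarith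
  then show ?thesis
  proof cases
    case 1
    have "((\<lambda>x. exp (- (1 / x)) / x ^ n) has_real_derivative
       (flat (n + 2) x - n * flat (n + 1) x)) (at x)"
    proof (cases n)
      case 0
      then show ?thesis using 1
        by (auto intro!: derivative_eq_intros simp: flat_def field_simps power2_eq_square)
    next
      case (Suc m)
      have "x * (x ^ m * x ^ (m - Suc 0)) * real m = x ^ m * x ^ m * real m"
        by (cases m) auto
      then show ?thesis using 1 Suc
        by (auto intro!: derivative_eq_intros simp: flat_def field_simps power2_eq_square)
    qed
    then show ?thesis
      by (rule DERIV_cong_ev[THEN iffD2, rotated -1])
        (use 1 eventually_nhds_in_open[of "{0<..}" x] in \<open>auto simp: flat_def elim!: eventually_mono\<close>)
  next
    case 2
    have "((\<lambda>x. 0) has_real_derivative (flat (n + 2) x - n * flat (n + 1) x)) (at x)"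
      using 2 by (auto simp: flat_def)
    then show ?thesis
      by (rule DERIV_cong_ev[THEN iffD2, rotated -1])
        (use 2 eventually_nhds_in_open[of "{..<0}" x] in \<open>auto simp: flat_def elim!: eventually_mono\<close>)
  next
    case 3
    have l: "((\<lambda>h. flat n h / h) \<longlongrightarrow> 0) (at_left 0)"
      by (rule tendsto_eventually) (auto simp: flat_def eventually_at_filter)
    have "((\<lambda>h::real. (inverse h) ^ (n + 1) / exp (inverse h)) \<longlongrightarrow> 0) (at_right 0)"
      using filterlim_compose[OF tendsto_power_div_exp_0 filterlim_inverse_at_top_right] .
    then have r: "((\<lambda>h. flat n h / h) \<longlongrightarrow> 0) (at_right 0)"
      by (rule Lim_transform_eventually)
        (auto simp: flat_def eventually_at_filter field_simps exp_minus)
    have "((\<lambda>h. flat n h / h) \<longlongrightarrow> 0) (at 0)"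
      using l r filterlim_at_split by blast
    then show ?thesis using 3 by (simp add: has_field_derivative_iff flat_def)
  qed
qed

lemma Ck_on_flat:
  assumes "bounded_linear l"
  shows "Ck_on k (\<lambda>p. flat n (l p + c)) UNIV"
proof (induction k arbitrary: n)
  case 0
  have "continuous_on UNIV (flat n)"
    using flat_DERIV DERIV_isCont continuous_at_imp_continuous_on by blast
  then show ?case
    by (auto intro!: continuous_on_compose2[of UNIV "flat n"] continuous_intros
        bounded_linear.continuous_on[OF assms])
next
  case (Suc k)
  show ?case
  proof (rule Ck_on_SucI)
    show "((\<lambda>p. flat n (l p + c)) has_derivative
      (\<lambda>d. l d * (flat (n + 2) (l p + c) - n * flat (n + 1) (l p + c)))) (at p)" for p
      by (rule has_derivative_eq_rhs[OF has_derivative_compose[where f = "\<lambda>p. l p + c" and g = "flat n",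
              OF _ flat_DERIV[THEN has_field_derivative_imp_has_derivative]]])
        (auto intro!: derivative_eq_intros bounded_linear_imp_has_derivative[OF assms])
    show "Ck_on k (\<lambda>p. l d * (flat (n + 2) (l p + c) - n * flat (n + 1) (l p + c))) UNIV" for d
      using Suc by (intro Ck_on_cmult Ck_on_diff)
  qed
qed

text \<open>The factor \<open>Suc n\<close> drives every \<open>flat 0\<close> to 1 inside the box
  without enlarging the set where the product is nonzero. Indicators of open boxes thus become
  bounded pointwise limits of smooth functions with the same support.\<close>

definition box_bump :: "nat \<Rightarrow> 'a::euclidean_space \<Rightarrow> 'a \<Rightarrow> 'a \<Rightarrow> real" where
  "box_bump n a b p =
     (\<Prod>i\<in>Basis. flat 0 (Suc n * ((p - a) \<bullet> i)) * flat 0 (Suc n * ((b - p) \<bullet> i)))"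

lemma Ck_on_box_bump: "Ck_on k (box_bump n a b) UNIV"
  unfolding box_bump_def
proof (intro Ck_on_prod Ck_on_mult)
  fix i :: 'a
  have "Ck_on k (\<lambda>p. flat 0 ((\<lambda>p. Suc n * (p \<bullet> i)) p + - (Suc n * (a \<bullet> i)))) UNIV"
    by (rule Ck_on_flat) (intro bounded_linear_intros)
  then show "Ck_on k (\<lambda>p. flat 0 (Suc n * ((p - a) \<bullet> i))) UNIV"
    by (simp add: inner_diff_left algebra_simps)
  have "Ck_on k (\<lambda>p. flat 0 ((\<lambda>p. - Suc n * (p \<bullet> i)) p + Suc n * (b \<bullet> i))) UNIV"
    by (rule Ck_on_flat) (intro bounded_linear_intros)
  then show "Ck_on k (\<lambda>p. flat 0 (Suc n * ((b - p) \<bullet> i))) UNIV"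
    by (simp add: inner_diff_left algebra_simps)
qed auto

lemma flat_0_bounds: "0 \<le> flat 0 x" "flat 0 x \<le> 1"
  by (auto simp: flat_def)

lemma box_bump_bounds: "0 \<le> box_bump n a b p" "box_bump n a b p \<le> 1"
  unfolding box_bump_def
  by (auto intro!: prod_nonneg prod_le_1 mult_nonneg_nonneg mult_le_one simp: flat_0_bounds)

lemma box_bump_eq_0: "p \<notin> box a b \<Longrightarrow> box_bump n a b p = 0"
  by (auto simp: box_bump_def mem_box flat_def inner_diff_left zero_less_mult_iff)

lemma box_bump_LIMSEQ: "(\<lambda>n. box_bump n a b p) \<longlonglongrightarrow> indicator (box a b) p"
proof (cases "p \<in> box a b")
  case True
  have *: "(\<lambda>n. flat 0 (Suc n * x)) \<longlonglongrightarrow> 1" if "x > 0" for x :: real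
  proof -
    have "(\<lambda>n. exp (- (1 / x * inverse (real (Suc n))))) \<longlonglongrightarrow> exp (- (1 / x * 0))"
      by (intro tendsto_intros LIMSEQ_inverse_real_of_nat)
    moreover have "(\<lambda>n. flat 0 (Suc n * x)) = (\<lambda>n. exp (- (1 / x * inverse (real (Suc n)))))"
      using that zero_less_mult_iff[of "real (Suc _)" x] by (auto simp: flat_def divide_simps simp del: of_nat_Suc)
    ultimately show ?thesis by simp
  qed
  have "(\<lambda>n. box_bump n a b p) \<longlonglongrightarrow> (\<Prod>i\<in>(Basis::'a set). 1 * 1)"
    unfolding box_bump_def
    by (intro tendsto_prod tendsto_mult *) (use True in \<open>auto simp: mem_box inner_diff_left\<close>)
  then show ?thesis using True by simp
next
  case False
  then show ?thesis by (simp add: box_bump_eq_0)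
qed

text \<open>Equal to 1 from time -1 on and to 0 up to time -2. An advanced potential can reach
  arbitrarily far into the past; multiplied by this function it becomes a test function, and nothing
  changes at times t >= 0, where \<open>u\<close> lives.\<close>

definition time_cutoff :: "spacetime \<Rightarrow> real" where
  "time_cutoff p = flat 0 (snd p + 2) * inverse (flat 0 (snd p + 2) + flat 0 (- snd p + (- 1)))"

lemma Ck_on_time_cutoff: "Ck_on k time_cutoff UNIV"
  unfolding time_cutoff_def
proof (intro Ck_on_mult Ck_on_inverse Ck_on_add)
  show "Ck_on k (\<lambda>p. flat 0 (snd p + 2)) UNIV"
    by (rule Ck_on_flat) (rule bounded_linear_snd)
  show "Ck_on k (\<lambda>p. flat 0 (snd p + 2)) UNIV"
    by (rule Ck_on_flat) (rule bounded_linear_snd)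
  show "Ck_on k (\<lambda>p. flat 0 (- snd p + (- 1))) UNIV"
    by (rule Ck_on_flat) (intro bounded_linear_minus bounded_linear_snd)
  show "flat 0 (snd p + 2) + flat 0 (- snd p + - 1) \<noteq> 0" for p :: spacetime
  proof -
    have "flat 0 (snd p + 2) > 0 \<or> flat 0 (- snd p + - 1) > 0" by (auto simp: flat_def)
    then show ?thesis using flat_0_bounds(1)[of "snd p + 2"] flat_0_bounds(1)[of "- snd p + - 1"] by linarith
  qed
qed

lemma time_cutoff_eq_1: "snd p \<ge> -1 \<Longrightarrow> time_cutoff p = 1"
  by (auto simp: time_cutoff_def flat_def)

lemma time_cutoff_eq_0: "snd p \<le> -2 \<Longrightarrow> time_cutoff p = 0"
  by (auto simp: time_cutoff_def flat_def)

section \<open>The Newton kernel and test functions\<close>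

abbreviation ball3_vol :: real where "ball3_vol \<equiv> unit_ball_vol 3"

lemma pred_ball [measurable]: "Measurable.pred borel (\<lambda>x. x \<in> ball c r)"
  for c :: "'a::euclidean_space"
  by (simp add: pred_def)

section \<open>Integrals of inverse powers of the distance in three dimensions\<close>

lemma dyadic_scale:
  fixes r x :: real
  assumes "0 < x" "x < r"
  obtains k :: nat where "r / 2 ^ (k + 1) \<le> x" "x < r / 2 ^ k"
proof -
  obtain n :: nat where "(1 / 2) ^ n < x / r"
    using real_arch_pow_inv[of "x / r" "1 / 2"] assms by auto
  then have ex: "r / 2 ^ n \<le> x"
    using assms by (auto simp: field_simps power_divide)
  define m where "m = (LEAST n. r / 2 ^ n \<le> x)"
  have m: "r / 2 ^ m \<le> x" unfolding m_def by (rule LeastI[of _ n]) (rule ex)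
  have "m \<noteq> 0" using m assms by (cases m) auto
  then obtain k where k: "m = Suc k" by (cases m) auto
  have "\<not> r / 2 ^ k \<le> x" using not_less_Least[of k "\<lambda>n. r / 2 ^ n \<le> x"] k m_def by auto
  then show ?thesis using that[of k] m k by auto
qed

lemma emeasure_ball3: "r \<ge> 0 \<Longrightarrow> emeasure lborel (ball c r) = ennreal (ball3_vol * r ^ 3)"
  for c :: space
  using emeasure_ball[of r c] by simp

text \<open>Dyadic shells replace polar coordinates: where the distance is at least r / 2^(k+1) the
  integrand is at most 4^(k+1) / r^2, and the ball of radius r / 2^k has volume
  \<open>ball3_vol\<close> * r^3 / 8^k. The products form a geometric series with sum 8 *
  \<open>ball3_vol\<close> * r.\<close>

lemma nn_integral_inverse_square:
  fixes c :: space
  assumes r: "r > 0"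
  shows "(\<integral>\<^sup>+z. ennreal (indicator (ball c r) z / (norm (z - c))\<^sup>2) \<partial>lborel) \<le> ennreal (8 * ball3_vol * r)"
proof -
  let ?g = "\<lambda>k z. ennreal (4 ^ (k + 1) / r\<^sup>2) * indicator (ball c (r / 2 ^ k)) z"
  have le: "ennreal (indicator (ball c r) z / (norm (z - c))\<^sup>2) \<le> (\<Sum>k. ?g k z)" for z
  proof (cases "0 < norm (z - c) \<and> norm (z - c) < r")
    case True
    then obtain k :: nat where k: "r / 2 ^ (k + 1) \<le> norm (z - c)" "norm (z - c) < r / 2 ^ k"
      using dyadic_scale by blast
    have "(r / 2 ^ (k + 1))\<^sup>2 \<le> (norm (z - c))\<^sup>2"
      using k r by (intro power_mono) auto
    moreover have "(r / 2 ^ (k + 1))\<^sup>2 = r\<^sup>2 / 4 ^ (k + 1)"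
    proof -
      have "(2::real) ^ (k + 1) * 2 ^ (k + 1) = 4 ^ (k + 1)" by (simp flip: power_mult_distrib)
      then show ?thesis by (simp add: power2_eq_square)
    qed
    ultimately have "1 / (norm (z - c))\<^sup>2 \<le> 4 ^ (k + 1) / r\<^sup>2"
      using True r by (simp add: divide_simps mult_ac split: if_splits)
    then have "ennreal (indicator (ball c r) z / (norm (z - c))\<^sup>2) \<le> ?g k z"
      using k True by (auto simp: indicator_def dist_norm norm_minus_commute intro!: ennreal_leI)
    also have "\<dots> \<le> (\<Sum>k. ?g k z)"
      using sum_le_suminf[OF summableI, of "{k}" "\<lambda>k. ?g k z"] by (simp del: sum_mult_indicator)
    finally show ?thesis .
  next
    case False
    \<comment> \<open>At the centre the quotient is 0 by the convention x / 0 = 0.\<close>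
    then have "indicator (ball c r) z / (norm (z - c))\<^sup>2 = (0::real)"
      by (auto simp: indicator_def dist_norm norm_minus_commute)
    then show ?thesis by (simp only: ennreal_0 zero_le)
  qed
  have "(\<integral>\<^sup>+z. ennreal (indicator (ball c r) z / (norm (z - c))\<^sup>2) \<partial>lborel) \<le> (\<integral>\<^sup>+z. (\<Sum>k. ?g k z) \<partial>lborel)"
    by (intro nn_integral_mono le)
  also have "\<dots> = (\<Sum>k. \<integral>\<^sup>+z. ?g k z \<partial>lborel)"
    by (rule nn_integral_suminf) (intro borel_measurable_times_ennreal borel_measurable_const borel_measurable_indicator, simp)
  also have "\<dots> = (\<Sum>k. ennreal (4 * ball3_vol * r * (1 / 2) ^ k))"
  proof (rule arg_cong[where f = suminf], rule ext)
    fix k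
    have "(\<integral>\<^sup>+z. ?g k z \<partial>lborel) = ennreal (4 ^ (k + 1) / r\<^sup>2) * ennreal (ball3_vol * (r / 2 ^ k) ^ 3)"
      using r by (subst nn_integral_cmult_indicator) (auto simp: emeasure_ball3)
    also have "\<dots> = ennreal (4 ^ (k + 1) / r\<^sup>2 * (ball3_vol * (r / 2 ^ k) ^ 3))"
      using r by (subst ennreal_mult) auto
    also have "4 ^ (k + 1) / r\<^sup>2 * (ball3_vol * (r / 2 ^ k) ^ 3) = 4 * ball3_vol * r * (1 / 2) ^ k"
    proof -
      have "(4::real) ^ k = 2 ^ k * 2 ^ k" by (simp flip: power_mult_distrib)
      then show ?thesis using r
        by (simp add: field_simps power_divide power2_eq_square power3_eq_cube)
    qed
    finally show "(\<integral>\<^sup>+z. ?g k z \<partial>lborel) = ennreal (4 * ball3_vol * r * (1 / 2) ^ k)" .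
  qed
  also have "\<dots> = ennreal (\<Sum>k. 4 * ball3_vol * r * (1 / 2) ^ k)"
    using r by (intro suminf_ennreal2) (auto intro!: summable_mult)
  also have "(\<Sum>k. 4 * ball3_vol * r * (1 / 2) ^ k) = 4 * ball3_vol * r * 2"
    by (subst suminf_mult) (auto simp: suminf_geometric)
  finally show ?thesis by (simp add: mult_ac)
qed

lemma integrable_inverse_square:
  fixes c :: space
  assumes "r > 0"
  shows "integrable lborel (\<lambda>z. indicator (ball c r) z / (norm (z - c))\<^sup>2)"
    and "(LBINT z. indicator (ball c r) z / (norm (z - c))\<^sup>2) \<le> 8 * ball3_vol * r"
proof -
  let ?f = "\<lambda>z. indicator (ball c r) z / (norm (z - c))\<^sup>2 :: real"
  show i: "integrable lborel ?f"
  proof (rule integrableI_bounded)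
    have "(\<integral>\<^sup>+z. ennreal (norm (?f z)) \<partial>lborel) = (\<integral>\<^sup>+z. ennreal (?f z) \<partial>lborel)"
      by (intro nn_integral_cong) auto
    then show "(\<integral>\<^sup>+z. ennreal (norm (?f z)) \<partial>lborel) < \<infinity>"
      using le_less_trans[OF nn_integral_inverse_square[OF assms, of c] ennreal_less_top] by simp
    have "?f \<in> borel_measurable borel" by measurable
    then show "?f \<in> borel_measurable lborel" by simp
  qed
  show "integral\<^sup>L lborel ?f \<le> 8 * ball3_vol * r"
    using nn_integral_inverse_square[OF assms, of c] assms
    by (subst (asm) nn_integral_eq_integral[OF i]) (auto simp: mult_nonneg_nonneg)
qed

lemma integrable_inverse_norm:
  fixes c :: space
  assumes "r > 0"
  shows "integrable lborel (\<lambda>z. indicator (ball c r) z / norm (z - c))"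
    and "(LBINT z. indicator (ball c r) z / norm (z - c)) \<le> 8 * ball3_vol * r\<^sup>2"
proof -
  have le: "indicator (ball c r) z / norm (z - c) \<le> r * (indicator (ball c r) z / (norm (z - c))\<^sup>2)" for z
    using assms by (auto simp: indicator_def dist_norm norm_minus_commute divide_simps power2_eq_square)
  show i: "integrable lborel (\<lambda>z. indicator (ball c r) z / norm (z - c))"
    by (rule Bochner_Integration.integrable_bound[OF integrable_mult_right[OF integrable_inverse_square(1)[OF assms, of c], of r]])
      (measurable, use le assms in \<open>auto intro!: AE_I2 simp: abs_mult\<close>)
  have "(LBINT z. indicator (ball c r) z / norm (z - c))
     \<le> (LBINT z. r * (indicator (ball c r) z / (norm (z - c))\<^sup>2))"
    by (intro integral_mono i integrable_mult_right integrable_inverse_square assms le)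
  also have "\<dots> \<le> r * (8 * ball3_vol * r)"
    unfolding integral_mult_right_zero using integrable_inverse_square(2)[OF assms, of c] assms
    by (intro mult_left_mono) auto
  finally show "(LBINT z. indicator (ball c r) z / norm (z - c)) \<le> 8 * ball3_vol * r\<^sup>2"
    by (simp add: power2_eq_square mult_ac)
qed

definition newton_kernel :: "space \<Rightarrow> real" where "newton_kernel z = 1 / (4 * pi * norm z)"

lemma newton_kernel_nonneg [simp]: "newton_kernel z \<ge> 0"
  by (simp add: newton_kernel_def)

lemma newton_kernel_measurable [measurable]: "newton_kernel \<in> borel_measurable borel"
  unfolding newton_kernel_def by measurable

lemma integrable_newton_kernel:
  assumes "R > 0"
  shows "integrable lborel (\<lambda>z. indicator (ball 0 R) z * newton_kernel z)"
    and "(LBINT z. indicator (ball 0 R) z * newton_kernel z) \<le> ball3_vol * R\<^sup>2"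
proof -
  have eq: "(\<lambda>z. indicator (ball 0 R) z * newton_kernel z)
    = (\<lambda>z. (1 / (4 * pi)) * (indicator (ball 0 R) z / norm (z - 0)))"
    by (auto simp: newton_kernel_def)
  show "integrable lborel (\<lambda>z. indicator (ball 0 R) z * newton_kernel z)"
    unfolding eq by (intro integrable_mult_right integrable_inverse_norm assms)
  have "(LBINT z. indicator (ball 0 R) z * newton_kernel z) \<le> (1 / (4 * pi)) * (8 * ball3_vol * R\<^sup>2)"
    unfolding eq integral_mult_right_zero
    using integrable_inverse_norm(2)[OF assms, of 0] by (intro mult_left_mono) auto
  also have "\<dots> = (2 / pi) * (ball3_vol * R\<^sup>2)" by simp
  also have "\<dots> \<le> 1 * (ball3_vol * R\<^sup>2)"
    using pi_gt3 by (intro mult_right_mono) auto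
  finally show "(LBINT z. indicator (ball 0 R) z * newton_kernel z) \<le> ball3_vol * R\<^sup>2" by simp
qed

lemma integrable_times_newton_kernel:
  assumes [measurable]: "f \<in> borel_measurable borel" and R: "R > 0"
    and B: "\<And>z. norm z < R \<Longrightarrow> \<bar>f z\<bar> \<le> B" and 0: "\<And>z. norm z \<ge> R \<Longrightarrow> f z = 0"
  shows "integrable lborel (\<lambda>z. f z * newton_kernel z)"
    and "\<bar>LBINT z. f z * newton_kernel z\<bar> \<le> B * (ball3_vol * R\<^sup>2)"
proof -
  have B0: "B \<ge> 0" using B[of 0] R by (smt (verit) norm_zero)
  have le: "\<bar>f z * newton_kernel z\<bar> \<le> B * (indicator (ball 0 R) z * newton_kernel z)" for z
    using B[of z] 0[of z] by (auto simp: abs_mult indicator_def intro!: mult_right_mono)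
  have bi: "integrable lborel (\<lambda>z. B * (indicator (ball 0 R) z * newton_kernel z))"
    by (intro integrable_mult_right integrable_newton_kernel R)
  show i: "integrable lborel (\<lambda>z. f z * newton_kernel z)"
    by (rule Bochner_Integration.integrable_bound[OF bi]) (use le B0 in \<open>auto intro!: AE_I2 simp: abs_mult\<close>)
  have "\<bar>LBINT z. f z * newton_kernel z\<bar> \<le> (LBINT z. B * (indicator (ball 0 R) z * newton_kernel z))"
    using Bochner_Integration.integral_norm_bound_integral[OF i bi] le by simp
  also have "\<dots> \<le> B * (ball3_vol * R\<^sup>2)"
    using integrable_newton_kernel(2)[OF R] B0 by (simp add: mult_left_mono)
  finally show "\<bar>LBINT z. f z * newton_kernel z\<bar> \<le> B * (ball3_vol * R\<^sup>2)" .
qed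

text \<open>The solution of the backward problem for the free wave equation with source \<open>f\<close>.\<close>

definition adv_potential :: "(spacetime \<Rightarrow> real) \<Rightarrow> spacetime \<Rightarrow> real" where
  "adv_potential f p = (LBINT z. f (p + (z, norm z)) * newton_kernel z)"

lemma singular_part_eq: "singular_part f = (LBINT z. f (z, norm z) * newton_kernel z)"
  by (simp add: singular_part_def newton_kernel_def)

lemma adv_potential_eq_singular_part:
  "adv_potential f p = singular_part (\<lambda>y. f (p + y))"
  by (simp add: adv_potential_def singular_part_eq)

lemma adv_potential_measurable [measurable]:
  assumes [measurable]: "f \<in> borel_measurable borel"
  shows "adv_potential f \<in> borel_measurable borel"
  unfolding adv_potential_def by measurable

lemma adv_potential_bounded:
  assumes [measurable]: "f \<in> borel_measurable borel" and R: "R > 0"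
    and "\<And>z. norm z < R \<Longrightarrow> \<bar>f (p + (z, norm z))\<bar> \<le> B"
    and "\<And>z. norm z \<ge> R \<Longrightarrow> f (p + (z, norm z)) = 0"
  shows "integrable lborel (\<lambda>z. f (p + (z, norm z)) * newton_kernel z)"
    and "\<bar>adv_potential f p\<bar> \<le> B * (ball3_vol * R\<^sup>2)"
proof -
  have "(\<lambda>z::space. p + (z, norm z)) \<in> borel_measurable borel"
    by (rule borel_measurable_continuous_onI) (intro continuous_intros)
  then have m: "(\<lambda>z. f (p + (z, norm z))) \<in> borel_measurable borel"
    using assms(1) by (rule measurable_compose)
  note * = integrable_times_newton_kernel[OF m R assms(3,4)]
  show "integrable lborel (\<lambda>z. f (p + (z, norm z)) * newton_kernel z)" by (rule *)
  show "\<bar>adv_potential f p\<bar> \<le> B * (ball3_vol * R\<^sup>2)"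
    unfolding adv_potential_def by (rule *)
qed

section \<open>Compactly supported functions and test functions\<close>

lemma fun_supportI: "f p \<noteq> 0 \<Longrightarrow> p \<in> fun_support f"
  using closure_subset[of "{p. f p \<noteq> 0}"] by (auto simp: fun_support_def)

lemma compact_fun_support_iff:
  "compact (fun_support f) \<longleftrightarrow> (\<exists>R>0. \<forall>p. norm p \<ge> R \<longrightarrow> f p = 0)" for f :: "'a::euclidean_space \<Rightarrow> real"
proof
  assume "compact (fun_support f)"
  then obtain R where "\<forall>p\<in>fun_support f. norm p \<le> R" using compact_imp_bounded bounded_iff by blast
  then have "\<forall>p. norm p \<ge> max R 0 + 1 \<longrightarrow> f p = 0" using fun_supportI by fastforce
  then show "\<exists>R>0. \<forall>p. norm p \<ge> R \<longrightarrow> f p = 0"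
    by (intro exI[of _ "max R 0 + 1"]) auto
next
  assume "\<exists>R>0. \<forall>p. norm p \<ge> R \<longrightarrow> f p = 0"
  then have "bounded {p. f p \<noteq> 0}" unfolding bounded_iff by (metis mem_Collect_eq nle_le)
  then show "compact (fun_support f)" by (simp add: fun_support_def compact_closure)
qed

lemma CcE:
  assumes "f \<in> Cc"
  obtains R B where "R > 0" "\<And>p. norm p \<ge> R \<Longrightarrow> f p = 0" "\<And>p. \<bar>f p\<bar> \<le> B"
    "f \<in> borel_measurable borel"
proof -
  obtain R where R: "R > 0" "\<And>p. norm p \<ge> R \<Longrightarrow> f p = 0"
    using assms by (auto simp: Cc_def compact_fun_support_iff)
  have c: "continuous_on UNIV f" using assms by (auto simp: Cc_def)
  then have "bounded (f ` cball 0 R)"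
    by (intro compact_imp_bounded compact_continuous_image continuous_on_subset[OF c]) auto
  then obtain B where B: "\<forall>p\<in>cball 0 R. \<bar>f p\<bar> \<le> B" unfolding bounded_iff by auto
  have B0: "0 \<le> B" using B[THEN bspec, of 0] R by (auto intro: order_trans[OF abs_ge_zero])
  have "\<bar>f p\<bar> \<le> B" for p
    using B R(2)[of p] B0 by (cases "norm p \<ge> R") auto
  then show ?thesis using that R borel_measurable_continuous_onI[OF c] by blast
qed

lemma test_functions_iff:
  "f \<in> test_functions \<longleftrightarrow> (\<forall>k. Ck_on k f UNIV) \<and> (\<exists>R>0. \<forall>p. norm p \<ge> R \<longrightarrow> f p = 0)"
  by (simp add: test_functions_def compact_fun_support_iff)

lemma test_functions_Ck_on: "f \<in> test_functions \<Longrightarrow> Ck_on k f UNIV"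
  by (simp add: test_functions_def)

lemma test_functions_Cc: "f \<in> test_functions \<Longrightarrow> f \<in> Cc"
  using Ck_on_imp_continuous_on by (auto simp: test_functions_def Cc_def)

lemma dir_deriv_cong_open:
  assumes "open U" "p \<in> U" "\<And>y. y \<in> U \<Longrightarrow> f y = g y"
  shows "dir_deriv d f p = dir_deriv d g p"
proof -
  have "(f has_derivative f') (at p) \<longleftrightarrow> (g has_derivative f') (at p)" for f'
    using has_derivative_transform_within_open[of f f' p UNIV U g]
      has_derivative_transform_within_open[of g f' p UNIV U f] assms by auto
  then show ?thesis by (simp add: dir_deriv_def frechet_derivative_def)
qed

lemma dir_deriv_eq_0_outside:
  fixes f :: "'a::euclidean_space \<Rightarrow> real"
  assumes "\<And>p. norm p \<ge> R \<Longrightarrow> f p = 0" "norm p > R"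
  shows "dir_deriv d f p = 0"
proof -
  have "dir_deriv d f p = dir_deriv d (\<lambda>_. 0) p"
  proof (rule dir_deriv_cong_open[where U = "- cball 0 R"])
    show "open (- cball (0::'a) R)" by (simp add: closed_cball open_Compl)
  qed (use assms in auto)
  also have "\<dots> = 0" by (rule dir_deriv_eq[OF has_derivative_const])
  finally show ?thesis .
qed

lemma test_functions_dir_deriv:
  assumes "f \<in> test_functions" shows "dir_deriv d f \<in> test_functions"
proof -
  obtain R where R: "R > 0" "\<And>p. norm p \<ge> R \<Longrightarrow> f p = 0"
    using assms by (auto simp: test_functions_iff)
  have "dir_deriv d f p = 0" if "norm p \<ge> R + 1" for p
    using dir_deriv_eq_0_outside[of R f p d] R that by auto
  moreover have "Ck_on k (dir_deriv d f) UNIV" for k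
    using test_functions_Ck_on[OF assms, of "Suc k"] unfolding Ck_on.simps by blast
  ultimately show ?thesis using R by (auto simp: test_functions_iff intro!: exI[of _ "R + 1"])
qed

lemma test_functions_affine_comp:
  assumes "f \<in> test_functions" "c \<noteq> 0"
  shows "(\<lambda>p. f (c *\<^sub>R p + a)) \<in> test_functions"
proof -
  obtain R where R: "R > 0" "\<And>p. norm p \<ge> R \<Longrightarrow> f p = 0"
    using assms by (auto simp: test_functions_iff)
  have "f (c *\<^sub>R p + a) = 0" if "norm p \<ge> (R + norm a) / \<bar>c\<bar>" for p
  proof (rule R(2))
    have "R + norm a \<le> norm (c *\<^sub>R p)" using that assms by (simp add: field_simps)
    then show "R \<le> norm (c *\<^sub>R p + a)" using norm_diff_ineq[of "c *\<^sub>R p" a] by linarith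
  qed
  moreover have "(R + norm a) / \<bar>c\<bar> > 0" using R assms by (intro divide_pos_pos add_pos_nonneg) auto
  ultimately show ?thesis using assms by (auto simp: test_functions_iff intro: Ck_on_affine_comp)
qed

lemma test_functions_differentiable: "f \<in> test_functions \<Longrightarrow> f differentiable at p"
  using test_functions_Ck_on[of f "Suc 0"] unfolding Ck_on.simps by blast

lemma dir_deriv_linear: "f differentiable at p \<Longrightarrow> linear (\<lambda>d. dir_deriv d f p)"
  using has_derivative_dir_deriv has_derivative_linear by blast

lemma dir_deriv_bound:
  fixes f :: "'a::euclidean_space \<Rightarrow> real" and B :: real
  assumes "f differentiable at p" "\<And>b. b \<in> Basis \<Longrightarrow> \<bar>dir_deriv b f p\<bar> \<le> (B::real)"
  shows "\<bar>dir_deriv d f p\<bar> \<le> (DIM('a) * B) * norm d"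
proof -
  have "dir_deriv d f p = dir_deriv (\<Sum>b\<in>Basis. (d \<bullet> b) *\<^sub>R b) f p"
    by (simp add: euclidean_representation)
  also have "\<dots> = (\<Sum>b\<in>Basis. (d \<bullet> b) * dir_deriv b f p)"
    by (simp add: linear_sum[OF dir_deriv_linear[OF assms(1)]] linear_cmul[OF dir_deriv_linear[OF assms(1)]])
  finally have "\<bar>dir_deriv d f p\<bar> \<le> (\<Sum>b\<in>Basis. \<bar>(d \<bullet> b) * dir_deriv b f p\<bar>)"
    using sum_abs by metis
  also have "\<dots> \<le> (\<Sum>b\<in>(Basis::'a set). norm d * B)"
    unfolding abs_mult by (intro sum_mono mult_mono assms Basis_le_norm) auto
  finally show ?thesis by (simp add: mult_ac)
qed

lemma test_functions_Lipschitz: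
  assumes "f \<in> test_functions"
  obtains L where "L \<ge> 0" "\<And>p d. \<bar>dir_deriv d f p\<bar> \<le> L * norm d" "\<And>p p'. \<bar>f p' - f p\<bar> \<le> L * norm (p' - p)"
proof -
  have "\<exists>B. \<forall>p. \<bar>dir_deriv b f p\<bar> \<le> B" for b
    by (rule CcE[OF test_functions_Cc[OF test_functions_dir_deriv[OF assms, of b]]]) blast
  then obtain B where B: "\<And>b p. \<bar>dir_deriv b f p\<bar> \<le> B b" by metis
  define C where "C = (\<Sum>b\<in>Basis. B b)"
  have "B b \<ge> 0" for b using B[of b 0] by linarith
  then have "\<bar>dir_deriv b f p\<bar> \<le> C" if "b \<in> Basis" for b p
    using B[of b p] member_le_sum[of b Basis B] that by (fastforce simp: C_def)
  then have D: "\<bar>dir_deriv d f p\<bar> \<le> (DIM(spacetime) * C) * norm d" for d p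
    using dir_deriv_bound test_functions_differentiable[OF assms] by blast
  have C0: "C \<ge> 0" using \<open>\<And>b. B b \<ge> 0\<close> by (auto simp: C_def intro: sum_nonneg)
  have "norm (f p' - f p) \<le> (DIM(spacetime) * C) * norm (p' - p)" for p p'
    by (rule differentiable_bound[where S = UNIV and f' = "\<lambda>p d. dir_deriv d f p"])
      (use D C0 in \<open>auto intro!: onorm_le has_derivative_dir_deriv test_functions_differentiable[OF assms]\<close>)
  then show ?thesis using that[of "DIM(spacetime) * C"] D C0 by auto
qed

text \<open>The remainder is uniform in \<open>p\<close>, which allows it to be integrated over a
  whole shifted light cone when \<open>adv_potential\<close> is differentiated. It follows from the
  mean value inequality, the directional derivatives being Lipschitz.\<close>

lemma test_functions_Taylor:
  assumes f: "f \<in> test_functions"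
  obtains C where "C \<ge> 0" "\<And>p h. \<bar>f (p + h) - f p - dir_deriv h f p\<bar> \<le> C * (norm h)\<^sup>2"
proof -
  have "\<exists>L. \<forall>p p'. \<bar>dir_deriv b f p' - dir_deriv b f p\<bar> \<le> L * norm (p' - p)" for b
    by (rule test_functions_Lipschitz[OF test_functions_dir_deriv[OF f, of b]]) blast
  then obtain L where L: "\<And>b p p'. \<bar>dir_deriv b f p' - dir_deriv b f p\<bar> \<le> L b * norm (p' - p)" by metis
  have L0: "L b \<ge> 0" for b :: spacetime
    using L[where b = b and p = 0 and p' = "(0,1)"] by (simp add: norm_Pair)
  define C where "C = (\<Sum>b\<in>Basis. L b)"
  have C0: "C \<ge> 0" using L0 by (auto simp: C_def intro: sum_nonneg)
  have LC: "L b \<le> C" if "b \<in> Basis" for b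
    using member_le_sum[of b Basis L] that L0 by (auto simp: C_def)
  note lin = dir_deriv_linear[OF test_functions_differentiable[OF f]]
  have D: "\<bar>dir_deriv d f p' - dir_deriv d f p\<bar> \<le> (DIM(spacetime) * C * norm (p' - p)) * norm d" for d p p'
  proof -
    have "dir_deriv d f p' - dir_deriv d f p = (\<Sum>b\<in>Basis. (d \<bullet> b) * (dir_deriv b f p' - dir_deriv b f p))"
    proof -
      have "dir_deriv d f p = dir_deriv (\<Sum>b\<in>Basis. (d \<bullet> b) *\<^sub>R b) f p" for p
        by (simp add: euclidean_representation)
      then have "dir_deriv d f p = (\<Sum>b\<in>Basis. (d \<bullet> b) * dir_deriv b f p)" for p
        by (simp add: linear_sum[OF lin] linear_cmul[OF lin])
      then show ?thesis by (simp add: right_diff_distrib sum_subtractf)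
    qed
    then have "\<bar>dir_deriv d f p' - dir_deriv d f p\<bar> \<le> (\<Sum>b\<in>Basis. \<bar>(d \<bullet> b) * (dir_deriv b f p' - dir_deriv b f p)\<bar>)"
      by (simp only: sum_abs)
    also have "\<dots> \<le> (\<Sum>b\<in>(Basis::spacetime set). norm d * (C * norm (p' - p)))"
      unfolding abs_mult
    proof (intro sum_mono mult_mono Basis_le_norm)
      fix b :: spacetime assume "b \<in> Basis"
      then show "\<bar>dir_deriv b f p' - dir_deriv b f p\<bar> \<le> C * norm (p' - p)"
        using L[of b p' p] LC[of b] by (meson mult_right_mono norm_ge_zero order_trans)
    qed auto
    finally show ?thesis by (simp add: mult_ac)
  qed
  have "\<bar>f (p + h) - f p - dir_deriv h f p\<bar> \<le> (DIM(spacetime) * C) * (norm h)\<^sup>2" for p h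
  proof -
    \<comment> \<open>Mean value inequality for \<open>f\<close> minus its linearisation at
      \<open>p\<close>. As \<open>dir_deriv y f p\<close> is linear in \<open>y\<close>, it is its
      own derivative, and a position may be inserted where a direction is expected.\<close>
    have "norm ((f (p + h) - dir_deriv (p + h) f p) - (f p - dir_deriv p f p))
       \<le> (DIM(spacetime) * C * norm h) * norm ((p + h) - p)"
    proof (rule differentiable_bound[where S = "cball p (norm h)" and f' = "\<lambda>y d. dir_deriv d f y - dir_deriv d f p"])
      fix y assume y: "y \<in> cball p (norm h)"
      have "(f has_derivative (\<lambda>d. dir_deriv d f y)) (at y within cball p (norm h))"
        using has_derivative_dir_deriv test_functions_differentiable[OF f] has_derivative_at_withinI by blast
      moreover have "((\<lambda>y. dir_deriv y f p) has_derivative (\<lambda>d. dir_deriv d f p)) (at y within cball p (norm h))"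
        using lin by (simp add: bounded_linear_imp_has_derivative linear_conv_bounded_linear)
      ultimately show "((\<lambda>y. f y - dir_deriv y f p) has_derivative (\<lambda>d. dir_deriv d f y - dir_deriv d f p)) (at y within cball p (norm h))"
        by (rule has_derivative_diff)
      have "(DIM(spacetime) * C * norm (y - p)) * norm d \<le> (DIM(spacetime) * C * norm h) * norm d" for d :: spacetime
        using y C0 by (intro mult_right_mono mult_left_mono) (auto simp: dist_norm norm_minus_commute)
      then show "onorm (\<lambda>d. dir_deriv d f y - dir_deriv d f p) \<le> DIM(spacetime) * C * norm h"
        using order_trans[OF D[of _ y p]] by (intro onorm_le) (simp only: real_norm_def)
    qed (auto simp: dist_norm)
    then show ?thesis by (simp add: linear_add[OF lin] power2_eq_square mult_ac algebra_simps)
  qed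
  then show ?thesis using that[of "DIM(spacetime) * C"] C0 by auto
qed

section \<open>The advanced potential and the free wave equation\<close>

lemma measurable_retarded_shift [measurable]:
  "(\<lambda>z::space. p + (z, norm z)) \<in> borel_measurable borel"
  by (rule borel_measurable_continuous_onI) (intro continuous_intros)

lemma Cc_measurable: "f \<in> Cc \<Longrightarrow> f \<in> borel_measurable borel"
  unfolding Cc_def by (blast intro: borel_measurable_continuous_onI)

lemma integrable_newton_kernel_Cc:
  assumes "f \<in> Cc"
  shows "integrable lborel (\<lambda>z. f (p + (z, norm z)) * newton_kernel z)"
proof -
  obtain R B where R: "R > 0" "\<And>p. norm p \<ge> R \<Longrightarrow> f p = 0" "\<And>p. \<bar>f p\<bar> \<le> B" "f \<in> borel_measurable borel"
    using CcE[OF assms] by blast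
  have "f (p + (z, norm z)) = 0" if "norm z \<ge> R + norm p" for z
  proof (rule R(2))
    have "norm z \<le> norm (z, norm z)" by (metis norm_fst_le fst_conv)
    then show "R \<le> norm (p + (z, norm z))" using norm_diff_ineq[of "(z, norm z)" p] that by (simp add: add.commute)
  qed
  then show ?thesis
    using R by (intro adv_potential_bounded(1)[where R = "R + norm p" and B = B]) (auto intro: add_pos_nonneg)
qed

lemma adv_potential_add:
  "f \<in> Cc \<Longrightarrow> g \<in> Cc \<Longrightarrow> adv_potential (\<lambda>p. f p + g p) p = adv_potential f p + adv_potential g p"
  unfolding adv_potential_def
  by (simp add: distrib_right integrable_newton_kernel_Cc)

lemma adv_potential_diff:
  "f \<in> Cc \<Longrightarrow> g \<in> Cc \<Longrightarrow> adv_potential (\<lambda>p. f p - g p) p = adv_potential f p - adv_potential g p"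
  unfolding adv_potential_def
  by (simp add: left_diff_distrib integrable_newton_kernel_Cc)

lemma adv_potential_cmult:
  "adv_potential (\<lambda>p. c * f p) p = c * adv_potential f p"
  unfolding adv_potential_def by (simp add: mult.assoc)

lemma adv_potential_sum:
  "(\<And>i. i \<in> I \<Longrightarrow> f i \<in> Cc) \<Longrightarrow>
   adv_potential (\<lambda>p. \<Sum>i\<in>I. f i p) p = (\<Sum>i\<in>I. adv_potential (f i) p)"
  unfolding adv_potential_def
  by (simp add: sum_distrib_right integrable_newton_kernel_Cc Bochner_Integration.integral_sum)

text \<open>The potential is linear in its source, so the Taylor remainder of the potential is the
  potential of the Taylor remainder \<open>?g\<close> of \<open>f\<close>. The latter is O(|h|^2)
  and, for |h| <= 1, vanishes on the shifted cone outside a fixed ball, over which the Newton kernel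
  has finite mass.\<close>

lemma adv_potential_has_derivative:
  assumes f: "f \<in> test_functions"
  shows "(adv_potential f has_derivative (\<lambda>d. adv_potential (dir_deriv d f) p)) (at p)"
proof -
  let ?D = "\<lambda>d. adv_potential (dir_deriv d f) p"
  note df = test_functions_Cc[OF test_functions_dir_deriv[OF f]]
  note lin = dir_deriv_linear[OF test_functions_differentiable[OF f]]
  have "linear ?D"
  proof (rule linearI)
    show "?D (a + b) = ?D a + ?D b" for a b
      using adv_potential_add[OF df df, of a b p] linear_add[OF lin, of a b] by (metis (no_types, lifting) ext)
    show "?D (c *\<^sub>R a) = c *\<^sub>R ?D a" for c a
    proof -
      have "dir_deriv (c *\<^sub>R a) f = (\<lambda>p. c * dir_deriv a f p)"
        using linear_cmul[OF lin, of c a] by (intro ext) simp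
      then show ?thesis by (simp add: adv_potential_cmult)
    qed
  qed
  then have bl: "bounded_linear ?D" by (simp add: linear_conv_bounded_linear)
  obtain C where C: "C \<ge> 0" "\<And>p h. \<bar>f (p + h) - f p - dir_deriv h f p\<bar> \<le> C * (norm h)\<^sup>2"
    using test_functions_Taylor[OF f] by blast
  obtain R where R: "R > 0" "\<And>p. norm p \<ge> R \<Longrightarrow> f p = 0"
    using f unfolding test_functions_iff by blast
  \<comment> \<open>The margin 2 leaves room for the shift by \<open>h\<close> with |h| <= 1 and for
    the strict inequality needed to make the derivative of \<open>f\<close> vanish.\<close>
  define S where "S = R + 2 + norm p"
  have S: "S > 0" using R by (auto simp: S_def intro: add_pos_nonneg)
  have bound: "\<bar>adv_potential f (p + h) - adv_potential f p - ?D h\<bar>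
      \<le> C * (norm h)\<^sup>2 * (ball3_vol * S\<^sup>2)" if h: "norm h \<le> 1" for h
  proof -
    let ?g = "\<lambda>y. f (y + h) - f y - dir_deriv h f y"
    have fm [measurable]: "f \<in> borel_measurable borel" "dir_deriv h f \<in> borel_measurable borel"
      by (intro Cc_measurable test_functions_Cc[OF f] df)+
    have "(\<lambda>y. f (y + h)) \<in> borel_measurable borel"
      by (rule measurable_compose[OF _ fm(1)]) (rule borel_measurable_continuous_onI, intro continuous_intros)
    then have g: "?g \<in> borel_measurable borel" by measurable
    have "?g (p + (z, norm z)) = 0" if "norm z \<ge> S" for z
    proof -
      have "norm z \<le> norm (z, norm z)" by (metis norm_fst_le fst_conv)
      then have n: "norm (p + (z, norm z)) \<ge> R + 2"
        using norm_diff_ineq[of "(z, norm z)" p] that by (simp add: add.commute S_def)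
      then have "norm (p + (z, norm z) + h) \<ge> R" using h norm_diff_ineq[of "p + (z, norm z)" h] by linarith
      then show ?thesis using R n dir_deriv_eq_0_outside[of R f "p + (z, norm z)" h] by simp
    qed
    then have "\<bar>adv_potential ?g p\<bar> \<le> C * (norm h)\<^sup>2 * (ball3_vol * S\<^sup>2)"
      by (intro adv_potential_bounded(2)[OF g S]) (use C in auto)
    moreover have "adv_potential ?g p = adv_potential f (p + h) - adv_potential f p - ?D h"
    proof -
      have i1: "integrable lborel (\<lambda>z. f (p + h + (z, norm z)) * newton_kernel z)"
        and i2: "integrable lborel (\<lambda>z. f (p + (z, norm z)) * newton_kernel z)"
        and i3: "integrable lborel (\<lambda>z. dir_deriv h f (p + (z, norm z)) * newton_kernel z)"
        using integrable_newton_kernel_Cc test_functions_Cc[OF f] df by blast+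
      have "adv_potential ?g p = (LBINT z. f (p + h + (z, norm z)) * newton_kernel z
         - f (p + (z, norm z)) * newton_kernel z - dir_deriv h f (p + (z, norm z)) * newton_kernel z)"
        unfolding adv_potential_def by (simp add: left_diff_distrib add_ac)
      also have "\<dots> = adv_potential f (p + h) - adv_potential f p - ?D h"
        unfolding adv_potential_def using i1 i2 i3 by simp
      finally show ?thesis .
    qed
    ultimately show ?thesis by simp
  qed
  have "((\<lambda>h. norm (adv_potential f (p + h) - adv_potential f p - ?D h) / norm h) \<longlongrightarrow> 0) (at 0)"
  proof (rule Lim_null_comparison)
    have "eventually (\<lambda>h::spacetime. norm h < 1) (at 0)"
      using eventually_at_ball[of 1 "0::spacetime" UNIV] by (simp add: dist_norm)
    then show "\<forall>\<^sub>F h in at 0. norm (norm (adv_potential f (p + h) - adv_potential f p - ?D h) / norm h)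
       \<le> C * (ball3_vol * S\<^sup>2) * norm h"
    proof eventually_elim
      case (elim h)
      then show ?case using bound[of h]
        by (cases "h = 0") (auto simp: divide_simps power2_eq_square mult_ac)
    qed
    show "((\<lambda>h::spacetime. C * (ball3_vol * S\<^sup>2) * norm h) \<longlongrightarrow> 0) (at 0)"
      by (auto intro!: tendsto_eq_intros)
  qed
  then show ?thesis using bl by (simp add: has_derivative_at)
qed

lemma dir_deriv_adv_potential:
  "f \<in> test_functions \<Longrightarrow> dir_deriv d (adv_potential f) = adv_potential (dir_deriv d f)"
  using dir_deriv_eq[OF adv_potential_has_derivative] by blast

lemma Ck_on_adv_potential: "f \<in> test_functions \<Longrightarrow> Ck_on k (adv_potential f) UNIV"
proof (induction k arbitrary: f)
  case 0
  then show ?case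
    using adv_potential_has_derivative[OF 0] has_derivative_continuous continuous_at_imp_continuous_on
    by (metis Ck_on.simps(1))
next
  case (Suc k)
  show ?case
    by (rule Ck_on_SucI[OF adv_potential_has_derivative[OF Suc.prems]])
      (rule Suc.IH[OF test_functions_dir_deriv[OF Suc.prems]])
qed

lemma test_functions_add:
  assumes "f \<in> test_functions" "g \<in> test_functions"
  shows "(\<lambda>p. f p + g p) \<in> test_functions"
proof -
  obtain R R' where "R > 0" "\<forall>p. norm p \<ge> R \<longrightarrow> f p = 0" "R' > 0" "\<forall>p. norm p \<ge> R' \<longrightarrow> g p = 0"
    using assms unfolding test_functions_iff by blast
  then have "max R R' > 0 \<and> (\<forall>p. norm p \<ge> max R R' \<longrightarrow> f p + g p = 0)" by simp
  then show ?thesis using assms unfolding test_functions_iff by (blast intro: Ck_on_add)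
qed

lemma test_functions_mult:
  assumes "f \<in> test_functions" "\<And>k. Ck_on k g UNIV"
  shows "(\<lambda>p. g p * f p) \<in> test_functions"
proof -
  obtain R where "R > 0" "\<forall>p. norm p \<ge> R \<longrightarrow> f p = 0"
    using assms unfolding test_functions_iff by blast
  then have "R > 0 \<and> (\<forall>p. norm p \<ge> R \<longrightarrow> g p * f p = 0)" by simp
  then show ?thesis using assms unfolding test_functions_iff by (blast intro: Ck_on_mult)
qed

lemma test_functions_cmult: "f \<in> test_functions \<Longrightarrow> (\<lambda>p. c * f p) \<in> test_functions"
  using test_functions_mult[OF _ Ck_on_const] by blast

lemma test_functions_diff:
  "f \<in> test_functions \<Longrightarrow> g \<in> test_functions \<Longrightarrow> (\<lambda>p. f p - g p) \<in> test_functions"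
  using test_functions_add[OF _ test_functions_cmult, of f g "-1"] by simp

lemma test_functions_zero: "(\<lambda>p. 0) \<in> test_functions"
  unfolding test_functions_iff by (auto intro: Ck_on_const exI[of _ 1])

lemma test_functions_sum:
  "finite I \<Longrightarrow> (\<And>i. i \<in> I \<Longrightarrow> f i \<in> test_functions) \<Longrightarrow> (\<lambda>p. \<Sum>i\<in>I. f i p) \<in> test_functions"
  by (induction I rule: finite_induct) (auto intro: test_functions_add test_functions_zero)

lemma wave_op_test_functions: "f \<in> test_functions \<Longrightarrow> wave_op f \<in> test_functions"
  unfolding wave_op_def[abs_def]
  by (intro test_functions_diff test_functions_sum test_functions_dir_deriv) auto

lemma wave_op_adv_potential:
  assumes "f \<in> test_functions"
  shows "wave_op (adv_potential f) p = adv_potential (wave_op f) p"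
proof -
  have c: "dir_deriv d (dir_deriv d f) \<in> Cc" for d
    using assms test_functions_Cc test_functions_dir_deriv by blast
  have s: "(\<lambda>p. \<Sum>b\<in>Basis. dir_deriv (b::space, 0) (dir_deriv (b, 0) f) p) \<in> Cc"
    using assms by (intro test_functions_Cc test_functions_sum test_functions_dir_deriv) auto
  show ?thesis
    unfolding wave_op_def[abs_def]
    by (simp add: adv_potential_diff[OF c s] adv_potential_sum[OF c]
        dir_deriv_adv_potential assms test_functions_dir_deriv)
qed

lemma wave_op_pot_Cc:
  assumes "f \<in> test_functions" "continuous_on UNIV q"
  shows "wave_op_pot q f \<in> Cc"
proof -
  obtain R R' where R: "R > 0" "\<forall>p. norm p \<ge> R \<longrightarrow> f p = 0" "R' > 0" "\<forall>p. norm p \<ge> R' \<longrightarrow> wave_op f p = 0"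
    using assms(1) wave_op_test_functions[OF assms(1)] unfolding test_functions_iff by blast
  then have "max R R' > 0 \<and> (\<forall>p. norm p \<ge> max R R' \<longrightarrow> wave_op_pot q f p = 0)"
    by (simp add: wave_op_pot_def)
  moreover have "continuous_on UNIV (wave_op_pot q f)"
    unfolding wave_op_pot_def[abs_def]
    using Ck_on_imp_continuous_on[OF test_functions_Ck_on[OF assms(1)]]
      Ck_on_imp_continuous_on[OF test_functions_Ck_on[OF wave_op_test_functions[OF assms(1)]]]
    by (intro continuous_intros continuous_on_compose2[OF assms(2)]) auto
  ultimately show ?thesis unfolding Cc_def compact_fun_support_iff by blast
qed

section \<open>Scaling and crude bounds for integrals over balls\<close>

lemma lborel_integral_scale:
  fixes f :: "'a::euclidean_space \<Rightarrow> real"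
  assumes [measurable]: "f \<in> borel_measurable borel" and c: "c > 0"
  shows "(LBINT x. f x) = c ^ DIM('a) * (LBINT x. f (c *\<^sub>R x))"
proof -
  have [measurable]: "(\<lambda>x::'a. 0 + c *\<^sub>R x) \<in> borel_measurable borel" by simp
  have "(LBINT x. f x) = (\<integral>x. f x \<partial>density (distr lborel borel (\<lambda>x::'a. 0 + c *\<^sub>R x)) (\<lambda>_. \<bar>c\<bar> ^ DIM('a)))"
    using lborel_affine[of c "0::'a"] c by simp
  also have "\<dots> = (\<integral>x. \<bar>c\<bar> ^ DIM('a) * f x \<partial>distr lborel borel (\<lambda>x::'a. 0 + c *\<^sub>R x))"
    using c by (subst integral_density) auto
  also have "\<dots> = (LBINT x. \<bar>c\<bar> ^ DIM('a) * f (0 + c *\<^sub>R x))"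
    by (subst integral_distr) auto
  finally show ?thesis using c by simp
qed

lemma abs_integral_le_ball:
  fixes f :: "'a::euclidean_space \<Rightarrow> real"
  assumes r: "r \<ge> 0" and B: "\<And>x. norm x < r \<Longrightarrow> \<bar>f x\<bar> \<le> B" and 0: "\<And>x. norm x \<ge> r \<Longrightarrow> f x = 0"
    and B0: "B \<ge> 0"
  shows "\<bar>LBINT x. f x\<bar> \<le> B * (unit_ball_vol (DIM('a)) * r ^ DIM('a))"
proof (cases "integrable lborel f")
  case True
  have i: "integrable lborel (\<lambda>x. B * indicator (ball (0::'a) r) x)"
    by (intro integrable_mult_right integrable_real_indicator emeasure_bounded_finite) auto
  have "\<bar>LBINT x. f x\<bar> \<le> (LBINT x. B * indicator (ball (0::'a) r) x)"
    using Bochner_Integration.integral_norm_bound_integral[OF True i] B 0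
    by (force simp: indicator_def)
  also have "\<dots> = B * measure lborel (ball (0::'a) r)" by simp
  also have "\<dots> = B * (unit_ball_vol (DIM('a)) * r ^ DIM('a))"
    using content_ball[OF r, of "0::'a"] by simp
  finally show ?thesis .
next
  \<comment> \<open>A function that is not integrable has Bochner integral 0 by convention.\<close>
  case False
  then show ?thesis using r B0 by (simp add: not_integrable_integral_eq)
qed

lemma integrable_bounded_ball:
  fixes f :: "'a::euclidean_space \<Rightarrow> real"
  assumes [measurable]: "f \<in> borel_measurable borel"
    and B: "\<And>x. norm x < r \<Longrightarrow> \<bar>f x\<bar> \<le> B" and 0: "\<And>x. norm x \<ge> r \<Longrightarrow> f x = 0"
  shows "integrable lborel f"
proof (rule Bochner_Integration.integrable_bound)
  show "integrable lborel (\<lambda>x. \<bar>B\<bar> * indicator (ball (0::'a) r) x)"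
    by (intro integrable_mult_right integrable_real_indicator emeasure_bounded_finite) auto
  show "AE x in lborel. norm (f x) \<le> norm (\<bar>B\<bar> * indicator (ball 0 r) x)"
    using B 0 by (force simp: indicator_def intro!: AE_I2)
qed simp

lemma continuous_bounded_ball:
  fixes f :: "'a::euclidean_space \<Rightarrow> real"
  assumes "continuous_on UNIV f"
  obtains B where "B \<ge> 0" "\<And>x. norm x \<le> r \<Longrightarrow> \<bar>f x\<bar> \<le> B"
proof -
  have "bounded (f ` cball 0 r)"
    by (intro compact_imp_bounded compact_continuous_image continuous_on_subset[OF assms]) auto
  then obtain B where "\<forall>x\<in>cball 0 r. \<bar>f x\<bar> \<le> B" unfolding bounded_iff by auto
  then show ?thesis using that[of "max B 0"] by (auto simp: le_max_iff_disj)
qed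

lemma singular_part_diff:
  "f \<in> Cc \<Longrightarrow> g \<in> Cc \<Longrightarrow> singular_part (\<lambda>p. f p - g p) = singular_part f - singular_part g"
  using adv_potential_diff[of f g 0] by (simp add: adv_potential_eq_singular_part)

lemma wave_op_affine_comp:
  assumes "f \<in> test_functions"
  shows "wave_op (\<lambda>p. f (c *\<^sub>R p + a)) p = c\<^sup>2 * wave_op f (c *\<^sub>R p + a)"
proof -
  have "dir_deriv d (dir_deriv d (\<lambda>p. f (c *\<^sub>R p + a))) p = c\<^sup>2 * dir_deriv d (dir_deriv d f) (c *\<^sub>R p + a)" for d p
  proof -
    have 1: "dir_deriv d (\<lambda>p. f (c *\<^sub>R p + a)) = (\<lambda>p. c * dir_deriv d f (c *\<^sub>R p + a))"
      using dir_deriv_affine_comp[OF test_functions_differentiable[OF assms], of d c a] by (intro ext) simp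
    have "dir_deriv d (\<lambda>p. (\<lambda>y. c * dir_deriv d f y) (c *\<^sub>R p + a)) p
       = c * dir_deriv d (\<lambda>y. c * dir_deriv d f y) (c *\<^sub>R p + a)"
      by (rule dir_deriv_affine_comp)
        (intro test_functions_differentiable test_functions_cmult test_functions_dir_deriv assms)
    moreover have "dir_deriv d (\<lambda>y. c * dir_deriv d f y) y = c * dir_deriv d (dir_deriv d f) y" for y
      by (rule dir_deriv_eq) (intro has_derivative_mult_right has_derivative_dir_deriv
          test_functions_differentiable test_functions_dir_deriv assms)
    ultimately show ?thesis using 1 by (simp add: power2_eq_square mult.assoc)
  qed
  then show ?thesis by (simp add: wave_op_def right_diff_distrib sum_distrib_left)
qed


text \<open>Applied to \<open>\<phi> (n p)\<close>, the equation for \<open>u\<close> loses its lower order terms in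
  the limit \<open>n \<longrightarrow> \<infinity>\<close>, whereas the leading term is scaling invariant.\<close>

lemma singular_part_wave_op:
  assumes ivp: "solves_ivp q u" and reg: "has_regular_part u v" and q: "continuous_on UNIV q"
    and v: "\<And>R. \<exists>B. \<forall>p. norm p \<le> R \<longrightarrow> \<bar>v p\<bar> \<le> B"
    and f: "f \<in> test_functions"
  shows "singular_part (wave_op f) = f 0"
proof -
  define g where "g = wave_op f"
  have gt: "g \<in> test_functions" using wave_op_test_functions[OF f] by (simp add: g_def)
  obtain R0 where R0: "R0 > 0" "\<forall>p. norm p \<ge> R0 \<longrightarrow> f p = 0" using f unfolding test_functions_iff by blast
  obtain R1 where R1: "R1 > 0" "\<forall>p. norm p \<ge> R1 \<longrightarrow> g p = 0" using gt unfolding test_functions_iff by blast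
  define R where "R = max R0 R1"
  have R: "R > 0" "\<And>p. norm p \<ge> R \<Longrightarrow> f p = 0" "\<And>p. norm p \<ge> R \<Longrightarrow> g p = 0"
    using R0 R1 by (auto simp: R_def)
  note fc = Ck_on_imp_continuous_on[OF test_functions_Ck_on[OF f]]
  note gc = Ck_on_imp_continuous_on[OF test_functions_Ck_on[OF gt]]
  obtain Bf where Bf: "Bf \<ge> 0" "\<And>p. norm p \<le> R \<Longrightarrow> \<bar>f p\<bar> \<le> Bf" using continuous_bounded_ball[OF fc] by metis
  obtain Bg where Bg: "Bg \<ge> 0" "\<And>p. norm p \<le> R \<Longrightarrow> \<bar>g p\<bar> \<le> Bg" using continuous_bounded_ball[OF gc] by metis
  have Bf': "\<bar>f p\<bar> \<le> Bf" for p
    using Bf(1) Bf(2)[of p] R(2)[of p] by (cases "norm p \<le> R") auto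
  have Bg': "\<bar>g p\<bar> \<le> Bg" for p
    using Bg(1) Bg(2)[of p] R(3)[of p] by (cases "norm p \<le> R") auto
  obtain Bq where Bq: "Bq \<ge> 0" "\<And>x. norm x \<le> R \<Longrightarrow> \<bar>q x\<bar> \<le> Bq" using continuous_bounded_ball[OF q] by metis
  obtain Bv0 where Bv0: "\<forall>p. norm p \<le> R \<longrightarrow> \<bar>v p\<bar> \<le> Bv0" using v by blast
  define Bv where "Bv = max Bv0 0"
  have Bv: "Bv \<ge> 0" "\<And>p. norm p \<le> R \<Longrightarrow> \<bar>v p\<bar> \<le> Bv" using Bv0 by (auto simp: Bv_def le_max_iff_disj)
  \<comment> \<open>Under scaling by \<open>c\<close> both error terms live on a ball of radius R /
    c. The kernel mass of that ball gives (R / c)^2 for the potential term; the term with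
    \<open>v\<close> has an integrand of size c^2 on a four-dimensional volume of order (R / c)^4.
    Both are multiples of 1 / c^2.\<close>
  define K where "K = Bq * Bf * (ball3_vol * R\<^sup>2) + Bv * (Bg + Bq * Bf) * (unit_ball_vol 4 * R ^ 4)"
  have K0: "K \<ge> 0" unfolding K_def using Bq Bf Bv Bg R by (intro add_nonneg_nonneg mult_nonneg_nonneg) auto
  have main: "\<bar>singular_part g - f 0\<bar> \<le> K / (real n)\<^sup>2" if n: "n > 0" for n :: nat
  proof -
    define c where "c = real n"
    have c: "c \<ge> 1" using n by (simp add: c_def)
    define fn where "fn = (\<lambda>p. f (c *\<^sub>R p))"
    have fn: "fn \<in> test_functions" using test_functions_affine_comp[OF f, of c 0] c by (simp add: fn_def)
    have wfn: "wave_op fn = (\<lambda>p. c\<^sup>2 * g (c *\<^sub>R p))"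
      using wave_op_affine_comp[OF f, of c 0] by (auto simp: fn_def g_def)
    define \<psi> where "\<psi> = wave_op_pot q fn"
    have \<psi>: "\<psi> p = c\<^sup>2 * g (c *\<^sub>R p) - q (fst p) * fn p" for p
      by (simp add: \<psi>_def wave_op_pot_def wfn)
    have \<psi>c: "\<psi> \<in> Cc" unfolding \<psi>_def by (rule wave_op_pot_Cc[OF fn q])
    have qfn: "(\<lambda>p. q (fst p) * fn p) \<in> Cc"
    proof -
      have "continuous_on UNIV (\<lambda>p. q (fst p) * fn p)"
        by (intro continuous_intros continuous_on_compose2[OF q]
            Ck_on_imp_continuous_on[OF test_functions_Ck_on[OF fn]]) auto
      moreover obtain r where "r > 0" "\<forall>p. norm p \<ge> r \<longrightarrow> fn p = 0" using fn unfolding test_functions_iff by blast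
      then have "r > 0 \<and> (\<forall>p. norm p \<ge> r \<longrightarrow> q (fst p) * fn p = 0)" by simp
      ultimately show ?thesis unfolding Cc_def compact_fun_support_iff by blast
    qed
    have "f 0 = u \<psi>" using ivp fn unfolding solves_ivp_def \<psi>_def by (simp add: fn_def)
    also have "\<dots> = singular_part \<psi> + (LBINT p. v p * \<psi> p)"
      using reg \<psi>c unfolding has_regular_part_def by blast
    also have "singular_part \<psi> = singular_part (wave_op fn) - singular_part (\<lambda>p. q (fst p) * fn p)"
      using singular_part_diff[OF test_functions_Cc[OF wave_op_test_functions[OF fn]] qfn]
      by (simp add: \<psi>_def wave_op_pot_def[abs_def])
    also have "singular_part (wave_op fn) = singular_part g"
    proof -
      have gm: "g \<in> borel_measurable borel" by (intro Cc_measurable test_functions_Cc gt)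
      have "(\<lambda>z::space. 0 + (z, norm z)) \<in> borel_measurable borel" by (rule measurable_retarded_shift)
      then have "(\<lambda>z::space. g (0 + (z, norm z))) \<in> borel_measurable borel"
        using gm by (rule measurable_compose)
      then have [measurable]: "(\<lambda>z::space. g (z, norm z)) \<in> borel_measurable borel" by simp
      \<comment> \<open>Scaling invariance: the volume element gives c^3 and the kernel 1 / c,
        leaving exactly the c^2 produced by the wave operator.\<close>
      have "singular_part g = c ^ 3 * (LBINT x. g (c *\<^sub>R x, norm (c *\<^sub>R x)) * newton_kernel (c *\<^sub>R x))"
        unfolding singular_part_eq
        using lborel_integral_scale[of "\<lambda>x. g (x, norm x) * newton_kernel x" c] c by simp
      also have "\<dots> = (LBINT x. c ^ 3 * (g (c *\<^sub>R x, norm (c *\<^sub>R x)) * newton_kernel (c *\<^sub>R x)))"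
        by simp
      also have "\<dots> = singular_part (wave_op fn)"
        unfolding singular_part_eq wfn using c
        by (intro Bochner_Integration.integral_cong refl)
          (auto simp: newton_kernel_def field_simps power2_eq_square power3_eq_cube)
      finally show ?thesis by simp
    qed
    finally have eq: "f 0 = singular_part g - singular_part (\<lambda>p. q (fst p) * fn p) + (LBINT p. v p * \<psi> p)" .
    have small: "c * s \<ge> R" if "s \<ge> R / c" for s using that c by (simp add: field_simps)
    have Rc: "R / c > 0" "R / c \<le> R" using R c by (auto simp: field_simps)
    have n1: "norm (c *\<^sub>R (z, norm z)) \<ge> R" if "norm z \<ge> R / c" for z :: space
    proof -
      have "norm z \<le> norm (z, norm z)" by (metis norm_fst_le fst_conv)
      then have "c * norm z \<le> c * norm (z, norm z)" using c by (intro mult_left_mono) auto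
      moreover have "norm (c *\<^sub>R (z, norm z)) = c * norm (z, norm z)"
        unfolding norm_scaleR using c by simp
      ultimately show ?thesis using small[OF that] by linarith
    qed
    have "\<bar>singular_part (\<lambda>p. q (fst p) * fn p)\<bar> \<le> Bq * Bf * (ball3_vol * (R / c)\<^sup>2)"
      unfolding singular_part_eq
    proof (rule integrable_times_newton_kernel(2)[OF _ Rc(1)])
      have "(\<lambda>p. q (fst p) * fn p) \<in> borel_measurable borel" by (rule Cc_measurable[OF qfn])
      moreover have "(\<lambda>z::space. (z, norm z)) \<in> borel_measurable borel"
        by (rule borel_measurable_continuous_onI) (intro continuous_intros)
      ultimately show "(\<lambda>z. q (fst (z, norm z)) * fn (z, norm z)) \<in> borel_measurable borel"
        by (rule measurable_compose[rotated])
      show "\<bar>q (fst (z, norm z)) * fn (z, norm z)\<bar> \<le> Bq * Bf" if "norm z < R / c" for z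
        unfolding abs_mult using Bq Bf' Rc that by (intro mult_mono) (auto simp: fn_def)
      show "q (fst (z, norm z)) * fn (z, norm z) = 0" if "norm z \<ge> R / c" for z
        using R(2)[OF n1[OF that]] by (simp add: fn_def)
    qed
    moreover have "\<bar>LBINT p. v p * \<psi> p\<bar> \<le> Bv * (c\<^sup>2 * (Bg + Bq * Bf)) * (unit_ball_vol (DIM(spacetime)) * (R / c) ^ DIM(spacetime))"
    proof (rule abs_integral_le_ball)
      fix p :: spacetime assume p: "norm p < R / c"
      have "norm (fst p) \<le> R" using norm_fst_le[of "fst p" "snd p"] p Rc by simp
      then have "\<bar>q (fst p) * fn p\<bar> \<le> Bq * Bf"
        unfolding abs_mult using Bq Bf' by (intro mult_mono) (auto simp: fn_def)
      moreover have "Bq * Bf \<le> c\<^sup>2 * (Bq * Bf)" using c Bq Bf mult_right_mono[of 1 "c\<^sup>2" "Bq * Bf"] by simp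
      moreover have "\<bar>c\<^sup>2 * g (c *\<^sub>R p)\<bar> \<le> c\<^sup>2 * Bg"
        unfolding abs_mult using Bg' by (intro mult_mono) auto
      ultimately have "\<bar>\<psi> p\<bar> \<le> c\<^sup>2 * (Bg + Bq * Bf)" unfolding \<psi> by (simp add: distrib_left)
      then show "\<bar>v p * \<psi> p\<bar> \<le> Bv * (c\<^sup>2 * (Bg + Bq * Bf))"
        unfolding abs_mult using Bv p Rc by (intro mult_mono) auto
    next
      fix p :: spacetime assume "norm p \<ge> R / c"
      then have "norm (c *\<^sub>R p) \<ge> R" using small c by simp
      then show "v p * \<psi> p = 0" using R by (simp add: \<psi> fn_def)
    qed (use Rc Bv Bg Bq Bf c in auto)
    moreover have "Bq * Bf * (ball3_vol * (R / c)\<^sup>2) + Bv * (c\<^sup>2 * (Bg + Bq * Bf)) * (unit_ball_vol (DIM(spacetime)) * (R / c) ^ DIM(spacetime)) = K / c\<^sup>2"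
    proof -
      have alg: "a * (V * (r2 / s)) + d * (s * b) * (U * (r4 / (s * s))) = (a * (V * r2) + d * b * (U * r4)) / s"
        if "s > 0" for a b d s V U r2 r4 :: real
        using that by (simp add: field_simps)
      have "c ^ 4 = c\<^sup>2 * c\<^sup>2" by (simp add: power2_eq_square power4_eq_xxxx mult.assoc)
      moreover have "DIM(spacetime) = 4" by simp
      ultimately show ?thesis
        using alg[of "c\<^sup>2" "Bq * Bf" ball3_vol "R\<^sup>2" Bv "Bg + Bq * Bf" "unit_ball_vol 4" "R ^ 4"] c
        by (simp only: K_def power_divide of_nat_numeral) simp
    qed
    ultimately show ?thesis using eq by (simp add: c_def)
  qed
  have "(\<lambda>n. K / (real n)\<^sup>2) \<longlonglongrightarrow> 0"
    by (intro tendsto_divide_0[OF tendsto_const] filterlim_at_top_imp_at_infinity filterlim_pow_at_top filterlim_real_sequentially) auto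
  moreover have "\<forall>\<^sub>F n in sequentially. \<bar>singular_part g - f 0\<bar> \<le> K / (real n)\<^sup>2"
    using eventually_gt_at_top[of 0] by eventually_elim (rule main)
  ultimately have "\<bar>singular_part g - f 0\<bar> \<le> 0"
    by (intro tendsto_lowerbound[of _ _ sequentially]) auto
  then show ?thesis by (simp add: g_def)
qed

section \<open>Regularity of Goursat solutions and the Duhamel identity\<close>

text \<open>The boundary values are limits from the open cone only, whereas a boundary point may
  also be approached along the boundary. At such a nearby point \<open>y\<close> the value is again
  a limit of interior values, all of them within e / 2 of \<open>v p\<close>, and the bound passes
  to the limit.\<close>

lemma goursat_solution_continuous_on:
  assumes "goursat_solution q v"
  shows "continuous_on {p. norm (fst p) \<le> snd p} v"
  unfolding continuous_on_def
proof
  have cone: "light_cone = {p. norm (fst p) < snd p}" by (auto simp: light_cone_def)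
  have op: "open light_cone" unfolding cone by (intro open_Collect_less continuous_intros)
  have int: "(v \<longlongrightarrow> v p) (at p)" if "p \<in> light_cone" for p
  proof -
    have "Ck_on 2 v light_cone" using assms by (simp add: goursat_solution_def)
    then have "continuous_on light_cone v" by (rule Ck_on_imp_continuous_on)
    then show ?thesis using that op by (metis continuous_on_eq_continuous_at isCont_def)
  qed
  have bd: "(v \<longlongrightarrow> v p) (at p within light_cone)" if "norm (fst p) \<le> snd p" for p
  proof (cases "norm (fst p) = snd p")
    case True
    then show ?thesis using assms unfolding goursat_solution_def by (metis prod.collapse)
  next
    case False
    then have "p \<in> light_cone" using that by (simp add: cone)
    then show ?thesis using tendsto_within_subset[OF int] by blast
  qed
  have lim: "at p within light_cone \<noteq> bot" if "norm (fst p) \<le> snd p" for p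
  proof -
    have "p islimpt light_cone"
      unfolding islimpt_approachable
    proof (intro allI impI)
      fix e :: real assume "e > 0"
      then show "\<exists>x'\<in>light_cone. x' \<noteq> p \<and> dist x' p < e"
        using that by (intro bexI[of _ "(fst p, snd p + e / 2)"])
          (auto simp: cone dist_prod_def prod_eq_iff dist_real_def)
    qed
    then show ?thesis by (simp add: trivial_limit_within)
  qed
  fix p :: spacetime assume "p \<in> {p. norm (fst p) \<le> snd p}"
  then have p: "norm (fst p) \<le> snd p" by simp
  show "(v \<longlongrightarrow> v p) (at p within {p. norm (fst p) \<le> snd p})"
  proof (rule tendstoI)
    fix e :: real assume e: "e > 0"
    then have "\<forall>\<^sub>F y in at p within light_cone. dist (v y) (v p) < e / 2"
      by (intro tendstoD[OF bd[OF p]]) simp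
    then obtain d where d: "d > 0" "\<And>y. y \<in> light_cone \<Longrightarrow> y \<noteq> p \<Longrightarrow> dist y p < d \<Longrightarrow> dist (v y) (v p) < e / 2"
      unfolding eventually_at by blast
    have d': "dist (v y) (v p) \<le> e / 2" if "y \<in> light_cone" "dist y p < d" for y
    proof (cases "y = p")
      case False
      then show ?thesis using d(2)[OF that(1) False that(2)] by simp
    qed (use e in simp)
    have "dist (v y) (v p) < e" if y: "norm (fst y) \<le> snd y" "dist y p < d" for y
    proof -
      have "\<forall>\<^sub>F x in at y within light_cone. x \<in> light_cone \<and> dist x p < d"
        unfolding eventually_at
      proof (intro exI[of _ "d - dist y p"] conjI ballI impI)
        fix x assume "x \<in> light_cone" "x \<noteq> y \<and> dist x y < d - dist y p"
        then show "dist x p < d" using dist_triangle[of x p y] by linarith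
      qed (use y in auto)
      then have "\<forall>\<^sub>F x in at y within light_cone. dist (v x) (v p) \<le> e / 2"
        by eventually_elim (use d' in auto)
      then have "dist (v y) (v p) \<le> e / 2"
        using lim[OF y(1)] by (intro tendsto_upperbound[OF tendsto_dist[OF bd[OF y(1)] tendsto_const]])
      then show ?thesis using e by simp
    qed
    then show "\<forall>\<^sub>F y in at p within {p. norm (fst p) \<le> snd p}. dist (v y) (v p) < e"
      unfolding eventually_at using d(1) by blast
  qed
qed

lemma norm_fst_le_norm: "norm (fst p) \<le> norm p"
  by (metis norm_fst_le prod.collapse)

lemma abs_snd_le_norm: "\<bar>snd p\<bar> \<le> norm p" for p :: "'a::real_normed_vector \<times> real"
  by (metis norm_snd_le prod.collapse real_norm_def)

lemma closed_cone: "closed {p :: spacetime. norm (fst p) \<le> snd p}"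
  by (intro closed_Collect_le continuous_intros)

lemma goursat_solution_eq_0: "goursat_solution q v \<Longrightarrow> snd p < norm (fst p) \<Longrightarrow> v p = 0"
  unfolding goursat_solution_def by (metis prod.collapse)

lemma goursat_solution_measurable:
  assumes "goursat_solution q v"
  shows "v \<in> borel_measurable borel"
proof -
  have "(\<lambda>p. indicator {p. norm (fst p) \<le> snd p} p *\<^sub>R v p) \<in> borel_measurable borel"
    by (rule borel_measurable_continuous_on_indicator)
      (use closed_cone goursat_solution_continuous_on[OF assms] in auto)
  moreover have "(\<lambda>p. indicator {p. norm (fst p) \<le> snd p} p *\<^sub>R v p) = v"
    using goursat_solution_eq_0[OF assms] by (intro ext) (metis (lifting) indicator_simps mem_Collect_eq
        mult_zero_left not_le real_scaleR_def scaleR_one scaleR_zero_left)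
  ultimately show ?thesis by simp
qed

text \<open>No spatial cut-off appears because |x| <= t <= R describes a compact piece of the closed
  cone, on which \<open>v\<close> is continuous, and \<open>v\<close> is 0 below the cone.\<close>

lemma goursat_solution_bounded:
  assumes "goursat_solution q v"
  obtains B where "B \<ge> 0" "\<And>p. snd p \<le> R \<Longrightarrow> \<bar>v p\<bar> \<le> B"
proof -
  define K where "K = {p :: spacetime. norm (fst p) \<le> snd p} \<inter> cball 0 (2 * \<bar>R\<bar>)"
  have "compact K" unfolding K_def using closed_cone by (intro closed_Int_compact) auto
  moreover have "continuous_on K v"
    by (rule continuous_on_subset[OF goursat_solution_continuous_on[OF assms]]) (auto simp: K_def)
  ultimately have "bounded (v ` K)" by (intro compact_imp_bounded compact_continuous_image)
  then obtain B where B: "\<forall>p\<in>K. \<bar>v p\<bar> \<le> B" unfolding bounded_iff by auto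
  have "\<bar>v p\<bar> \<le> max B 0" if "snd p \<le> R" for p
  proof (cases "norm (fst p) \<le> snd p")
    case True
    have "norm p \<le> norm (fst p) + norm (snd p)" using norm_Pair_le[of "fst p" "snd p"] by simp
    also have "\<dots> \<le> 2 * \<bar>R\<bar>" using True that norm_ge_zero[of "fst p"] by (simp add: abs_real_def)
    finally have "p \<in> K" using True by (simp add: K_def)
    then show ?thesis using B by (auto simp: le_max_iff_disj)
  next
    case False
    then show ?thesis using goursat_solution_eq_0[OF assms, of p] by simp
  qed
  then show ?thesis using that[of "max B 0"] by auto
qed

text \<open>Translation carries the statement at the origin to every \<open>p\<close>. In this way
  \<open>adv_potential\<close> inverts the free wave operator on test functions without any
  computation with spherical means.\<close>

lemma adv_potential_wave_op:
  assumes "\<And>g. g \<in> test_functions \<Longrightarrow> singular_part (wave_op g) = g 0" and f: "f \<in> test_functions"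
  shows "adv_potential (wave_op f) p = f p"
proof -
  have "adv_potential (wave_op f) p = singular_part (\<lambda>y. wave_op f (1 *\<^sub>R y + p))"
    by (simp add: adv_potential_eq_singular_part add.commute)
  also have "(\<lambda>y. wave_op f (1 *\<^sub>R y + p)) = wave_op (\<lambda>y. f (1 *\<^sub>R y + p))"
    using wave_op_affine_comp[OF f, of 1 p] by (intro ext) simp
  also have "singular_part \<dots> = f p"
    using assms(1)[OF test_functions_affine_comp[OF f, of 1 p]] by simp
  finally show ?thesis .
qed

lemma adv_potential_bound:
  assumes "f \<in> borel_measurable borel" and T: "T > 0" and "\<And>y. \<bar>f y\<bar> \<le> B"
    and "\<And>y. snd y \<ge> T \<Longrightarrow> f y = 0" and "snd p \<ge> 0"
  shows "integrable lborel (\<lambda>z. f (p + (z, norm z)) * newton_kernel z)" (is ?i)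
    and "\<bar>adv_potential f p\<bar> \<le> B * (ball3_vol * T\<^sup>2)" (is ?b)
proof -
  have 0: "f (p + (z, norm z)) = 0" if "norm z \<ge> T" for z
    by (rule assms(4)) (use assms(5) that in simp)
  show ?i ?b by (rule adv_potential_bounded[OF assms(1) T assms(3) 0]; assumption)+
qed

lemma adv_potential_eq_0:
  "(\<And>z. f (p + (z, norm z)) = 0) \<Longrightarrow> adv_potential f p = 0"
  by (simp add: adv_potential_def)

lemma adv_potential_eq_0_time:
  "(\<And>y. snd y \<ge> T \<Longrightarrow> f y = 0) \<Longrightarrow> snd p \<ge> T \<Longrightarrow> adv_potential f p = 0"
  by (rule adv_potential_eq_0) (auto simp: add_increasing2)

lemma wave_op_cong_open:
  assumes "open U" "p \<in> U" "\<And>y. y \<in> U \<Longrightarrow> f y = g y"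
  shows "wave_op f p = wave_op g p"
proof -
  have "dir_deriv d (dir_deriv d f) p = dir_deriv d (dir_deriv d g) p" for d
    using dir_deriv_cong_open[OF assms(1) _ assms(3)]
    by (intro dir_deriv_cong_open[OF assms(1,2)]) auto
  then show ?thesis by (simp add: wave_op_def)
qed

lemma integrable_goursat_solution_times:
  assumes "goursat_solution q v" "f \<in> Cc"
  shows "integrable lborel (\<lambda>p. v p * f p)"
proof -
  obtain R where R: "R > 0" "\<And>p. norm p \<ge> R \<Longrightarrow> f p = 0"
    using assms(2) unfolding Cc_def compact_fun_support_iff by blast
  obtain B' where B': "B' \<ge> 0" "\<And>p. norm p \<le> R \<Longrightarrow> \<bar>f p\<bar> \<le> B'"
    using continuous_bounded_ball[of f R] assms(2) unfolding Cc_def by blast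
  obtain B where B: "B \<ge> 0" "\<And>p. snd p \<le> R \<Longrightarrow> \<bar>v p\<bar> \<le> B"
    using goursat_solution_bounded[OF assms(1)] by metis
  show ?thesis
  proof (rule integrable_bounded_ball[where r = R and B = "B * B'"])
    show "(\<lambda>p. v p * f p) \<in> borel_measurable borel"
      by (intro borel_measurable_times goursat_solution_measurable[OF assms(1)] Cc_measurable assms(2))
    fix p :: spacetime assume "norm p < R"
    moreover have "snd p \<le> norm p" using abs_snd_le_norm[of p] by linarith
    ultimately show "\<bar>v p * f p\<bar> \<le> B * B'"
      unfolding abs_mult using B B' by (intro mult_mono) auto
  qed (use R in auto)
qed

text \<open>The equation \<open>v = E * (q v + q \<delta>(t - |x|) / (4 \<pi> |x|))\<close> with \<open>E\<close> the retarded
  fundamental solution, tested against \<open>f\<close>.\<close>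

definition duhamel_against :: "(space \<Rightarrow> real) \<Rightarrow> (spacetime \<Rightarrow> real) \<Rightarrow> (spacetime \<Rightarrow> real) \<Rightarrow> bool" where
  "duhamel_against q v f \<longleftrightarrow>
     (LBINT p. v p * f p) =
       (LBINT p. v p * (q (fst p) * adv_potential f p))
       + (LBINT x. q x * adv_potential f (x, norm x) * newton_kernel x)"

text \<open>The weak equation is tested with the potential \<open>\<Phi>\<close> of
  \<open>f\<close>, cut off in the past. At times t >= 0, where \<open>u\<close> is concentrated,
  the operator turns it into \<open>f\<close> minus \<open>q\<close> times \<open>\<Phi>\<close>.
  The value at the origin equals \<open>singular_part f\<close> and cancels the singular
  contribution of \<open>f\<close>; what remains is the identity.\<close>

lemma duhamel_against_test_function:
  assumes sol: "ivp_solution q u v" and q: "continuous_on UNIV q" and f: "f \<in> test_functions"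
  shows "duhamel_against q v f"
proof -
  have ivp: "solves_ivp q u" and reg: "has_regular_part u v" and gs: "goursat_solution q v"
    using sol by (auto simp: ivp_solution_def)
  have vb: "\<exists>B. \<forall>p. norm p \<le> R \<longrightarrow> \<bar>v p\<bar> \<le> B" for R
  proof -
    obtain B where B: "B \<ge> 0" "\<And>p. snd p \<le> R \<Longrightarrow> \<bar>v p\<bar> \<le> B"
      using goursat_solution_bounded[OF gs] by metis
    moreover have "snd p \<le> norm p" for p :: spacetime
      using abs_snd_le_norm[of p] by linarith
    ultimately show ?thesis using order_trans by blast
  qed
  note sw = singular_part_wave_op[OF ivp reg q vb]
  define \<Phi> where "\<Phi> = adv_potential f"
  define \<phi> where "\<phi> = (\<lambda>p. time_cutoff p * \<Phi> p)"
  obtain R where R: "R > 0" "\<forall>p. norm p \<ge> R \<longrightarrow> f p = 0" using f unfolding test_functions_iff by blast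
  \<comment> \<open>A nonzero value needs t > -2 and a point of the forward cone within distance R
    of the origin. Then |z| < R + 2, so |x| < 2 * R + 2 and |t| < R + 2, which add up to the radius
    used here.\<close>
  have "\<phi> p = 0" if p: "norm p \<ge> 3 * R + 4" for p
  proof (cases "snd p \<le> -2")
    case True
    then show ?thesis by (simp add: \<phi>_def time_cutoff_eq_0)
  next
    case False
    have "f (p + (z, norm z)) = 0" for z
    proof (rule ccontr)
      assume "f (p + (z, norm z)) \<noteq> 0"
      then have n: "norm (p + (z, norm z)) < R" using R by (meson not_le)
      have "norm (fst (p + (z, norm z))) < R"
        using n norm_fst_le_norm[of "p + (z, norm z)"] by linarith
      then have "norm (fst p + z) < R" by simp
      moreover have "\<bar>snd (p + (z, norm z))\<bar> < R"
        using n abs_snd_le_norm[of "p + (z, norm z)"] by linarith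
      then have s: "\<bar>snd p + norm z\<bar> < R" by simp
      moreover have "norm (fst p) \<le> norm (fst p + z) + norm z"
        using norm_triangle_ineq4[of "fst p + z" z] by simp
      ultimately have "norm (fst p) + \<bar>snd p\<bar> < 3 * R + 4" using False norm_ge_zero[of z] R by linarith
      then show False using p norm_Pair_le[of "fst p" "snd p"] by simp
    qed
    then show ?thesis by (simp add: \<phi>_def \<Phi>_def adv_potential_eq_0)
  qed
  moreover have "Ck_on k \<phi> UNIV" for k
    unfolding \<phi>_def \<Phi>_def by (intro Ck_on_mult Ck_on_time_cutoff Ck_on_adv_potential f)
  moreover have "3 * R + 4 > 0" using R by simp
  ultimately have \<phi>: "\<phi> \<in> test_functions" unfolding test_functions_iff by blast
  define \<psi> where "\<psi> = wave_op_pot q \<phi>"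
  have \<psi>c: "\<psi> \<in> Cc" unfolding \<psi>_def by (rule wave_op_pot_Cc[OF \<phi> q])
  have \<psi>: "\<psi> p = f p - q (fst p) * \<Phi> p" if "snd p \<ge> 0" for p
  proof -
    have "wave_op \<phi> p = wave_op \<Phi> p"
    proof (rule wave_op_cong_open)
      show "open {p :: spacetime. snd p > -1}" by (intro open_Collect_less continuous_intros)
    qed (use that in \<open>auto simp: \<phi>_def time_cutoff_eq_1\<close>)
    also have "\<dots> = f p"
      unfolding \<Phi>_def wave_op_adv_potential[OF f] by (rule adv_potential_wave_op[OF sw f])
    finally show ?thesis using that by (simp add: \<psi>_def wave_op_pot_def \<phi>_def time_cutoff_eq_1)
  qed
  have "\<Phi> 0 = \<phi> 0" by (simp add: \<phi>_def time_cutoff_eq_1)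
  also have "\<dots> = u \<psi>" using ivp \<phi> unfolding solves_ivp_def \<psi>_def by simp
  also have "\<dots> = singular_part \<psi> + (LBINT p. v p * \<psi> p)"
    using reg \<psi>c unfolding has_regular_part_def by blast
  finally have main: "\<Phi> 0 = singular_part \<psi> + (LBINT p. v p * \<psi> p)" .
  note fC = test_functions_Cc[OF f]
  have i1: "integrable lborel (\<lambda>z. f (z, norm z) * newton_kernel z)"
    using integrable_newton_kernel_Cc[OF fC, of 0] by simp
  have i2: "integrable lborel (\<lambda>z. \<psi> (z, norm z) * newton_kernel z)"
    using integrable_newton_kernel_Cc[OF \<psi>c, of 0] by simp
  have "(LBINT x. q x * \<Phi> (x, norm x) * newton_kernel x)
      = (LBINT z. f (z, norm z) * newton_kernel z - \<psi> (z, norm z) * newton_kernel z)"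
    by (intro Bochner_Integration.integral_cong refl) (simp add: \<psi> algebra_simps)
  also have "\<dots> = singular_part f - singular_part \<psi>"
    using i1 i2 by (simp add: singular_part_eq)
  also have "singular_part f = \<Phi> 0" by (simp add: \<Phi>_def adv_potential_eq_singular_part)
  finally have 1: "(LBINT x. q x * \<Phi> (x, norm x) * newton_kernel x) = \<Phi> 0 - singular_part \<psi>" .
  have "(LBINT p. v p * (q (fst p) * \<Phi> p)) = (LBINT p. v p * f p - v p * \<psi> p)"
  proof (intro Bochner_Integration.integral_cong refl)
    fix p
    show "v p * (q (fst p) * \<Phi> p) = v p * f p - v p * \<psi> p"
    proof (cases "snd p \<ge> 0")
      case True
      then show ?thesis by (simp add: \<psi> algebra_simps)
    next
      case False
      then have "v p = 0" using goursat_solution_eq_0[OF gs, of p] norm_ge_zero[of "fst p"] by linarith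
      then show ?thesis by simp
    qed
  qed
  also have "\<dots> = (LBINT p. v p * f p) - (LBINT p. v p * \<psi> p)"
    using integrable_goursat_solution_times[OF gs] fC \<psi>c by simp
  finally show ?thesis using 1 main unfolding duhamel_against_def \<Phi>_def by simp
qed

section \<open>The Duhamel identity against bounded Borel functions\<close>

text \<open>Sources may be discontinuous and may extend indefinitely into the past and in space:
  \<open>v\<close> lives on |x| <= t, and for t >= 0 vanishing from time \<open>T\<close> on already
  confines the integration over the forward cone to |z| < T.\<close>

definition admissible :: "real \<Rightarrow> (spacetime \<Rightarrow> real) \<Rightarrow> bool" where
  "admissible T f \<longleftrightarrow> f \<in> borel_measurable borel \<and> (\<exists>B. \<forall>p. \<bar>f p\<bar> \<le> B) \<and> (\<forall>p. snd p \<ge> T \<longrightarrow> f p = 0)"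

lemma admissibleE:
  assumes "admissible T f"
  obtains B where "f \<in> borel_measurable borel" "\<And>p. \<bar>f p\<bar> \<le> B" "B \<ge> 0" "\<And>p. snd p \<ge> T \<Longrightarrow> f p = 0"
proof -
  obtain B where "f \<in> borel_measurable borel" "\<And>p. \<bar>f p\<bar> \<le> B" "\<And>p. snd p \<ge> T \<Longrightarrow> f p = 0"
    using assms unfolding admissible_def by blast
  moreover then have "B \<ge> 0" using abs_ge_zero order_trans by blast
  ultimately show ?thesis using that by blast
qed

lemma admissible_lincomb:
  assumes "admissible T f" "admissible T g"
  shows "admissible T (\<lambda>p. a * f p + b * g p)"
proof -
  obtain B where B: "f \<in> borel_measurable borel" "\<And>p. \<bar>f p\<bar> \<le> B" "B \<ge> 0" "\<And>p. snd p \<ge> T \<Longrightarrow> f p = 0"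
    using admissibleE[OF assms(1)] by metis
  obtain B' where B': "g \<in> borel_measurable borel" "\<And>p. \<bar>g p\<bar> \<le> B'" "B' \<ge> 0" "\<And>p. snd p \<ge> T \<Longrightarrow> g p = 0"
    using admissibleE[OF assms(2)] by metis
  have "\<bar>a * f p + b * g p\<bar> \<le> \<bar>a\<bar> * B + \<bar>b\<bar> * B'" for p
    using abs_triangle_ineq[of "a * f p" "b * g p"] mult_left_mono[OF B(2)[of p], of "\<bar>a\<bar>"]
      mult_left_mono[OF B'(2)[of p], of "\<bar>b\<bar>"] by (simp add: abs_mult)
  moreover have "(\<lambda>p. a * f p + b * g p) \<in> borel_measurable borel"
    using B(1) B'(1) by (intro borel_measurable_add borel_measurable_times borel_measurable_const)
  ultimately show ?thesis unfolding admissible_def using B(4) B'(4) by auto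
qed

lemma adv_potential_lincomb:
  assumes T: "T > 0" and f: "admissible T f" "admissible T g" and p: "snd p \<ge> 0"
  shows "adv_potential (\<lambda>p. a * f p + b * g p) p = a * adv_potential f p + b * adv_potential g p"
proof -
  have i: "integrable lborel (\<lambda>z. h (p + (z, norm z)) * newton_kernel z)" if h: "admissible T h" for h
  proof -
    obtain B where "h \<in> borel_measurable borel" "\<And>p. \<bar>h p\<bar> \<le> B" "\<And>p. snd p \<ge> T \<Longrightarrow> h p = 0"
      using admissibleE[OF h] by metis
    then show ?thesis using adv_potential_bound(1)[OF _ T _ _ p] by blast
  qed
  show ?thesis
    unfolding adv_potential_def
    by (simp add: distrib_right mult.assoc i[OF f(1)] i[OF f(2)])
qed

lemma adv_potential_LIMSEQ:
  assumes T: "T > 0" and m: "\<And>n. F n \<in> borel_measurable borel"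
    and B: "\<And>n y. \<bar>F n y\<bar> \<le> B" and 0: "\<And>n y. snd y \<ge> T \<Longrightarrow> F n y = 0"
    and lim: "\<And>y. (\<lambda>n. F n y) \<longlonglongrightarrow> f y" and p: "snd p \<ge> 0"
  shows "(\<lambda>n. adv_potential (F n) p) \<longlonglongrightarrow> adv_potential f p"
  unfolding adv_potential_def
proof (rule integral_dominated_convergence)
  have fm: "f \<in> borel_measurable borel" by (rule borel_measurable_LIMSEQ_real[OF lim m])
  show "(\<lambda>z. f (p + (z, norm z)) * newton_kernel z) \<in> borel_measurable lborel"
    using measurable_compose[OF measurable_retarded_shift fm] by simp
  show "(\<lambda>z. F n (p + (z, norm z)) * newton_kernel z) \<in> borel_measurable lborel" for n
    using measurable_compose[OF measurable_retarded_shift m] by simp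
  show "integrable lborel (\<lambda>z. B * (indicator (ball 0 T) z * newton_kernel z))"
    by (intro integrable_mult_right integrable_newton_kernel T)
  show "AE z in lborel. (\<lambda>n. F n (p + (z, norm z)) * newton_kernel z) \<longlonglongrightarrow> f (p + (z, norm z)) * newton_kernel z"
    by (intro AE_I2 tendsto_mult lim tendsto_const)
  show "AE z in lborel. norm (F n (p + (z, norm z)) * newton_kernel z) \<le> B * (indicator (ball 0 T) z * newton_kernel z)" for n
  proof (intro AE_I2)
    fix z :: space
    show "norm (F n (p + (z, norm z)) * newton_kernel z) \<le> B * (indicator (ball 0 T) z * newton_kernel z)"
    proof (cases "norm z < T")
      case True
      then show ?thesis using mult_right_mono[OF B newton_kernel_nonneg] by (simp add: abs_mult)
    next
      case False
      then have "F n (p + (z, norm z)) = 0" using p by (intro 0) simp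
      then show ?thesis using False by simp
    qed
  qed
qed

lemma adv_potential_nonneg: "(\<And>y. f y \<ge> 0) \<Longrightarrow> adv_potential f p \<ge> 0"
  unfolding adv_potential_def by (simp add: integral_nonneg)

text \<open>The bounds are parameters instead of being obtained inside, so that two problems with
  different potentials can share the same constants.\<close>

locale goursat_problem =
  fixes q :: "space \<Rightarrow> real" and v :: "spacetime \<Rightarrow> real" and T Bv Bq :: real
  assumes gs: "goursat_solution q v" and qc: "continuous_on UNIV q" and T: "T > 0"
    and Bv: "\<And>p. snd p \<le> T \<Longrightarrow> \<bar>v p\<bar> \<le> Bv" and Bq: "\<And>x. norm x \<le> T \<Longrightarrow> \<bar>q x\<bar> \<le> Bq"
begin

lemma Bv_nonneg: "Bv \<ge> 0"
  using Bv[of 0] T by simp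

lemma Bq_nonneg: "Bq \<ge> 0"
  using Bq[of 0] T by simp

lemma v_measurable [measurable]: "v \<in> borel_measurable borel"
  by (rule goursat_solution_measurable[OF gs])

lemma q_measurable [measurable]: "q \<in> borel_measurable borel"
  by (rule borel_measurable_continuous_onI[OF qc])

lemma q_fst_measurable [measurable]: "(\<lambda>p. q (fst p)) \<in> borel_measurable borel"
  by (rule borel_measurable_continuous_onI) (intro continuous_on_compose2[OF qc] continuous_intros; simp)

text \<open>Only the truncated cone |x| <= t < T counts, and it lies in a ball of radius 2 * T + 1.
  This supplies one integrable majorant for all dominated convergence arguments on
  spacetime.\<close>

lemma v_times_dominated:
  assumes B: "\<And>p. norm (fst p) \<le> snd p \<Longrightarrow> snd p < T \<Longrightarrow> \<bar>g p\<bar> \<le> B" and 0: "\<And>p. snd p \<ge> T \<Longrightarrow> g p = 0"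
  shows "\<bar>v p * g p\<bar> \<le> Bv * B * indicator (ball 0 (2 * T + 1)) p"
proof -
  consider "snd p \<ge> T" | "snd p < norm (fst p)" | "norm (fst p) \<le> snd p" "snd p < T" by linarith
  then show ?thesis
  proof cases
    case 3
    have "norm p \<le> norm (fst p) + \<bar>snd p\<bar>" using norm_Pair_le[of "fst p" "snd p"] by simp
    then have "p \<in> ball 0 (2 * T + 1)" using 3 norm_ge_zero[of "fst p"] by simp
    moreover have "\<bar>v p\<bar> * \<bar>g p\<bar> \<le> Bv * B"
      using Bv[of p] B[OF 3] 3 Bv_nonneg by (intro mult_mono) auto
    ultimately show ?thesis by (simp add: abs_mult)
  qed (use 0 goursat_solution_eq_0[OF gs, of p] Bv_nonneg B[of 0] T in \<open>auto simp: zero_prod_def\<close>)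
qed

lemma integrable_ball_indicator: "integrable lborel (\<lambda>p::spacetime. c * indicator (ball 0 (2 * T + 1)) p :: real)"
  by (intro integrable_mult_right integrable_real_indicator emeasure_bounded_finite) auto

lemma integrable_v_times:
  assumes "g \<in> borel_measurable borel" "\<And>p. norm (fst p) \<le> snd p \<Longrightarrow> snd p < T \<Longrightarrow> \<bar>g p\<bar> \<le> B" "\<And>p. snd p \<ge> T \<Longrightarrow> g p = 0"
  shows "integrable lborel (\<lambda>p. v p * g p)"
proof (rule Bochner_Integration.integrable_bound[OF integrable_ball_indicator[of "Bv * B"]])
  show "(\<lambda>p. v p * g p) \<in> borel_measurable lborel" using assms(1) by simp
  have "\<bar>v p * g p\<bar> \<le> \<bar>Bv * B * indicator (ball 0 (2 * T + 1)) p\<bar>" for p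
    using v_times_dominated[of g B p, OF assms(2,3)] by linarith
  then show "AE p in lborel. norm (v p * g p) \<le> norm (Bv * B * indicator (ball 0 (2 * T + 1)) p)"
    by (intro AE_I2) simp
qed

lemma potential_term_bound:
  assumes "f \<in> borel_measurable borel" "\<And>p. \<bar>f p\<bar> \<le> B" "B \<ge> 0" "\<And>p. snd p \<ge> T \<Longrightarrow> f p = 0"
    and "norm (fst p) \<le> snd p" "snd p < T"
  shows "\<bar>q (fst p) * adv_potential f p\<bar> \<le> Bq * (B * (ball3_vol * T\<^sup>2))"
proof -
  have "snd p \<ge> 0" using assms(5) norm_ge_zero order_trans by blast
  then have "\<bar>adv_potential f p\<bar> \<le> B * (ball3_vol * T\<^sup>2)"
    by (intro adv_potential_bound(2)[OF assms(1) T assms(2) assms(4)])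
  then show ?thesis unfolding abs_mult using Bq[of "fst p"] assms(5,6) Bq_nonneg by (intro mult_mono) auto
qed

lemma q_measurable_term [measurable]:
  "f \<in> borel_measurable borel \<Longrightarrow> (\<lambda>p. q (fst p) * adv_potential f p) \<in> borel_measurable borel"
  by (intro borel_measurable_times q_fst_measurable adv_potential_measurable)

lemma q_measurable_cone_term [measurable]:
  assumes "f \<in> borel_measurable borel"
  shows "(\<lambda>x. q x * adv_potential f (x, norm x)) \<in> borel_measurable borel"
proof -
  have "(\<lambda>z::space. (z, norm z)) \<in> borel_measurable borel"
    by (rule borel_measurable_continuous_onI) (intro continuous_intros)
  from measurable_compose[OF this q_measurable_term[OF assms]] show ?thesis by simp
qed

lemma integrable_terms:
  assumes "admissible T f"
  shows "integrable lborel (\<lambda>p. v p * f p)"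
    and "integrable lborel (\<lambda>p. v p * (q (fst p) * adv_potential f p))"
    and "integrable lborel (\<lambda>x. q x * adv_potential f (x, norm x) * newton_kernel x)"
proof -
  obtain B where B: "f \<in> borel_measurable borel" "\<And>p. \<bar>f p\<bar> \<le> B" "B \<ge> 0" "\<And>p. snd p \<ge> T \<Longrightarrow> f p = 0"
    using admissibleE[OF assms] by metis
  show "integrable lborel (\<lambda>p. v p * f p)"
    by (rule integrable_v_times[OF B(1) B(2) B(4)])
  have z: "q (fst p) * adv_potential f p = 0" if "snd p \<ge> T" for p
    using adv_potential_eq_0_time[OF B(4) that] by simp
  show "integrable lborel (\<lambda>p. v p * (q (fst p) * adv_potential f p))"
    by (rule integrable_v_times[OF q_measurable_term[OF B(1)] potential_term_bound[OF B] z])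
  show "integrable lborel (\<lambda>x. q x * adv_potential f (x, norm x) * newton_kernel x)"
  proof (rule integrable_times_newton_kernel(1)[OF q_measurable_cone_term[OF B(1)] T])
    show "\<bar>q x * adv_potential f (x, norm x)\<bar> \<le> Bq * (B * (ball3_vol * T\<^sup>2))" if "norm x < T" for x
      using potential_term_bound[OF B, of "(x, norm x)"] that by simp
    show "q x * adv_potential f (x, norm x) = 0" if "norm x \<ge> T" for x
      using z[of "(x, norm x)"] that by simp
  qed
qed

lemma duhamel_against_lincomb:
  assumes f: "admissible T f" "admissible T g" and d: "duhamel_against q v f" "duhamel_against q v g"
  shows "duhamel_against q v (\<lambda>p. a * f p + b * g p)"
proof -
  note i = integrable_terms[OF f(1)] and j = integrable_terms[OF f(2)]
  note lin = adv_potential_lincomb[OF T f]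
  have 1: "(LBINT p. v p * (a * f p + b * g p)) = a * (LBINT p. v p * f p) + b * (LBINT p. v p * g p)"
  proof -
    have "(LBINT p. v p * (a * f p + b * g p)) = (LBINT p. a * (v p * f p) + b * (v p * g p))"
      by (simp add: algebra_simps)
    then show ?thesis using i j by simp
  qed
  have 2: "(LBINT p. v p * (q (fst p) * adv_potential (\<lambda>p. a * f p + b * g p) p))
    = a * (LBINT p. v p * (q (fst p) * adv_potential f p))
      + b * (LBINT p. v p * (q (fst p) * adv_potential g p))"
  proof -
    have "v p * (q (fst p) * adv_potential (\<lambda>p. a * f p + b * g p) p)
       = a * (v p * (q (fst p) * adv_potential f p)) + b * (v p * (q (fst p) * adv_potential g p))" for p
    proof (cases "snd p \<ge> 0")
      case True
      then show ?thesis by (simp add: lin algebra_simps)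
    next
      case False
      then have "v p = 0" using goursat_solution_eq_0[OF gs, of p] norm_ge_zero[of "fst p"] by linarith
      then show ?thesis by simp
    qed
    then show ?thesis using i j by simp
  qed
  have 3: "(LBINT x. q x * adv_potential (\<lambda>p. a * f p + b * g p) (x, norm x) * newton_kernel x)
    = a * (LBINT x. q x * adv_potential f (x, norm x) * newton_kernel x)
      + b * (LBINT x. q x * adv_potential g (x, norm x) * newton_kernel x)"
  proof -
    have "q x * adv_potential (\<lambda>p. a * f p + b * g p) (x, norm x) * newton_kernel x
       = a * (q x * adv_potential f (x, norm x) * newton_kernel x)
         + b * (q x * adv_potential g (x, norm x) * newton_kernel x)" for x
      by (simp add: lin algebra_simps)
    then show ?thesis using i j by simp
  qed
  show ?thesis using d unfolding duhamel_against_def 1 2 3 by (simp add: algebra_simps)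
qed

text \<open>Stability under bounded pointwise limits, together with linearity, is what a monotone
  class argument requires. Each of the three integrals converges by dominated convergence, the inner
  potentials first.\<close>

lemma duhamel_against_LIMSEQ:
  assumes m: "\<And>n. F n \<in> borel_measurable borel"
    and B: "\<And>n y. \<bar>F n y\<bar> \<le> B" and 0: "\<And>n y. snd y \<ge> T \<Longrightarrow> F n y = 0"
    and lim: "\<And>y. (\<lambda>n. F n y) \<longlonglongrightarrow> f y" and d: "\<And>n. duhamel_against q v (F n)"
  shows "duhamel_against q v f"
proof -
  have B0: "B \<ge> 0" using B[of 0 0] by linarith
  have fm: "f \<in> borel_measurable borel" by (rule borel_measurable_LIMSEQ_real[OF lim m])
  note Flim = adv_potential_LIMSEQ[OF T m B 0 lim]
  have 1: "(\<lambda>n. LBINT p. v p * F n p) \<longlonglongrightarrow> (LBINT p. v p * f p)"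
  proof (rule integral_dominated_convergence[OF _ _ integrable_ball_indicator[of "Bv * B"]])
    show "AE p in lborel. norm (v p * F n p) \<le> Bv * B * indicator (ball 0 (2 * T + 1)) p" for n
      using v_times_dominated[OF B 0] by (intro AE_I2) simp
    show "AE p in lborel. (\<lambda>n. v p * F n p) \<longlonglongrightarrow> v p * f p"
      by (intro AE_I2 tendsto_mult lim tendsto_const)
  qed (use fm m in simp_all)
  have z: "q (fst p) * adv_potential (F n) p = 0" if "snd p \<ge> T" for p n
    using adv_potential_eq_0_time[OF 0 that] by simp
  note pb = potential_term_bound[OF m B B0 0]
  have 2: "(\<lambda>n. LBINT p. v p * (q (fst p) * adv_potential (F n) p))
     \<longlonglongrightarrow> (LBINT p. v p * (q (fst p) * adv_potential f p))"
  proof (rule integral_dominated_convergence[OF _ _ integrable_ball_indicator])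
    show "AE p in lborel. norm (v p * (q (fst p) * adv_potential (F n) p))
        \<le> Bv * (Bq * (B * (ball3_vol * T\<^sup>2))) * indicator (ball 0 (2 * T + 1)) p" for n
      using v_times_dominated[OF pb z] by (intro AE_I2) simp
    show "AE p in lborel. (\<lambda>n. v p * (q (fst p) * adv_potential (F n) p))
        \<longlonglongrightarrow> v p * (q (fst p) * adv_potential f p)"
    proof (intro AE_I2)
      fix p
      show "(\<lambda>n. v p * (q (fst p) * adv_potential (F n) p))
        \<longlonglongrightarrow> v p * (q (fst p) * adv_potential f p)"
      proof (cases "snd p \<ge> 0")
        case True
        then show ?thesis by (intro tendsto_mult Flim tendsto_const)
      next
        case False
        then have "v p = 0" using goursat_solution_eq_0[OF gs, of p] norm_ge_zero[of "fst p"] by linarith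
        then show ?thesis by simp
      qed
    qed
    show "(\<lambda>p. v p * (q (fst p) * adv_potential f p)) \<in> borel_measurable lborel"
      using q_measurable_term[OF fm] by simp
    show "(\<lambda>p. v p * (q (fst p) * adv_potential (F n) p)) \<in> borel_measurable lborel" for n
      using q_measurable_term[OF m] by simp
  qed
  have 3: "(\<lambda>n. LBINT x. q x * adv_potential (F n) (x, norm x) * newton_kernel x)
     \<longlonglongrightarrow> (LBINT x. q x * adv_potential f (x, norm x) * newton_kernel x)"
  proof (rule integral_dominated_convergence[where w = "\<lambda>x. Bq * (B * (ball3_vol * T\<^sup>2)) * (indicator (ball 0 T) x * newton_kernel x)"])
    show "integrable lborel (\<lambda>x. Bq * (B * (ball3_vol * T\<^sup>2)) * (indicator (ball 0 T) x * newton_kernel x))"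
      by (intro integrable_mult_right integrable_newton_kernel T)
    show "AE x in lborel. (\<lambda>n. q x * adv_potential (F n) (x, norm x) * newton_kernel x)
        \<longlonglongrightarrow> q x * adv_potential f (x, norm x) * newton_kernel x"
      by (intro AE_I2 tendsto_mult Flim tendsto_const) auto
    show "AE x in lborel. norm (q x * adv_potential (F n) (x, norm x) * newton_kernel x)
        \<le> Bq * (B * (ball3_vol * T\<^sup>2)) * (indicator (ball 0 T) x * newton_kernel x)" for n
    proof (intro AE_I2)
      fix x :: space
      show "norm (q x * adv_potential (F n) (x, norm x) * newton_kernel x)
        \<le> Bq * (B * (ball3_vol * T\<^sup>2)) * (indicator (ball 0 T) x * newton_kernel x)"
      proof (cases "norm x < T")
        case True
        then have "\<bar>q x * adv_potential (F n) (x, norm x)\<bar> * newton_kernel x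
           \<le> Bq * (B * (ball3_vol * T\<^sup>2)) * newton_kernel x"
          using pb[of "(x, norm x)" n] by (intro mult_right_mono) auto
        then show ?thesis using True by (simp add: abs_mult)
      next
        case False
        then show ?thesis using z[of "(x, norm x)" n] by simp
      qed
    qed
    show "(\<lambda>x. q x * adv_potential f (x, norm x) * newton_kernel x) \<in> borel_measurable lborel"
      using q_measurable_cone_term[OF fm] by simp
    show "(\<lambda>x. q x * adv_potential (F n) (x, norm x) * newton_kernel x) \<in> borel_measurable lborel" for n
      using q_measurable_cone_term[OF m] by simp
  qed
  have "(\<lambda>n. LBINT p. v p * F n p) \<longlonglongrightarrow>
     (LBINT p. v p * (q (fst p) * adv_potential f p))
     + (LBINT x. q x * adv_potential f (x, norm x) * newton_kernel x)"
    using tendsto_add[OF 2 3] d unfolding duhamel_against_def by simp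
  from LIMSEQ_unique[OF 1 this] show ?thesis unfolding duhamel_against_def .
qed

end

section \<open>From test functions to bounded Borel functions\<close>

locale point_source_problem = goursat_problem +
  fixes u :: "(spacetime \<Rightarrow> real) \<Rightarrow> real"
  assumes sol: "ivp_solution q u v"
begin

abbreviation slab :: "spacetime set" where "slab \<equiv> {p. snd p < T}"

lemma slab_sets [measurable]: "slab \<in> sets borel"
  by (intro borel_open open_Collect_less continuous_intros)

lemma admissible_indicator: "A \<in> sets borel \<Longrightarrow> admissible T (indicator (A \<inter> slab))"
  unfolding admissible_def by (auto intro!: exI[of _ 1] simp: indicator_def)

text \<open>A box cut off at time \<open>T\<close> is again a box, with upper corner
  \<open>c\<close>. Its bumps are test functions vanishing from time \<open>T\<close> on, so the
  identity passes to their limit.\<close>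

lemma duhamel_against_box: "duhamel_against q v (indicator (box a b \<inter> slab))"
proof -
  define c where "c = (fst b, min (snd b) T)"
  have mem: "(x \<in> box a b) \<longleftrightarrow> (\<forall>i\<in>Basis. fst a \<bullet> i < fst x \<bullet> i \<and> fst x \<bullet> i < fst b \<bullet> i) \<and> snd a < snd x \<and> snd x < snd b"
    for x a b :: spacetime
    by (auto simp: mem_box Basis_prod_def ball_Un inner_prod_def)
  have eq: "box a b \<inter> slab = box a c"
    by (auto simp: mem c_def simp del: split_paired_All)
  show ?thesis
    unfolding eq
  proof (rule duhamel_against_LIMSEQ[where F = "\<lambda>n. box_bump n a c" and B = 1])
    have bb: "bounded (box a c)" by simp
    have "box_bump n a c \<in> test_functions" for n
    proof -
      obtain R where R: "R > 0" "box a c \<subseteq> ball 0 R" using bounded_subset_ballD[OF bb] by blast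
      then have "\<forall>p. norm p \<ge> R \<longrightarrow> box_bump n a c p = 0" by (auto intro!: box_bump_eq_0)
      then show ?thesis unfolding test_functions_iff using R Ck_on_box_bump by blast
    qed
    then show "duhamel_against q v (box_bump n a c)" "box_bump n a c \<in> borel_measurable borel" for n
      using duhamel_against_test_function[OF sol qc] Cc_measurable test_functions_Cc by blast+
    show "\<bar>box_bump n a c y\<bar> \<le> 1" for n y
      using box_bump_bounds[of n a c y] by simp
    show "box_bump n a c y = 0" if "snd y \<ge> T" for n y
      by (rule box_bump_eq_0) (use that in \<open>simp add: mem c_def\<close>)
  qed (rule box_bump_LIMSEQ)
qed

text \<open>Needed as the total set in the complement step of the measure-theoretic induction;
  growing boxes exhaust the slab.\<close>

lemma duhamel_against_slab: "duhamel_against q v (indicator slab)"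
proof (rule duhamel_against_LIMSEQ[where F = "\<lambda>n. indicator (box (- (real n *\<^sub>R One)) (real n *\<^sub>R One) \<inter> slab)" and B = 1])
  show "(\<lambda>n. indicator (box (- (real n *\<^sub>R One)) (real n *\<^sub>R One) \<inter> slab) p) \<longlonglongrightarrow> (indicator slab p :: real)" for p
  proof (rule tendsto_eventually)
    obtain N :: nat where N: "norm p < real N" using reals_Archimedean2 by blast
    show "\<forall>\<^sub>F n in sequentially. indicator (box (- (real n *\<^sub>R One)) (real n *\<^sub>R One) \<inter> slab) p = (indicator slab p :: real)"
      using eventually_ge_at_top[of N]
    proof eventually_elim
      case (elim n)
      have "\<bar>p \<bullet> i\<bar> < real n" if "i \<in> Basis" for i
        using Basis_le_norm[OF that, of p] N elim by linarith
      then have "p \<in> box (- (real n *\<^sub>R One)) (real n *\<^sub>R One)"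
        by (auto simp: mem_box abs_less_iff minus_less_iff)
      then show ?case by (simp add: indicator_def)
    qed
  qed
qed (auto simp: duhamel_against_box indicator_def)

text \<open>Dynkin's pi-lambda argument: open boxes form an intersection-stable generator of the
  Borel sets, complements are handled by subtraction from the slab and disjoint unions by bounded
  pointwise limits.\<close>

lemma duhamel_against_indicator:
  assumes "A \<in> sets borel"
  shows "duhamel_against q v (indicator (A \<inter> slab))"
proof -
  have "Int_stable (range (\<lambda>(a, b). box a b :: spacetime set))"
    by (auto simp: Int_stable_def box_Int_box)
  moreover have "range (\<lambda>(a, b). box a b :: spacetime set) \<subseteq> Pow UNIV" by auto
  moreover have "A \<in> sigma_sets UNIV (range (\<lambda>(a, b). box a b))"
    using assms unfolding borel_eq_box by simp
  ultimately show ?thesis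
  proof (induction rule: sigma_sets_induct_disjoint)
    case (basic A)
    then show ?case using duhamel_against_box by auto
  next
    case empty
    then show ?case by (simp add: duhamel_against_def adv_potential_def)
  next
    case (compl A)
    then have A: "A \<in> sets borel" by (simp add: borel_eq_box)
    have "indicator ((UNIV - A) \<inter> slab) = (\<lambda>p. 1 * indicator slab p + (- 1) * indicator (A \<inter> slab) p :: real)"
      by (auto simp: indicator_def)
    then show ?case
      using duhamel_against_lincomb[of "indicator slab" "indicator (A \<inter> slab)" 1 "- 1"] compl duhamel_against_slab
        admissible_indicator[OF A] admissible_indicator[of UNIV] by simp
  next
    case (union A)
    then have A: "A i \<in> sets borel" for i by (simp add: borel_eq_box subset_eq)
    have fin: "duhamel_against q v (indicator ((\<Union>i<n. A i) \<inter> slab))" for n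
    proof (induction n)
      case 0
      then show ?case by (simp add: duhamel_against_def adv_potential_def)
    next
      case (Suc n)
      have "A i \<inter> A n = {}" if "i < n" for i
        using union(1) that by (auto simp: disjoint_family_on_def)
      then have "indicator ((\<Union>i<Suc n. A i) \<inter> slab)
          = (\<lambda>p. 1 * indicator ((\<Union>i<n. A i) \<inter> slab) p + 1 * indicator (A n \<inter> slab) p :: real)"
        by (fastforce simp: indicator_def lessThan_Suc)
      moreover have "(\<Union>i<n. A i) \<in> sets borel" using A by blast
      ultimately show ?case
        using duhamel_against_lincomb[OF admissible_indicator admissible_indicator[OF A[of n]] Suc union(3), of 1 1] by simp
    qed
    show ?case
    proof (rule duhamel_against_LIMSEQ[where B = 1, OF _ _ _ _ fin])
      fix p
      show "(\<lambda>n. indicator ((\<Union>i<n. A i) \<inter> slab) p) \<longlonglongrightarrow> (indicator (\<Union> (range A) \<inter> slab) p :: real)"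
        using LIMSEQ_indicator_UN[of "\<lambda>i. A i \<inter> slab" p] by simp
      show "indicator ((\<Union>i<n. A i) \<inter> slab) \<in> borel_measurable borel" for n
        using A by (intro borel_measurable_indicator sets.Int slab_sets) blast
    qed (auto simp: indicator_def)
  qed
qed

lemma duhamel_against_sum:
  assumes "finite I" "\<And>i. i \<in> I \<Longrightarrow> admissible T (F i)" "\<And>i. i \<in> I \<Longrightarrow> duhamel_against q v (F i)"
  shows "admissible T (\<lambda>p. \<Sum>i\<in>I. c i * F i p) \<and> duhamel_against q v (\<lambda>p. \<Sum>i\<in>I. c i * F i p)"
  using assms
proof (induction I rule: finite_induct)
  case empty
  then show ?case by (auto simp: admissible_def duhamel_against_def adv_potential_def)
next
  case (insert i I)
  then show ?case
    using admissible_lincomb[of T "F i" "\<lambda>p. \<Sum>i\<in>I. c i * F i p" "c i" 1]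
      duhamel_against_lincomb[of "F i" "\<lambda>p. \<Sum>i\<in>I. c i * F i p" "c i" 1] by simp
qed

text \<open>The approximating simple functions satisfy |F i| <= 2 * |f|. They inherit boundedness
  and also the vanishing from time \<open>T\<close> on, and each is a finite combination of
  indicators of level sets cut to the slab.\<close>

lemma duhamel_against_admissible:
  assumes "admissible T f"
  shows "duhamel_against q v f"
proof -
  obtain B where B: "f \<in> borel_measurable borel" "\<And>p. \<bar>f p\<bar> \<le> B" "B \<ge> 0" "\<And>p. snd p \<ge> T \<Longrightarrow> f p = 0"
    using admissibleE[OF assms] by metis
  obtain F where F: "\<And>i. simple_function borel (F i)" "\<And>x. (\<lambda>i. F i x) \<longlonglongrightarrow> f x"
    "\<And>i x. dist (F i x) 0 \<le> 2 * dist (f x) 0"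
    using borel_measurable_implies_sequence_metric[OF B(1), of 0] by auto
  have Fb: "\<bar>F i x\<bar> \<le> 2 * \<bar>f x\<bar>" for i x using F(3)[of i x] by simp
  have F0: "F i x = 0" if "snd x \<ge> T" for i x using Fb[of i x] B(4)[OF that] by simp
  show ?thesis
  proof (rule duhamel_against_LIMSEQ[OF _ _ F0 F(2)])
    show "F i \<in> borel_measurable borel" for i by (rule borel_measurable_simple_function[OF F(1)])
    show "\<bar>F i y\<bar> \<le> 2 * B" for i y using Fb[of i y] B(2)[of y] by linarith
    show "duhamel_against q v (F i)" for i
    proof -
      have fin: "finite (range (F i))" using simple_functionD(1)[OF F(1)[of i]] by simp
      have eq: "(\<Sum>y\<in>range (F i). y * indicator (F i -` {y} \<inter> slab) p) = F i p" for p
      proof -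
        have "(\<Sum>y\<in>range (F i). y * indicator (F i -` {y} \<inter> slab) p) = F i p * indicator (F i -` {F i p} \<inter> slab) p"
          using fin by (subst sum.remove[of _ "F i p"]) (auto intro!: sum.neutral simp: indicator_def)
        then show ?thesis using F0[of p i] by (auto simp: indicator_def)
      qed
      have "F i -` {y} \<in> sets borel" for y using simple_functionD(2)[OF F(1)[of i], of "{y}"] by simp
      then have "duhamel_against q v (\<lambda>p. \<Sum>y\<in>range (F i). y * indicator (F i -` {y} \<inter> slab) p)"
        by (intro conjunct2[OF duhamel_against_sum[OF fin]] admissible_indicator duhamel_against_indicator)
      then show ?thesis unfolding eq .
    qed
  qed
qed

end

section \<open>Estimates for iterated potentials\<close>

lemma abs_le_imp_norm_le: "\<bar>x\<bar> \<le> y \<Longrightarrow> norm x \<le> norm (y :: real)"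
  by simp

section \<open>Integrals over thin ellipsoids\<close>

lemma near_segment:
  fixes a z :: "'a::real_inner"
  assumes s: "norm z + norm (z - a) < s" and d: "s - norm a \<le> d" and T: "s \<le> T"
  obtains l where "0 \<le> l" "l \<le> 1" "(norm (z - l *\<^sub>R a))\<^sup>2 \<le> T * d"
proof -
  define r1 r2 where "r1 = norm z" and "r2 = norm (z - a)"
  have n: "r1 \<ge> 0" "r2 \<ge> 0" by (auto simp: r1_def r2_def)
  have a: "norm a \<le> r1 + r2"
    using norm_triangle_ineq4[of z "z - a"] by (simp add: r1_def r2_def)
  have as: "norm a < s" using a s by (simp add: r1_def r2_def)
  have Td: "(s - norm a) * (s + norm a) \<le> d * (2 * T)"
    using as d T norm_ge_zero[of a] by (intro mult_mono; linarith)
  have d0: "d \<ge> 0" "T \<ge> 0" using as d T norm_ge_zero[of a] by linarith+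
  show ?thesis
  proof (cases "r1 + r2 = 0")
    case True
    then have "z = 0" using n by (simp add: r1_def add_nonneg_eq_0_iff)
    then show ?thesis using that[of 0] d0 by simp
  next
    case False
    \<comment> \<open>The point dividing the segment from 0 to \<open>a\<close> in the ratio of the
      distances from \<open>z\<close>. By Stewart's theorem its squared distance from
      \<open>z\<close> is r1 * r2 / (r1 + r2)^2 times (r1 + r2)^2 - |a|^2; the first factor is at
      most 1/4 and the second is below s^2 - |a|^2 <= 2 * T * d.\<close>
    define l where "l = r1 / (r1 + r2)"
    have pos: "r1 + r2 > 0" using False n by linarith
    have l: "0 \<le> l" "l \<le> 1" "1 - l = r2 / (r1 + r2)" using n pos by (auto simp: l_def field_simps)
    have ip: "2 * (z \<bullet> (z - a)) = r1\<^sup>2 + r2\<^sup>2 - (norm a)\<^sup>2"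
    proof -
      have "(norm (z - (z - a)))\<^sup>2 = r1\<^sup>2 + r2\<^sup>2 - 2 * (z \<bullet> (z - a))"
        unfolding r1_def r2_def by (simp only: power2_norm_eq_inner) (simp add: algebra_simps inner_commute)
      then show ?thesis by simp
    qed
    have "z - l *\<^sub>R a = (1 - l) *\<^sub>R z + l *\<^sub>R (z - a)" by (simp add: algebra_simps)
    then have "(norm (z - l *\<^sub>R a))\<^sup>2 = (1 - l)\<^sup>2 * r1\<^sup>2 + l\<^sup>2 * r2\<^sup>2 + l * (1 - l) * (2 * (z \<bullet> (z - a)))"
      unfolding r1_def r2_def power2_norm_eq_inner
      by (simp add: inner_add_left inner_add_right inner_commute power2_eq_square algebra_simps)
    also have "\<dots> = (r2 / (r1 + r2))\<^sup>2 * r1\<^sup>2 + (r1 / (r1 + r2))\<^sup>2 * r2\<^sup>2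
        + r1 / (r1 + r2) * (r2 / (r1 + r2)) * (r1\<^sup>2 + r2\<^sup>2 - (norm a)\<^sup>2)"
      unfolding ip l(3) by (simp add: l_def)
    also have "\<dots> = (r1 * r2) / (r1 + r2)\<^sup>2 * ((r1 + r2)\<^sup>2 - (norm a)\<^sup>2)"
      using pos by (simp add: divide_simps) (simp add: power2_eq_square algebra_simps)
    also have "\<dots> \<le> 1 / 4 * ((r1 + r2)\<^sup>2 - (norm a)\<^sup>2)"
    proof (rule mult_right_mono)
      have "0 \<le> (r1 - r2)\<^sup>2" by simp
      then have "4 * (r1 * r2) \<le> (r1 + r2)\<^sup>2" by (simp add: power2_eq_square algebra_simps)
      then show "(r1 * r2) / (r1 + r2)\<^sup>2 \<le> 1 / 4" using pos by (simp add: field_simps)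
      show "0 \<le> (r1 + r2)\<^sup>2 - (norm a)\<^sup>2" using power_mono[OF a, of 2] by simp
    qed
    also have "\<dots> \<le> 1 / 4 * (s\<^sup>2 - (norm a)\<^sup>2)"
      using power_mono[of "r1 + r2" s 2] pos s by (simp add: r1_def r2_def)
    also have "\<dots> \<le> T * d"
      using Td mult_nonneg_nonneg[OF d0(2,1)] by (simp add: power2_eq_square algebra_simps)
    finally show ?thesis using that l by blast
  qed
qed

text \<open>Its foci are 0 and \<open>a\<close>. With \<open>a = e - fst p\<close> and
  \<open>s = \<tau> - snd p\<close> it collects the \<open>z\<close> for which the point p + (z,
  |z|) of the forward light cone of \<open>p\<close> lies inside the backward cone with vertex (e,
  \<tau>).\<close>

definition ellipsoid :: "space \<Rightarrow> real \<Rightarrow> space set" where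
  "ellipsoid a s = {z. norm z + norm (z - a) < s}"

lemma ellipsoid_sets [measurable]: "ellipsoid a s \<in> sets borel"
  unfolding ellipsoid_def by (intro borel_open open_Collect_less continuous_intros)

lemma ellipsoid_subset_ball: "ellipsoid a s \<subseteq> ball 0 s"
proof
  fix z assume "z \<in> ellipsoid a s"
  then have "norm z + norm (z - a) < s" by (simp add: ellipsoid_def)
  then have "norm z < s" using norm_ge_zero[of "z - a"] by linarith
  then show "z \<in> ball 0 s" by simp
qed

lemma emeasure_ellipsoid_finite: "emeasure lborel (ellipsoid a s) < \<infinity>"
  using bounded_subset[OF bounded_ball ellipsoid_subset_ball] by (rule emeasure_bounded_finite)

text \<open>Uniform in \<open>a\<close> and \<open>s\<close>: a thin ellipsoid stays close to the
  segment between its foci, which has length at most \<open>T\<close>, so N + 1 balls of radius 3 *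
  T / N about equally spaced points cover it. Their total volume is O(1 / N^2).\<close>

lemma measure_ellipsoid_small:
  assumes T: "T > 0" and e: "e > 0"
  obtains d where "d > 0" "\<And>a s. s \<le> T \<Longrightarrow> s - norm a \<le> d \<Longrightarrow> measure lborel (ellipsoid a s) \<le> e"
proof -
  \<comment> \<open>The number 54 is 2 * 27: a factor 2 from N + 1 <= 2 * N and the cube of the 3 in
    the radius.\<close>
  obtain N :: nat where N: "54 * ball3_vol * T ^ 3 / e < real N" using reals_Archimedean2 by blast
  have "54 * ball3_vol * T ^ 3 / e > 0" using T e by simp
  then have N0: "real N > 0" "N > 0" using N by auto
  \<comment> \<open>Chosen so that T * d = (T / N)^2: points of the ellipsoid are then within T / N
    of the segment.\<close>
  define d where "d = T / (real N)\<^sup>2"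
  have d: "d > 0" using T N0 by (simp add: d_def)
  have "measure lborel (ellipsoid a s) \<le> e" if s: "s \<le> T" "s - norm a \<le> d" for a s
  proof -
    let ?B = "\<lambda>j::nat. ball ((real j / real N) *\<^sub>R a) (3 * T / real N)"
    have "ellipsoid a s \<subseteq> (\<Union>j\<in>{..N}. ?B j)"
    proof
      fix z assume "z \<in> ellipsoid a s"
      then have z: "norm z + norm (z - a) < s" by (simp add: ellipsoid_def)
      obtain l where l: "0 \<le> l" "l \<le> 1" "(norm (z - l *\<^sub>R a))\<^sup>2 \<le> T * d"
        using near_segment[OF z s(2,1)] by metis
      have "T * d = (T / real N)\<^sup>2" by (simp add: d_def power2_eq_square)
      then have n1: "norm (z - l *\<^sub>R a) \<le> T / real N"
        using l(3) T N0 by (auto intro!: power2_le_imp_le)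
      have na: "norm a \<le> T"
        using z s(1) norm_triangle_ineq4[of z "z - a"] by simp
      define j where "j = nat \<lfloor>l * real N\<rfloor>"
      have j: "real j \<le> l * real N" "l * real N < real j + 1"
        using l(1) N0 by (auto simp: j_def)
      have "l * real N \<le> real N" using l N0 by simp
      then have "j \<le> N" using j by linarith
      have "norm (l *\<^sub>R a - (real j / real N) *\<^sub>R a) = \<bar>l - real j / real N\<bar> * norm a"
        by (simp flip: scaleR_diff_left)
      also have "\<dots> \<le> 1 / real N * T"
      proof (intro mult_mono na)
        have "l - real j / real N = (l * real N - real j) / real N" using N0 by (simp add: field_simps)
        then show "\<bar>l - real j / real N\<bar> \<le> 1 / real N" using j by (simp add: divide_right_mono)
      qed auto
      finally have "norm (z - (real j / real N) *\<^sub>R a) \<le> T / real N + T / real N"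
        using n1 norm_triangle_ineq[of "z - l *\<^sub>R a" "l *\<^sub>R a - (real j / real N) *\<^sub>R a"] by simp
      also have "\<dots> < 3 * T / real N" using T N0 by (simp add: field_simps)
      finally have "z \<in> ?B j" by (simp add: dist_norm norm_minus_commute)
      then show "z \<in> (\<Union>j\<in>{..N}. ?B j)" using \<open>j \<le> N\<close> by blast
    qed
    then have "emeasure lborel (ellipsoid a s) \<le> emeasure lborel (\<Union>j\<in>{..N}. ?B j)"
      by (intro emeasure_mono) auto
    also have "\<dots> \<le> (\<Sum>j\<in>{..N}. emeasure lborel (?B j))"
      by (intro emeasure_subadditive_finite) auto
    also have "\<dots> = (\<Sum>j\<in>{..N}. ennreal (ball3_vol * (3 * T / real N) ^ 3))"
      using T by (intro sum.cong refl emeasure_ball3) simp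
    also have "\<dots> = ennreal (\<Sum>j\<in>{..N}. ball3_vol * (3 * T / real N) ^ 3)"
      using T by (intro sum_ennreal) simp
    also have "(\<Sum>j\<in>{..N}. ball3_vol * (3 * T / real N) ^ 3) = (real N + 1) * (ball3_vol * (3 * T / real N) ^ 3)"
      by simp
    finally have "measure lborel (ellipsoid a s) \<le> (real N + 1) * (ball3_vol * (3 * T / real N) ^ 3)"
      using T unfolding measure_def by (intro enn2real_leI) auto
    also have "\<dots> \<le> (2 * real N) * (ball3_vol * (3 * T / real N) ^ 3)"
      using T N0 by (intro mult_right_mono) auto
    also have "\<dots> = 54 * ball3_vol * T ^ 3 / (real N)\<^sup>2"
      using N0 by (simp add: power_divide power_mult_distrib field_simps power2_eq_square power3_eq_cube)
    also have "\<dots> \<le> 54 * ball3_vol * T ^ 3 / real N"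
      using N0 T by (intro divide_left_mono) (auto simp: power2_eq_square)
    also have "\<dots> \<le> e" using N N0 e by (simp add: field_simps)
    finally show ?thesis .
  qed
  then show ?thesis using that d by blast
qed

abbreviation ellipsoid_potential :: "space \<Rightarrow> real \<Rightarrow> space \<Rightarrow> real" where
  "ellipsoid_potential a s z \<equiv> indicator (ellipsoid a s) z / (norm z * norm (z - a))"

text \<open>The arithmetic-geometric inequality 1 / (a * b) <= (1 / a^2 + 1 / b^2) / 2 separates the
  two singularities. For the last bound each inverse square is split at distance
  \<open>\<rho>\<close> from its focus: the inner part integrates to O(\<rho>), the outer one is at
  most 1 / \<rho>^2 on the ellipsoid.\<close>

lemma ellipsoid_potential_integral:
  assumes s: "0 < s" "s \<le> T"
  shows "integrable lborel (ellipsoid_potential a s)"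
    and "integral\<^sup>L lborel (ellipsoid_potential a s) \<le> 8 * ball3_vol * T"
    and "\<And>\<rho>. \<rho> > 0 \<Longrightarrow> integral\<^sup>L lborel (ellipsoid_potential a s)
           \<le> 8 * ball3_vol * \<rho> + measure lborel (ellipsoid a s) / \<rho>\<^sup>2"
proof -
  let ?E = "ellipsoid a s"
  let ?i = "\<lambda>(c::space) r z. indicator (ball c r) z / (norm (z - c))\<^sup>2 :: real"
  have am: "1 / (norm z * norm (z - a)) \<le> 1 / 2 * (1 / (norm z)\<^sup>2) + 1 / 2 * (1 / (norm (z - a))\<^sup>2)" for z
  proof -
    have "0 \<le> (1 / norm z - 1 / norm (z - a))\<^sup>2" by simp
    then show ?thesis by (simp add: power2_diff power_divide)
  qed
  have le1: "ellipsoid_potential a s z \<le> 1 / 2 * ?i 0 T z + 1 / 2 * ?i a T z" for z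
  proof (cases "z \<in> ?E")
    case True
    then have "norm z + norm (z - a) < T" using s(2) by (simp add: ellipsoid_def)
    then have "norm z < T" "norm (z - a) < T" using norm_ge_zero[of z] norm_ge_zero[of "z - a"] by linarith+
    then have "z \<in> ball 0 T" "z \<in> ball a T" by (simp_all add: dist_norm norm_minus_commute)
    then show ?thesis using am[of z] True by simp
  qed simp
  have T: "T > 0" using s by simp
  note ii = integrable_inverse_square[OF T]
  have i1: "integrable lborel (\<lambda>z. 1 / 2 * ?i 0 T z + 1 / 2 * ?i a T z)"
    by (intro Bochner_Integration.integrable_add integrable_mult_right ii)
  have m: "ellipsoid_potential a s \<in> borel_measurable borel" by measurable
  show i: "integrable lborel (ellipsoid_potential a s)"
  proof (rule Bochner_Integration.integrable_bound[OF i1])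
    have "0 \<le> ellipsoid_potential a s z" for z by simp
    then show "AE z in lborel. norm (ellipsoid_potential a s z) \<le> norm (1 / 2 * ?i 0 T z + 1 / 2 * ?i a T z)"
      using le1 by (intro AE_I2 abs_le_imp_norm_le) (simp only: abs_of_nonneg)
  qed (use m in simp)
  have "integral\<^sup>L lborel (ellipsoid_potential a s) \<le> (LBINT z. 1 / 2 * ?i 0 T z + 1 / 2 * ?i a T z)"
    by (intro integral_mono i i1 le1)
  also have "\<dots> = 1 / 2 * (LBINT z. ?i 0 T z) + 1 / 2 * (LBINT z. ?i a T z)"
    by (simp only: Bochner_Integration.integral_add[OF integrable_mult_right integrable_mult_right, OF ii(1) ii(1)]
        integral_mult_right_zero)
  also have "\<dots> \<le> 8 * ball3_vol * T" using ii(2)[of 0] ii(2)[of a] by simp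
  finally show "integral\<^sup>L lborel (ellipsoid_potential a s) \<le> 8 * ball3_vol * T" .
  fix \<rho> :: real assume \<rho>: "\<rho> > 0"
  note jj = integrable_inverse_square[OF \<rho>]
  have ei: "integrable lborel (indicator ?E :: space \<Rightarrow> real)"
    using emeasure_ellipsoid_finite by (intro integrable_real_indicator) auto
  have split: "indicator ?E z / (norm (z - c))\<^sup>2 \<le> ?i c \<rho> z + 1 / \<rho>\<^sup>2 * indicator ?E z" for c z
  proof (cases "norm (z - c) < \<rho>")
    case True
    then show ?thesis by (auto simp: indicator_def dist_norm norm_minus_commute)
  next
    case False
    then have "\<rho>\<^sup>2 \<le> (norm (z - c))\<^sup>2" using \<rho> by (intro power_mono) auto
    moreover have "\<rho>\<^sup>2 > 0" using \<rho> by simp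
    ultimately have "1 / (norm (z - c))\<^sup>2 \<le> 1 / \<rho>\<^sup>2" by (intro divide_left_mono mult_pos_pos) auto
    then show ?thesis using False by (simp add: indicator_def dist_norm norm_minus_commute)
  qed
  have le2: "ellipsoid_potential a s z \<le> 1 / 2 * ?i 0 \<rho> z + 1 / 2 * ?i a \<rho> z + 1 / \<rho>\<^sup>2 * indicator ?E z" for z
    using am[of z] split[of z 0] split[of z a] by (cases "z \<in> ?E") (auto simp: field_simps)
  have i2: "integrable lborel (\<lambda>z. 1 / 2 * ?i 0 \<rho> z + 1 / 2 * ?i a \<rho> z + 1 / \<rho>\<^sup>2 * indicator ?E z)"
    by (intro Bochner_Integration.integrable_add integrable_mult_right jj ei)
  have "integral\<^sup>L lborel (ellipsoid_potential a s)
      \<le> (LBINT z. 1 / 2 * ?i 0 \<rho> z + 1 / 2 * ?i a \<rho> z + 1 / \<rho>\<^sup>2 * indicator ?E z)"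
    by (intro integral_mono i i2 le2)
  also have "\<dots> = 1 / 2 * (LBINT z. ?i 0 \<rho> z) + 1 / 2 * (LBINT z. ?i a \<rho> z) + 1 / \<rho>\<^sup>2 * measure lborel ?E"
    by (simp only: Bochner_Integration.integral_add[OF Bochner_Integration.integrable_add[OF integrable_mult_right integrable_mult_right] integrable_mult_right, OF jj(1) jj(1) ei]
        Bochner_Integration.integral_add[OF integrable_mult_right integrable_mult_right, OF jj(1) jj(1)]
        integral_mult_right_zero) simp
  also have "\<dots> \<le> 8 * ball3_vol * \<rho> + measure lborel ?E / \<rho>\<^sup>2" using jj(2)[of 0] jj(2)[of a] by simp
  finally show "integral\<^sup>L lborel (ellipsoid_potential a s) \<le> 8 * ball3_vol * \<rho> + measure lborel ?E / \<rho>\<^sup>2" .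
qed

lemma ellipsoid_potential_small:
  assumes T: "T > 0" and e: "e > 0"
  obtains d where "d > 0"
    "\<And>a s. 0 < s \<Longrightarrow> s \<le> T \<Longrightarrow> s - norm a \<le> d \<Longrightarrow> integral\<^sup>L lborel (ellipsoid_potential a s) \<le> e"
proof -
  \<comment> \<open>The contribution 8 * \<open>ball3_vol\<close> * \<rho> of the singularities
    becomes e / 2; the volume is then made small enough for the other half.\<close>
  define \<rho> where "\<rho> = e / (16 * ball3_vol)"
  have \<rho>: "\<rho> > 0" using e by (simp add: \<rho>_def)
  then obtain d where d: "d > 0" "\<And>a s. s \<le> T \<Longrightarrow> s - norm a \<le> d \<Longrightarrow> measure lborel (ellipsoid a s) \<le> e / 2 * \<rho>\<^sup>2"
    using measure_ellipsoid_small[OF T, of "e / 2 * \<rho>\<^sup>2"] e by auto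
  have "integral\<^sup>L lborel (ellipsoid_potential a s) \<le> e" if "0 < s" "s \<le> T" "s - norm a \<le> d" for a s
  proof -
    have "measure lborel (ellipsoid a s) / \<rho>\<^sup>2 \<le> e / 2" using d(2)[OF that(2,3)] \<rho> by (simp add: field_simps)
    moreover have "8 * ball3_vol * \<rho> = e / 2"
    proof -
      have "ball3_vol > 0" by simp
      then show ?thesis unfolding \<rho>_def by (simp add: less_imp_neq[symmetric])
    qed
    ultimately show ?thesis using ellipsoid_potential_integral(3)[OF that(1,2) \<rho>, of a] by linarith
  qed
  then show ?thesis using that d(1) by blast
qed

text \<open>The factor by which \<open>adv_potential\<close> acts on functions bounded by multiples
  of exp(l * (T - t)), a Bielecki weight. Taking \<open>l\<close> large makes the Neumann step a
  contraction with no smallness condition on \<open>T\<close> or on the potential.\<close>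

definition weighted_mass :: "real \<Rightarrow> real \<Rightarrow> real" where
  "weighted_mass T l = (LBINT z. indicator (ball 0 T) z * newton_kernel z * exp (- l * norm z))"

lemma integrable_weighted_mass:
  assumes "T > 0" "l \<ge> 0"
  shows "integrable lborel (\<lambda>z. indicator (ball 0 T) z * newton_kernel z * exp (- l * norm z))"
  by (rule Bochner_Integration.integrable_bound[OF integrable_newton_kernel(1)[OF assms(1)]])
    (measurable, use assms in \<open>auto intro!: AE_I2 mult_left_le simp: abs_mult\<close>)

lemma weighted_mass_small:
  assumes T: "T > 0" and e: "e > 0"
  obtains l where "l \<ge> 0" "weighted_mass T l \<le> e"
proof -
  have "(\<lambda>n. weighted_mass T (real n)) \<longlonglongrightarrow> (\<integral>z. 0 \<partial>(lborel :: space measure))"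
    unfolding weighted_mass_def
  proof (rule integral_dominated_convergence[where w = "\<lambda>z. indicator (ball 0 T) z * newton_kernel z"])
    show "integrable lborel (\<lambda>z. indicator (ball 0 T) z * newton_kernel z)"
      by (rule integrable_newton_kernel(1)[OF T])
    show "AE z in lborel. (\<lambda>n. indicator (ball 0 T) z * newton_kernel z * exp (- real n * norm z)) \<longlonglongrightarrow> 0"
    proof (intro AE_I2)
      fix z :: space
      show "(\<lambda>n. indicator (ball 0 T) z * newton_kernel z * exp (- real n * norm z)) \<longlonglongrightarrow> 0"
      \<comment> \<open>The exponential does not decay at z = 0, but there the kernel is 0 by the
        convention x / 0 = 0.\<close>
      proof (cases "z = 0")
        case False
        have "(\<lambda>n. exp (- norm z) ^ n) \<longlonglongrightarrow> 0" using False by (intro LIMSEQ_power_zero) simp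
        moreover have "exp (- real n * norm z) = exp (- norm z) ^ n" for n
          by (simp flip: exp_of_nat_mult)
        ultimately show ?thesis by (auto intro: tendsto_mult_right_zero)
      qed (simp add: newton_kernel_def)
    qed
    show "AE z in lborel. norm (indicator (ball 0 T) z * newton_kernel z * exp (- real n * norm z))
       \<le> indicator (ball 0 T) z * newton_kernel z" for n
      by (auto intro!: AE_I2 mult_left_le simp: abs_mult)
  qed (use integrable_weighted_mass[OF T] in \<open>auto dest: borel_measurable_integrable\<close>)
  then have "\<forall>\<^sub>F n in sequentially. weighted_mass T (real n) < e"
    using e by (auto dest: order_tendstoD(2))
  then obtain n where "weighted_mass T (real n) < e" by (meson eventually_sequentially order_refl)
  then show ?thesis using that[of "real n"] by simp
qed

text \<open>Along the forward cone time advances by |z|, so the weight splits as exp(l * (T - t))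
  times exp(- l * |z|); the second factor is absorbed into the kernel mass.\<close>

lemma adv_potential_weighted_bound:
  assumes f: "f \<in> borel_measurable borel" and T: "T > 0" and l: "l \<ge> 0" and B: "B \<ge> 0"
    and b: "\<And>z. snd p + norm z < T \<Longrightarrow> \<bar>f (p + (z, norm z))\<bar> \<le> B * exp (l * (T - (snd p + norm z)))"
    and 0: "\<And>y. snd y \<ge> T \<Longrightarrow> f y = 0" and p: "snd p \<ge> 0"
  shows "\<bar>adv_potential f p\<bar> \<le> B * weighted_mass T l * exp (l * (T - snd p))"
proof -
  let ?w = "\<lambda>z. B * exp (l * (T - snd p)) * (indicator (ball 0 T) z * newton_kernel z * exp (- l * norm z))"
  have wi: "integrable lborel ?w" by (intro integrable_mult_right integrable_weighted_mass T l)
  have le: "\<bar>f (p + (z, norm z)) * newton_kernel z\<bar> \<le> ?w z" for z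
  proof (cases "snd p + norm z < T")
    case True
    have "exp (l * (T - (snd p + norm z))) = exp (l * (T - snd p)) * exp (- l * norm z)"
      by (simp add: algebra_simps flip: exp_add)
    moreover have "norm z < T" using True p by linarith
    ultimately show ?thesis
      using mult_right_mono[OF b[OF True] newton_kernel_nonneg[of z]] by (simp add: abs_mult mult_ac)
  next
    case False
    then have "f (p + (z, norm z)) = 0" by (intro 0) simp
    then show ?thesis using B by simp
  qed
  have fi: "integrable lborel (\<lambda>z. f (p + (z, norm z)) * newton_kernel z)"
  proof (rule Bochner_Integration.integrable_bound[OF wi])
    show "(\<lambda>z. f (p + (z, norm z)) * newton_kernel z) \<in> borel_measurable lborel"
      using measurable_compose[OF measurable_retarded_shift f] by simp
    show "AE z in lborel. norm (f (p + (z, norm z)) * newton_kernel z) \<le> norm (?w z)"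
      by (intro AE_I2 abs_le_imp_norm_le le)
  qed
  have "\<bar>adv_potential f p\<bar> \<le> (LBINT z. ?w z)"
    unfolding adv_potential_def
    using Bochner_Integration.integral_norm_bound_integral[OF fi wi] le by simp
  also have "\<dots> = B * weighted_mass T l * exp (l * (T - snd p))"
    unfolding weighted_mass_def by simp
  finally show ?thesis .
qed

text \<open>The later estimates contain 1 / |x| and 1 / |x - e|, which are 0 in Isabelle at the
  singular points, so they can be claimed only off the time axes over 0 and
  \<open>e\<close>.\<close>

lemma AE_fst_neq: "AE p in (lborel :: ('a::euclidean_space \<times> 'b::euclidean_space) measure). fst p \<noteq> c"
proof -
  have "emeasure (lborel \<Otimes>\<^sub>M lborel) ({c} \<times> (UNIV :: 'b::euclidean_space set)) = emeasure lborel {c} * emeasure lborel (UNIV :: 'b set)"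
    by (rule lborel.emeasure_pair_measure_Times) auto
  then have "{c} \<times> (UNIV :: 'b set) \<in> null_sets lborel"
    by (auto simp: lborel_prod null_sets_def intro!: borel_closed closed_Times)
  then show "AE p in (lborel :: ('a \<times> 'b) measure). fst p \<noteq> c"
    by (rule AE_I') auto
qed

text \<open>A source bounded by C / |y - e| inside the backward cone meets the kernel, which is at
  most 1 / |z|. The product is the two-centre weight over the ellipsoid attached to
  \<open>p\<close>, and the size of that ellipsoid controls the result.\<close>

lemma adv_potential_of_inverse_distance:
  assumes f: "f \<in> borel_measurable borel" and s: "0 < \<tau> - snd p" "\<tau> \<le> T" and p: "snd p \<ge> 0" and C: "C \<ge> 0"
    and b: "\<And>y. snd y \<ge> 0 \<Longrightarrow> fst y \<noteq> e \<Longrightarrow> snd y + norm (fst y - e) < \<tau> \<Longrightarrow> \<bar>f y\<bar> \<le> C / norm (fst y - e)"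
    and 0: "\<And>y. snd y \<ge> 0 \<Longrightarrow> snd y + norm (fst y - e) \<ge> \<tau> \<Longrightarrow> f y = 0"
  shows "\<bar>adv_potential f p\<bar> \<le> C * integral\<^sup>L lborel (ellipsoid_potential (e - fst p) (\<tau> - snd p))"
proof -
  let ?a = "e - fst p" and ?s = "\<tau> - snd p"
  have sT: "?s \<le> T" using s p by simp
  have wi: "integrable lborel (\<lambda>z. C * ellipsoid_potential ?a ?s z)"
    by (intro integrable_mult_right ellipsoid_potential_integral(1)[OF s(1) sT])
  have le: "\<bar>f (p + (z, norm z)) * newton_kernel z\<bar> \<le> C * ellipsoid_potential ?a ?s z" if "z \<noteq> ?a" for z
  proof -
    let ?y = "p + (z, norm z)"
    have y: "snd ?y \<ge> 0" "fst ?y - e = z - ?a" using p by auto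
    have nz: "norm (z - ?a) > 0" using that by simp
    show ?thesis
    proof (cases "z \<in> ellipsoid ?a ?s")
      case True
      then have "snd ?y + norm (fst ?y - e) < \<tau>" unfolding y(2) by (simp add: ellipsoid_def)
      moreover have "fst ?y \<noteq> e" using y(2) nz by auto
      ultimately have "\<bar>f ?y\<bar> \<le> C / norm (z - ?a)" using b[OF y(1)] unfolding y(2) by blast
      moreover have "newton_kernel z \<le> 1 / norm z"
        using pi_gt3 by (cases "z = 0") (auto simp: newton_kernel_def field_simps)
      ultimately have "\<bar>f ?y\<bar> * newton_kernel z \<le> C / norm (z - ?a) * (1 / norm z)"
        using C by (intro mult_mono) auto
      then show ?thesis using True by (simp add: abs_mult mult.commute)
    next
      case False
      then have "snd ?y + norm (fst ?y - e) \<ge> \<tau>" unfolding y(2) by (simp add: ellipsoid_def)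
      then show ?thesis using 0[OF y(1)] False by simp
    qed
  qed
  have AE: "AE z in lborel. norm (f (p + (z, norm z)) * newton_kernel z) \<le> C * ellipsoid_potential ?a ?s z"
    using AE_lborel_singleton[of ?a] by eventually_elim (use le in simp)
  have fi: "integrable lborel (\<lambda>z. f (p + (z, norm z)) * newton_kernel z)"
  proof (rule Bochner_Integration.integrable_bound[OF wi])
    show "(\<lambda>z. f (p + (z, norm z)) * newton_kernel z) \<in> borel_measurable lborel"
      using measurable_compose[OF measurable_retarded_shift f] by simp
    show "AE z in lborel. norm (f (p + (z, norm z)) * newton_kernel z) \<le> norm (C * ellipsoid_potential ?a ?s z)"
      using AE by eventually_elim (simp only: real_norm_def abs_le_imp_norm_le)
  qed
  have "\<bar>adv_potential f p\<bar> \<le> (LBINT z. norm (f (p + (z, norm z)) * newton_kernel z))"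
    unfolding adv_potential_def 
    using integral_norm_bound[of lborel "\<lambda>z. f (p + (z, norm z)) * newton_kernel z"] by (simp only: real_norm_def)
  also have "\<dots> \<le> (LBINT z. C * ellipsoid_potential ?a ?s z)"
    by (intro integral_mono_AE AE wi integrable_norm fi)
  finally show ?thesis unfolding integral_mult_right_zero .
qed

text \<open>The potential of this source is an average over \<open>ball e r\<close> of backward fundamental solutions,
  integrated in time and normalised by \<open>r ^ 3\<close> instead of the volume of the ball.\<close>

definition source_average :: "space \<Rightarrow> real \<Rightarrow> real \<Rightarrow> spacetime \<Rightarrow> real" where
  "source_average e \<tau> r p = indicator (ball e r) (fst p) * indicator {..<\<tau> - r} (snd p) / r ^ 3"

lemma source_average_measurable [measurable]: "source_average e \<tau> r \<in> borel_measurable borel"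
proof -
  have eq: "source_average e \<tau> r = (\<lambda>p. indicator {p. dist e (fst p) < r \<and> snd p < \<tau> - r} p / r ^ 3)"
    by (auto simp: source_average_def indicator_def)
  have "open {p :: spacetime. dist e (fst p) < r \<and> snd p < \<tau> - r}"
    by (intro open_Collect_conj open_Collect_less continuous_intros)
  then show ?thesis unfolding eq by (intro borel_measurable_divide borel_measurable_indicator) auto
qed

lemma source_average_nonneg: "r > 0 \<Longrightarrow> source_average e \<tau> r p \<ge> 0"
  by (simp add: source_average_def)

lemma source_average_bound: "r > 0 \<Longrightarrow> \<bar>source_average e \<tau> r p\<bar> \<le> 1 / r ^ 3"
  by (simp add: source_average_def indicator_def)

text \<open>Ending the source at time \<tau> - r compensates for the radius of the ball, so it stays
  inside the backward cone with vertex (e, \<tau>).\<close>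

lemma source_average_eq_0: "r > 0 \<Longrightarrow> snd p + norm (fst p - e) \<ge> \<tau> \<Longrightarrow> source_average e \<tau> r p = 0"
  by (auto simp: source_average_def indicator_def dist_norm norm_minus_commute)

text \<open>The quantity t + |x - e| cannot decrease along forward light rays. This is finite
  propagation speed: the potential of a source inside t + |x - e| < \<tau> vanishes outside that
  region.\<close>

lemma forward_cone_gap:
  "snd p + norm (fst p - e) \<le> snd (p + (z, norm z)) + norm (fst (p + (z, norm z)) - e)"
  for e :: space
  using norm_triangle_ineq4[of "fst p + z - e" z] by (simp add: algebra_simps)

lemma adv_potential_source_average_eq_0:
  assumes "r > 0" "snd p + norm (fst p - e) \<ge> \<tau>"
  shows "adv_potential (source_average e \<tau> r) p = 0"
  by (rule adv_potential_eq_0, rule source_average_eq_0[OF assms(1)])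
    (rule order_trans[OF assms(2) forward_cone_gap])

text \<open>Uniform in \<open>r\<close> and \<open>\<tau>\<close>. If |a| >= 2 * r, the kernel is at
  most 1 / |a| on the ball about \<open>a\<close>. Otherwise that ball lies in the ball of radius 3
  * r about 0, whose kernel mass divided by r^3 is at most 9 * \<open>ball3_vol\<close> / r, and 1 /
  r < 2 / |a| gives the factor 18.\<close>

lemma adv_potential_source_average_le:
  assumes r: "r > 0" and p: "fst p \<noteq> e"
  shows "\<bar>adv_potential (source_average e \<tau> r) p\<bar> \<le> 18 * ball3_vol / norm (fst p - e)"
proof -
  define a where "a = e - fst p"
  have a: "norm a > 0" "norm (fst p - e) = norm a" using p by (auto simp: a_def norm_minus_commute)
  let ?I = "\<lambda>z. indicator (ball a r) z :: real"
  have le: "\<bar>source_average e \<tau> r (p + (z, norm z)) * newton_kernel z\<bar> \<le> ?I z / r ^ 3 * newton_kernel z" for z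
    using r by (auto simp: source_average_def indicator_def abs_mult dist_norm a_def algebra_simps)
  have sm: "(\<lambda>z. source_average e \<tau> r (p + (z, norm z)) * newton_kernel z) \<in> borel_measurable lborel"
    using measurable_compose[OF measurable_retarded_shift source_average_measurable] by simp
  have key: "\<bar>adv_potential (source_average e \<tau> r) p\<bar> \<le> integral\<^sup>L lborel g"
    if g: "integrable lborel g" "\<And>z. ?I z / r ^ 3 * newton_kernel z \<le> g z" for g
  proof -
    have le': "\<bar>source_average e \<tau> r (p + (z, norm z)) * newton_kernel z\<bar> \<le> g z" for z
      using le g(2) order_trans by blast
    have "integrable lborel (\<lambda>z. source_average e \<tau> r (p + (z, norm z)) * newton_kernel z)"
      by (rule Bochner_Integration.integrable_bound[OF g(1) sm])
        (intro AE_I2 abs_le_imp_norm_le le')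
    from Bochner_Integration.integral_norm_bound_integral[OF this g(1)] le' show ?thesis
      unfolding adv_potential_def by simp
  qed
  show ?thesis
  proof (cases "norm a \<ge> 2 * r")
    case True
    have bi: "integrable lborel (\<lambda>z. 1 / (r ^ 3 * norm a) * ?I z)"
      by (intro integrable_mult_right integrable_real_indicator emeasure_bounded_finite) auto
    have "\<bar>adv_potential (source_average e \<tau> r) p\<bar> \<le> (LBINT z. 1 / (r ^ 3 * norm a) * ?I z)"
    proof (rule key[OF bi])
      fix z
      show "?I z / r ^ 3 * newton_kernel z \<le> 1 / (r ^ 3 * norm a) * ?I z"
      proof (cases "z \<in> ball a r")
        case in_ball: True
        have "norm a \<le> norm z + norm (a - z)" using norm_triangle_ineq[of z "a - z"] by simp
        then have z: "norm a \<le> 2 * norm z" using in_ball True by (simp add: dist_norm)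
        have "1 / (4 * pi * norm z) \<le> 1 / norm a"
        proof (rule divide_left_mono)
          have "2 * norm z \<le> 4 * pi * norm z" using pi_gt3 by (intro mult_right_mono) auto
          then show "norm a \<le> 4 * pi * norm z" using z by linarith
          have "norm z > 0" using z a by linarith
          then show "0 < 4 * pi * norm z * norm a" using a by simp
        qed simp
        then have "1 / r ^ 3 * newton_kernel z \<le> 1 / r ^ 3 * (1 / norm a)"
          unfolding newton_kernel_def using r by (intro mult_left_mono) auto
        then show ?thesis using in_ball by simp
      qed simp
    qed
    also have "\<dots> = 1 / (r ^ 3 * norm a) * (ball3_vol * r ^ 3)"
      using content_ball[of r a] r by simp
    also have "\<dots> = ball3_vol / norm a" using r by simp
    also have "\<dots> \<le> 18 * ball3_vol / norm a" using a by (intro divide_right_mono) auto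
    finally show ?thesis unfolding a(2) .
  next
    case False
    have r3: "3 * r > 0" using r by simp
    have bi: "integrable lborel (\<lambda>z. 1 / r ^ 3 * (indicator (ball 0 (3 * r)) z * newton_kernel z))"
      by (intro integrable_mult_right integrable_newton_kernel(1)[OF r3])
    have "\<bar>adv_potential (source_average e \<tau> r) p\<bar>
        \<le> (LBINT z. 1 / r ^ 3 * (indicator (ball 0 (3 * r)) z * newton_kernel z))"
    proof (rule key[OF bi])
      fix z
      show "?I z / r ^ 3 * newton_kernel z \<le> 1 / r ^ 3 * (indicator (ball 0 (3 * r)) z * newton_kernel z)"
      proof (cases "z \<in> ball a r")
        case True
        have "norm z \<le> norm a + norm (a - z)" using norm_triangle_ineq4[of a "a - z"] by simp
        then have "norm z < 3 * r" using False True by (simp add: dist_norm)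
        then show ?thesis using True by simp
      qed (use r in simp)
    qed
    also have "\<dots> \<le> 1 / r ^ 3 * (ball3_vol * (3 * r)\<^sup>2)"
      unfolding integral_mult_right_zero using integrable_newton_kernel(2)[OF r3] r by (intro mult_left_mono) auto
    also have "\<dots> = 9 * ball3_vol * (1 / r)"
      using r by (simp add: power2_eq_square power3_eq_cube field_simps)
    also have "\<dots> \<le> 9 * ball3_vol * (2 / norm a)"
      using False a r by (intro mult_left_mono) (auto simp: field_simps)
    finally show ?thesis unfolding a(2) by simp
  qed
qed

text \<open>The margin 2 * r ensures that for every \<open>z\<close> in the ball about
  \<open>a\<close> the time t + |z| < t + |a| + r is still before \<tau> - r, so the whole ball
  contributes. Since r <= |a|, also |z| <= 2 * |a|, and the kernel is at least 1 / (8 * pi *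
  |a|).\<close>

lemma adv_potential_source_average_ge:
  assumes r: "r > 0" "\<tau> > 0" and p: "norm (fst p - e) \<ge> r" "snd p + norm (fst p - e) < \<tau> - 2 * r" "snd p \<ge> 0"
  shows "ball3_vol / (8 * pi * norm (fst p - e)) \<le> adv_potential (source_average e \<tau> r) p"
proof -
  define a where "a = e - fst p"
  have a: "norm a > 0" "norm (fst p - e) = norm a" using p r by (auto simp: a_def norm_minus_commute)
  have bi: "integrable lborel (\<lambda>z. 1 / (r ^ 3 * (8 * pi * norm a)) * indicator (ball a r) z :: real)"
    by (intro integrable_mult_right integrable_real_indicator emeasure_bounded_finite) auto
  have fi: "integrable lborel (\<lambda>z. source_average e \<tau> r (p + (z, norm z)) * newton_kernel z)"
    by (rule adv_potential_bound(1)[OF source_average_measurable r(2) source_average_bound[OF r(1)] _ p(3)])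
      (use r in \<open>auto simp: source_average_def\<close>)
  have "ball3_vol / (8 * pi * norm a) = 1 / (r ^ 3 * (8 * pi * norm a)) * (ball3_vol * r ^ 3)"
    using r by simp
  also have "\<dots> = (LBINT z. 1 / (r ^ 3 * (8 * pi * norm a)) * indicator (ball a r) z)"
    using content_ball[of r a] r by simp
  also have "\<dots> \<le> adv_potential (source_average e \<tau> r) p"
    unfolding adv_potential_def
  proof (intro integral_mono bi fi)
    fix z
    show "1 / (r ^ 3 * (8 * pi * norm a)) * indicator (ball a r) z \<le> source_average e \<tau> r (p + (z, norm z)) * newton_kernel z"
    proof (cases "z \<in> ball a r")
      case True
      then have d: "norm (a - z) < r" by (simp add: dist_norm)
      have "norm z \<le> norm a + norm (a - z)" using norm_triangle_ineq4[of a "a - z"] by simp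
      then have z: "norm z < norm a + r" using d by linarith
      then have z2: "norm z \<le> 2 * norm a" using p(1) a by simp
      have z0: "z \<noteq> 0" using d p(1) a by auto
      have "source_average e \<tau> r (p + (z, norm z)) = 1 / r ^ 3"
        using d z p(2) by (auto simp: source_average_def indicator_def dist_norm a_def a(2) algebra_simps)
      moreover have "1 / (8 * pi * norm a) \<le> newton_kernel z"
        unfolding newton_kernel_def using z2 z0 a by (intro divide_left_mono) (auto simp: mult_le_cancel_left)
      then have "1 / r ^ 3 * (1 / (8 * pi * norm a)) \<le> 1 / r ^ 3 * newton_kernel z"
        using r by (intro mult_left_mono) auto
      ultimately show ?thesis using True by simp
    qed (use source_average_nonneg[OF r(1)] in simp)
  qed
  finally show ?thesis unfolding a(2) .
qed

text \<open>Fubini for a layer of constant time thickness \<open>L\<close> above a graph. With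
  \<open>h\<close> the norm, the layer lies just above the light cone, and its thickness becomes a
  factor of the estimate.\<close>

lemma integral_time_interval:
  fixes g :: "space \<Rightarrow> real" and h :: "space \<Rightarrow> real"
  assumes g: "integrable lborel g" and [measurable]: "h \<in> borel_measurable borel" and L: "L \<ge> 0"
  shows "integrable lborel (\<lambda>p. g (fst p) * indicator {h (fst p)..<h (fst p) + L} (snd p))"
    and "(LBINT p. g (fst p) * indicator {h (fst p)..<h (fst p) + L} (snd p)) = L * (LBINT x. g x)"
proof -
  let ?f = "\<lambda>x t. g x * indicator {h x..<h x + L} t"
  have gm [measurable]: "g \<in> borel_measurable borel" using borel_measurable_integrable[OF g] by simp
  have m: "case_prod ?f \<in> borel_measurable (lborel \<Otimes>\<^sub>M lborel)"
  proof -
    have "(\<lambda>p. g (fst p) * (if h (fst p) \<le> snd p \<and> snd p < h (fst p) + L then 1 else 0))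
      \<in> borel_measurable (borel \<Otimes>\<^sub>M borel)" by measurable
    moreover have "case_prod ?f = (\<lambda>p. g (fst p) * (if h (fst p) \<le> snd p \<and> snd p < h (fst p) + L then 1 else 0))"
      by (auto simp: indicator_def)
    ultimately show ?thesis by (simp add: measurable_lborel1 cong: measurable_cong_sets)
  qed
  have inner: "(LBINT t. ?f x t) = L * g x" for x using L by simp
  have inorm: "(LBINT t. norm (?f x t)) = L * \<bar>g x\<bar>" for x
  proof -
    have "norm (?f x t) = \<bar>g x\<bar> * indicator {h x..<h x + L} t" for t by (simp add: abs_mult)
    then show ?thesis using L by simp
  qed
  have int: "integrable (lborel \<Otimes>\<^sub>M lborel) (case_prod ?f)"
  proof (rule lborel_pair.Fubini_integrable[OF m])
    show "integrable lborel (\<lambda>x. LBINT t. norm (case_prod ?f (x, t)))"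
      using g by (simp add: inorm del: real_norm_def)
    show "AE x in lborel. integrable lborel (\<lambda>t. case_prod ?f (x, t))"
      using L by (intro AE_I2) (simp add: emeasure_lborel_Ico)
  qed
  have eq: "case_prod ?f = (\<lambda>p. g (fst p) * indicator {h (fst p)..<h (fst p) + L} (snd p))"
    by auto
  show "integrable lborel (\<lambda>p. g (fst p) * indicator {h (fst p)..<h (fst p) + L} (snd p))"
    using int unfolding lborel_prod eq .
  have "(\<integral>x. (LBINT t. ?f x t) \<partial>lborel) = integral\<^sup>L (lborel \<Otimes>\<^sub>M lborel) (case_prod ?f)"
    using lborel_pair.integral_fst'[OF int] by simp
  then show "(LBINT p. g (fst p) * indicator {h (fst p)..<h (fst p) + L} (snd p)) = L * (LBINT x. g x)"
    unfolding lborel_prod eq inner by simp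
qed

section \<open>Neumann series for the difference of two solutions\<close>

locale two_point_sources =
  P1: point_source_problem q1 v1 T Bv Bq u1 + P2: point_source_problem q2 v2 T Bv Bq u2
  for q1 q2 :: "space \<Rightarrow> real" and v1 v2 :: "spacetime \<Rightarrow> real" and T Bv Bq :: real
    and u1 u2 :: "(spacetime \<Rightarrow> real) \<Rightarrow> real" +
  assumes ge: "q2 x \<le> q1 x"
begin

definition q :: "space \<Rightarrow> real" where "q x = q1 x - q2 x"
definition w :: "spacetime \<Rightarrow> real" where "w p = v1 p - v2 p"

lemma q_nonneg: "q x \<ge> 0"
  using ge by (simp add: q_def)

lemma q_le: "norm x \<le> T \<Longrightarrow> q x \<le> 2 * Bq"
  using P1.Bq[of x] P2.Bq[of x] by (simp add: q_def abs_le_iff)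

lemma q_continuous: "continuous_on UNIV q"
  unfolding q_def[abs_def] by (intro continuous_intros P1.qc P2.qc)

lemma q_measurable [measurable]: "q \<in> borel_measurable borel"
  by (rule borel_measurable_continuous_onI[OF q_continuous])

lemma w_eq_0: "snd p < norm (fst p) \<Longrightarrow> w p = 0"
  using goursat_solution_eq_0[OF P1.gs] goursat_solution_eq_0[OF P2.gs] by (simp add: w_def)

lemma w_le: "snd p \<le> T \<Longrightarrow> \<bar>w p\<bar> \<le> 2 * Bv"
  using P1.Bv[of p] P2.Bv[of p] abs_triangle_ineq4[of "v1 p" "v2 p"] by (simp add: w_def)

text \<open>One step of the Neumann series of the adjoint equation \<open>f \<mapsto> q1 * adv_potential f\<close>,
  cut off to the region that matters for \<open>w\<close>.\<close>

definition neumann_step :: "(spacetime \<Rightarrow> real) \<Rightarrow> spacetime \<Rightarrow> real" where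
  "neumann_step f p = indicator {p. norm (fst p) \<le> snd p \<and> snd p < T} p * (q1 (fst p) * adv_potential f p)"

text \<open>These are the contributions carrying the difference of the potentials when the two
  Duhamel identities are subtracted: q1 * v1 - q2 * v2 = q1 * w + q * v2, while the common singular
  parts contribute \<open>q\<close> times the same kernel.\<close>

definition source_term :: "(spacetime \<Rightarrow> real) \<Rightarrow> real" where
  "source_term f = (LBINT p. v2 p * (q (fst p) * adv_potential f p))
     + (LBINT x. q x * adv_potential f (x, norm x) * newton_kernel x)"

lemma admissible_neumann_step:
  assumes "admissible T f" shows "admissible T (neumann_step f)"
proof -
  obtain B where B: "f \<in> borel_measurable borel" "\<And>p. \<bar>f p\<bar> \<le> B" "B \<ge> 0" "\<And>p. snd p \<ge> T \<Longrightarrow> f p = 0"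
    using admissibleE[OF assms] by metis
  have "{p :: spacetime. norm (fst p) \<le> snd p \<and> snd p < T} = {p. norm (fst p) \<le> snd p} \<inter> {p. snd p < T}" by auto
  then have "{p :: spacetime. norm (fst p) \<le> snd p \<and> snd p < T} \<in> sets borel"
    using closed_cone P1.slab_sets by (auto intro: borel_closed)
  then have "neumann_step f \<in> borel_measurable borel"
    unfolding neumann_step_def[abs_def]
    by (intro borel_measurable_times borel_measurable_indicator P1.q_measurable_term B(1))
  moreover have "\<bar>neumann_step f p\<bar> \<le> Bq * (B * (ball3_vol * T\<^sup>2))" for p
    using P1.potential_term_bound[OF B, of p] P1.T P1.Bq_nonneg B(3)
    by (auto simp: neumann_step_def indicator_def)
  moreover have "neumann_step f p = 0" if "snd p \<ge> T" for p
    using that by (simp add: neumann_step_def)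
  ultimately show ?thesis unfolding admissible_def by blast
qed

lemma integrable_source_terms:
  assumes "admissible T f"
  shows "integrable lborel (\<lambda>p. v2 p * (q1 (fst p) * adv_potential f p))"
    and "integrable lborel (\<lambda>p. v2 p * (q (fst p) * adv_potential f p))"
    and "integrable lborel (\<lambda>x. q x * adv_potential f (x, norm x) * newton_kernel x)"
proof -
  obtain B where B: "f \<in> borel_measurable borel" "\<And>p. \<bar>f p\<bar> \<le> B" "B \<ge> 0" "\<And>p. snd p \<ge> T \<Longrightarrow> f p = 0"
    using admissibleE[OF assms] by metis
  have z: "q1 (fst p) * adv_potential f p = 0" if "snd p \<ge> T" for p
    using adv_potential_eq_0_time[OF B(4) that] by simp
  show i: "integrable lborel (\<lambda>p. v2 p * (q1 (fst p) * adv_potential f p))"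
    by (rule P2.integrable_v_times[OF P1.q_measurable_term[OF B(1)] P1.potential_term_bound[OF B] z])
  have "integrable lborel (\<lambda>p. v2 p * (q1 (fst p) * adv_potential f p) - v2 p * (q2 (fst p) * adv_potential f p))"
    by (intro Bochner_Integration.integrable_diff i P2.integrable_terms assms)
  then show "integrable lborel (\<lambda>p. v2 p * (q (fst p) * adv_potential f p))"
    by (simp add: q_def algebra_simps)
  have "integrable lborel (\<lambda>x. q1 x * adv_potential f (x, norm x) * newton_kernel x
      - q2 x * adv_potential f (x, norm x) * newton_kernel x)"
    by (intro Bochner_Integration.integrable_diff P1.integrable_terms P2.integrable_terms assms)
  then show "integrable lborel (\<lambda>x. q x * adv_potential f (x, norm x) * newton_kernel x)"
    by (simp add: q_def algebra_simps)
qed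

lemma duhamel_difference:
  assumes f: "admissible T f"
  shows "(LBINT p. w p * f p) = (LBINT p. w p * neumann_step f p) + source_term f"
proof -
  note i1 = P1.integrable_terms[OF f] and i2 = P2.integrable_terms[OF f] and i3 = integrable_source_terms[OF f]
  obtain B where B: "f \<in> borel_measurable borel" "\<And>p. \<bar>f p\<bar> \<le> B" "B \<ge> 0" "\<And>p. snd p \<ge> T \<Longrightarrow> f p = 0"
    using admissibleE[OF f] by metis
  have 1: "(LBINT p. w p * f p) = (LBINT p. v1 p * f p) - (LBINT p. v2 p * f p)"
    using i1 i2 by (simp add: w_def left_diff_distrib)
  have "w p * neumann_step f p = v1 p * (q1 (fst p) * adv_potential f p) - v2 p * (q1 (fst p) * adv_potential f p)" for p
  proof -
    consider "snd p < norm (fst p)" | "snd p \<ge> T" | "norm (fst p) \<le> snd p" "snd p < T" by linarith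
    then show ?thesis
    proof cases
      case 1
      then show ?thesis using goursat_solution_eq_0[OF P1.gs] goursat_solution_eq_0[OF P2.gs] by (simp add: w_def)
    next
      case 2
      then show ?thesis using adv_potential_eq_0_time[OF B(4) 2] by (simp add: neumann_step_def)
    next
      case 3
      then show ?thesis by (simp add: neumann_step_def w_def algebra_simps)
    qed
  qed
  then have 2: "(LBINT p. w p * neumann_step f p)
     = (LBINT p. v1 p * (q1 (fst p) * adv_potential f p)) - (LBINT p. v2 p * (q1 (fst p) * adv_potential f p))"
    using i1 i3 by simp
  have "v2 p * (q (fst p) * adv_potential f p)
     = v2 p * (q1 (fst p) * adv_potential f p) - v2 p * (q2 (fst p) * adv_potential f p)" for p
    by (simp add: q_def algebra_simps)
  then have 3: "(LBINT p. v2 p * (q (fst p) * adv_potential f p))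
     = (LBINT p. v2 p * (q1 (fst p) * adv_potential f p)) - (LBINT p. v2 p * (q2 (fst p) * adv_potential f p))"
    using i2 i3 by simp
  have "q x * adv_potential f (x, norm x) * newton_kernel x
     = q1 x * adv_potential f (x, norm x) * newton_kernel x - q2 x * adv_potential f (x, norm x) * newton_kernel x" for x
    by (simp add: q_def algebra_simps)
  then have 4: "(LBINT x. q x * adv_potential f (x, norm x) * newton_kernel x)
     = (LBINT x. q1 x * adv_potential f (x, norm x) * newton_kernel x)
       - (LBINT x. q2 x * adv_potential f (x, norm x) * newton_kernel x)"
    using i1 i2 by simp
  show ?thesis
    using P1.duhamel_against_admissible[OF f] P2.duhamel_against_admissible[OF f]
    unfolding duhamel_against_def source_term_def 1 2 3 4 by simp
qed

lemma admissible_neumann_iterate: "admissible T f \<Longrightarrow> admissible T ((neumann_step ^^ n) f)"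
  by (induction n) (auto intro: admissible_neumann_step)

text \<open>Each remainder is fed back as a new source. The expansion stays finite and exact, so
  only one remainder integral has to be shown to tend to 0.\<close>

lemma duhamel_difference_iterate:
  assumes f: "admissible T f"
  shows "(LBINT p. w p * f p)
     = (LBINT p. w p * (neumann_step ^^ N) f p) + (\<Sum>n<N. source_term ((neumann_step ^^ n) f))"
proof (induction N)
  case (Suc N)
  then show ?case using duhamel_difference[OF admissible_neumann_iterate[OF f, of N]] by simp
qed simp

lemma integral_w_bound:
  assumes "\<And>p. \<bar>f p\<bar> \<le> B" "B \<ge> 0" "\<And>p. snd p \<ge> T \<Longrightarrow> f p = 0"
  shows "\<bar>LBINT p. w p * f p\<bar> \<le> 2 * Bv * B * (unit_ball_vol (DIM(spacetime)) * (2 * T + 1) ^ DIM(spacetime))"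
proof (rule abs_integral_le_ball)
  have le: "\<bar>w p * f p\<bar> \<le> 2 * (Bv * B * indicator (ball 0 (2 * T + 1)) p)" for p
    using P1.v_times_dominated[of f B p] P2.v_times_dominated[of f B p] assms(1,3)
      abs_triangle_ineq4[of "v1 p * f p" "v2 p * f p"] by (simp add: w_def left_diff_distrib)
  fix p :: spacetime
  have "Bv * B * indicator (ball 0 (2 * T + 1)) p \<le> Bv * B * 1"
    using P1.Bv_nonneg assms(2) by (intro mult_left_mono) (auto simp: indicator_def)
  then show "\<bar>w p * f p\<bar> \<le> 2 * Bv * B" using le[of p] by linarith
  show "w p * f p = 0" if "norm p \<ge> 2 * T + 1" using le[of p] that by simp
qed (use P1.T P1.Bv_nonneg assms(2) in auto)

end

text \<open>The number \<open>l\<close> is an exponential weight for which one Neumann step followed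
  by the potential at least halves the weighted bound.\<close>

locale averaged_source = two_point_sources +
  fixes e :: space and \<tau> r l :: real
  assumes r: "r > 0" and \<tau>: "\<tau> > 0" "\<tau> \<le> T" and l: "l \<ge> 0" "Bq * weighted_mass T l \<le> 1 / 2"
begin

definition iterate :: "nat \<Rightarrow> spacetime \<Rightarrow> real" where
  "iterate n = (neumann_step ^^ n) (source_average e \<tau> r)"

lemma iterate_0: "iterate 0 = source_average e \<tau> r"
  by (simp add: iterate_def)

lemma iterate_Suc: "iterate (Suc n) = neumann_step (iterate n)"
  by (simp add: iterate_def)

lemma admissible_iterate: "admissible T (iterate n)"
proof -
  have "admissible T (source_average e \<tau> r)"
    unfolding admissible_def
  proof (intro conjI exI allI impI)
    show "\<bar>source_average e \<tau> r p\<bar> \<le> 1 / r ^ 3" for p by (rule source_average_bound[OF r])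
    show "source_average e \<tau> r p = 0" if "snd p \<ge> T" for p
      using that r \<tau> by (simp add: source_average_def)
  qed (rule source_average_measurable)
  then show ?thesis unfolding iterate_def by (rule admissible_neumann_iterate)
qed

lemma iterate_measurable: "iterate n \<in> borel_measurable borel"
  and iterate_eq_0_time: "snd p \<ge> T \<Longrightarrow> iterate n p = 0"
  using admissible_iterate[of n] unfolding admissible_def by blast+

text \<open>Domain of dependence: multiplication by the potential keeps supports, and
  \<open>forward_cone_gap\<close> shows that taking the advanced potential does not leave the
  backward cone of (e, \<tau>).\<close>

lemma iterate_eq_0:
  "snd p \<ge> 0 \<Longrightarrow> snd p + norm (fst p - e) \<ge> \<tau> \<Longrightarrow> iterate n p = 0 \<and> adv_potential (iterate n) p = 0"
proof (induction n arbitrary: p)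
  case 0
  then show ?case
    using source_average_eq_0[OF r 0(2)] adv_potential_source_average_eq_0[OF r 0(2)] by (simp add: iterate_0)
next
  case (Suc n)
  have z: "iterate (Suc n) p = 0" if "snd p \<ge> 0" "snd p + norm (fst p - e) \<ge> \<tau>" for p
    using Suc.IH[OF that] by (simp add: iterate_Suc neumann_step_def)
  have "adv_potential (iterate (Suc n)) p = 0"
  proof (rule adv_potential_eq_0, rule z)
    show "snd (p + (x, norm x)) \<ge> 0" for x using Suc.prems(1) by simp
    show "\<tau> \<le> snd (p + (x, norm x)) + norm (fst (p + (x, norm x)) - e)" for x
      by (rule order_trans[OF Suc.prems(2) forward_cone_gap])
  qed
  then show ?case using z[OF Suc.prems] by simp
qed

lemma neumann_step_le:
  assumes "\<bar>adv_potential f p\<bar> \<le> B" "B \<ge> 0"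
  shows "\<bar>neumann_step f p\<bar> \<le> Bq * B"
proof (cases "norm (fst p) \<le> snd p \<and> snd p < T")
  case True
  then show ?thesis
    unfolding neumann_step_def using P1.Bq[of "fst p"] assms P1.Bq_nonneg by (auto simp: abs_mult intro!: mult_mono)
next
  case False
  then show ?thesis unfolding neumann_step_def using assms P1.Bq_nonneg by simp
qed

text \<open>The first iterate is bounded by a multiple of 1 / |y - e|, so its potential is an
  integral over an ellipsoid whose excess over |e - x| is the gap \<tau> - t - |x - e|; a gap of at
  most \<open>d\<close> makes it small. Further iterates are evaluated only on forward cones, where
  the gap does not grow, so \<open>\<epsilon>\<close> survives while the weight supplies a factor
  1/2 per step.\<close>

lemma potential_iterate_bound:
  assumes d: "\<And>a s. 0 < s \<Longrightarrow> s \<le> T \<Longrightarrow> s - norm a \<le> d \<Longrightarrow> integral\<^sup>L lborel (ellipsoid_potential a s) \<le> \<epsilon>"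
    and \<epsilon>: "\<epsilon> \<ge> 0" and p: "snd p \<ge> 0" "\<tau> - snd p - norm (fst p - e) \<le> d"
  shows "\<bar>adv_potential (iterate (Suc n)) p\<bar>
     \<le> Bq * (18 * ball3_vol) * \<epsilon> * (1 / 2) ^ n * exp (l * (T - snd p))"
  using p
proof (induction n arbitrary: p)
  case 0
  have B0: "Bq * (18 * ball3_vol) * \<epsilon> \<ge> 0" using P1.Bq_nonneg \<epsilon> by simp
  show ?case
  proof (cases "snd p < T")
    case False
    then have "T \<le> snd p" by linarith
    then have "adv_potential (iterate (Suc 0)) p = 0"
      by (rule adv_potential_eq_0_time[where T = T, rotated]) (rule iterate_eq_0_time)
    then show ?thesis using B0 by simp
  next
    case pT: True
    have "\<bar>adv_potential (iterate (Suc 0)) p\<bar> \<le> Bq * (18 * ball3_vol) * \<epsilon>"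
    proof (cases "0 < \<tau> - snd p")
      case True
      have "\<bar>adv_potential (iterate (Suc 0)) p\<bar>
          \<le> Bq * (18 * ball3_vol) * integral\<^sup>L lborel (ellipsoid_potential (e - fst p) (\<tau> - snd p))"
      proof (rule adv_potential_of_inverse_distance[OF iterate_measurable True \<tau>(2) 0(1)])
        fix y assume y: "snd y \<ge> 0" "fst y \<noteq> e" "snd y + norm (fst y - e) < \<tau>"
        have "\<bar>neumann_step (source_average e \<tau> r) y\<bar> \<le> Bq * (18 * ball3_vol / norm (fst y - e))"
          using adv_potential_source_average_le[OF r y(2)] by (rule neumann_step_le) simp
        then show "\<bar>iterate (Suc 0) y\<bar> \<le> Bq * (18 * ball3_vol) / norm (fst y - e)"
          by (simp add: iterate_Suc iterate_0)
      qed (use iterate_eq_0 P1.Bq_nonneg in auto)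
      also have "\<dots> \<le> Bq * (18 * ball3_vol) * \<epsilon>"
        using 0 True \<tau>(2) P1.Bq_nonneg
        by (intro mult_left_mono d) (auto simp: norm_minus_commute)
      finally show ?thesis .
    next
      case False
      then have "\<tau> \<le> snd p + norm (fst p - e)" using norm_ge_zero[of "fst p - e"] by linarith
      then show ?thesis using iterate_eq_0[OF 0(1)] B0 by simp
    qed
    also have "\<dots> \<le> Bq * (18 * ball3_vol) * \<epsilon> * exp (l * (T - snd p))"
      using mult_left_mono[OF _ B0, of 1 "exp (l * (T - snd p))"] pT l by simp
    finally show ?thesis by simp
  qed
next
  case (Suc n)
  define A where "A = Bq * (18 * ball3_vol) * \<epsilon> * (1 / 2) ^ n"
  have A: "A \<ge> 0" using P1.Bq_nonneg \<epsilon> by (simp add: A_def)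
  have "\<bar>adv_potential (iterate (Suc (Suc n))) p\<bar> \<le> Bq * A * weighted_mass T l * exp (l * (T - snd p))"
  proof (rule adv_potential_weighted_bound[OF iterate_measurable P1.T l(1) _ _ iterate_eq_0_time Suc.prems(1)])
    show "0 \<le> Bq * A" using A P1.Bq_nonneg by simp
    fix z :: space assume "snd p + norm z < T"
    let ?y = "p + (z, norm z)"
    have y: "snd ?y \<ge> 0" using Suc.prems(1) by simp
    have "\<tau> - snd ?y - norm (fst ?y - e) \<le> d"
      using forward_cone_gap[of p e z] Suc.prems(2) by linarith
    from neumann_step_le[OF Suc.IH[OF y this]] A
    have "\<bar>iterate (Suc (Suc n)) ?y\<bar> \<le> Bq * (A * exp (l * (T - snd ?y)))"
      unfolding A_def iterate_Suc[of "Suc n"] by simp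
    then show "\<bar>iterate (Suc (Suc n)) ?y\<bar> \<le> Bq * A * exp (l * (T - (snd p + norm z)))" by simp
  qed
  also have "\<dots> = (Bq * weighted_mass T l) * (A * exp (l * (T - snd p)))" by simp
  also have "\<dots> \<le> 1 / 2 * (A * exp (l * (T - snd p)))"
    using l A by (intro mult_right_mono) auto
  finally show ?case by (simp add: A_def)
qed

text \<open>The geometric bound concerns the potential of \<open>iterate (Suc n)\<close>, and one
  more Neumann step turns it into a bound for the iterate itself; hence the offset 2.\<close>

lemma integral_w_iterate_tendsto_0: "(\<lambda>n. LBINT p. w p * iterate n p) \<longlonglongrightarrow> 0"
proof -
  define A where "A = Bq * (Bq * (18 * ball3_vol) * (8 * ball3_vol * T) * exp (l * T))"
  define V where "V = unit_ball_vol (DIM(spacetime)) * (2 * T + 1) ^ DIM(spacetime)"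
  have A: "A \<ge> 0" using P1.Bq_nonneg P1.T by (simp add: A_def)
  have bound: "\<bar>iterate (n + 2) p\<bar> \<le> A * (1 / 2) ^ n" for n p
  proof (cases "norm (fst p) \<le> snd p")
    case True
    then have p0: "snd p \<ge> 0" using norm_ge_zero order_trans by blast
    have "\<bar>adv_potential (iterate (Suc n)) p\<bar>
       \<le> Bq * (18 * ball3_vol) * (8 * ball3_vol * T) * (1 / 2) ^ n * exp (l * (T - snd p))"
    \<comment> \<open>Smallness is irrelevant for convergence: for t >= 0 the gap never exceeds
      \<open>T\<close>, and 8 * \<open>ball3_vol\<close> * T bounds every ellipsoid
      integral.\<close>
    proof (rule potential_iterate_bound[where d = T])
      show "\<tau> - snd p - norm (fst p - e) \<le> T" using p0 \<tau>(2) norm_ge_zero[of "fst p - e"] by linarith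
    qed (use ellipsoid_potential_integral(2) P1.T p0 in auto)
    also have "\<dots> \<le> Bq * (18 * ball3_vol) * (8 * ball3_vol * T) * (1 / 2) ^ n * exp (l * T)"
      using p0 l P1.Bq_nonneg P1.T by (intro mult_left_mono) (auto simp: mult_left_mono)
    finally have "\<bar>neumann_step (iterate (Suc n)) p\<bar>
       \<le> Bq * (Bq * (18 * ball3_vol) * (8 * ball3_vol * T) * (1 / 2) ^ n * exp (l * T))"
      by (rule neumann_step_le) (use P1.Bq_nonneg P1.T in simp)
    then show ?thesis by (simp add: iterate_Suc A_def mult_ac)
  next
    case False
    then show ?thesis using A by (simp add: iterate_Suc neumann_step_def)
  qed
  have lim: "(\<lambda>n. LBINT p. w p * iterate (n + 2) p) \<longlonglongrightarrow> 0"
  proof (rule Lim_null_comparison)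
    show "\<forall>\<^sub>F n in sequentially. norm (LBINT p. w p * iterate (n + 2) p) \<le> 2 * Bv * A * V * (1 / 2) ^ n"
    proof (intro always_eventually allI)
      fix n
      show "norm (LBINT p. w p * iterate (n + 2) p) \<le> 2 * Bv * A * V * (1 / 2) ^ n"
        using integral_w_bound[OF bound _ iterate_eq_0_time, of n] A unfolding V_def
        by (simp add: mult_ac)
    qed
    show "(\<lambda>n. 2 * Bv * A * V * (1 / 2) ^ n) \<longlonglongrightarrow> 0"
      by (intro tendsto_mult_right_zero LIMSEQ_power_zero) simp
  qed
  then show ?thesis by (rule LIMSEQ_offset)
qed

section \<open>Comparison of all terms with the leading one\<close>

definition weighted_q :: "space \<Rightarrow> real" where
  "weighted_q x = q x * ellipsoid_potential e \<tau> x"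

lemma weighted_q_nonneg: "weighted_q x \<ge> 0"
  unfolding weighted_q_def using q_nonneg by simp

lemma integrable_weighted_q: "integrable lborel weighted_q"
proof (rule Bochner_Integration.integrable_bound)
  show "integrable lborel (\<lambda>x. 2 * Bq * ellipsoid_potential e \<tau> x)"
    by (intro integrable_mult_right ellipsoid_potential_integral(1)[OF \<tau>])
  have "weighted_q \<in> borel_measurable borel" unfolding weighted_q_def[abs_def] by measurable
  then show "weighted_q \<in> borel_measurable lborel" by simp
  have "\<bar>weighted_q x\<bar> \<le> 2 * Bq * ellipsoid_potential e \<tau> x" for x
  proof (cases "x \<in> ellipsoid e \<tau>")
    case True
    then have "norm x < T" using ellipsoid_subset_ball[of e \<tau>] \<tau>(2) by auto
    then have "q x * ellipsoid_potential e \<tau> x \<le> 2 * Bq * ellipsoid_potential e \<tau> x"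
      using q_le[of x] by (intro mult_right_mono) auto
    then show ?thesis using weighted_q_nonneg[of x] unfolding weighted_q_def by simp
  qed (simp add: weighted_q_def)
  then show "AE x in lborel. norm (weighted_q x) \<le> norm (2 * Bq * ellipsoid_potential e \<tau> x)"
    by (intro AE_I2 abs_le_imp_norm_le)
qed

text \<open>Restricting the estimate to a time layer of thickness \<open>L\<close> above the cone
  lets Fubini produce the factor \<open>L\<close>. The lines over 0 and \<open>e\<close> are left
  out of the pointwise hypothesis because \<open>weighted_q\<close> is 0 there by the convention x /
  0 = 0.\<close>

lemma regular_source_term_bound:
  assumes f: "admissible T f" and c: "c \<ge> 0" and L: "L \<ge> 0"
    and b: "\<And>p. fst p \<noteq> 0 \<Longrightarrow> fst p \<noteq> e \<Longrightarrow> norm (fst p) \<le> snd p \<Longrightarrow> snd p < T \<Longrightarrow>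
       \<bar>q (fst p) * adv_potential f p\<bar> \<le> c * (weighted_q (fst p) * indicator {norm (fst p)..<norm (fst p) + L} (snd p))"
  shows "\<bar>LBINT p. v2 p * (q (fst p) * adv_potential f p)\<bar> \<le> Bv * c * L * (LBINT x. weighted_q x)"
proof -
  let ?g = "\<lambda>p. weighted_q (fst p) * indicator {norm (fst p)..<norm (fst p) + L} (snd p)"
  have "norm \<in> borel_measurable (borel :: space measure)" by simp
  note ti = integral_time_interval[OF integrable_weighted_q this L]
  have ti': "integrable lborel ?g" "(LBINT p. ?g p) = L * (LBINT x. weighted_q x)"
    using ti by simp_all
  obtain B where B: "\<And>p. snd p \<ge> T \<Longrightarrow> f p = 0" using admissibleE[OF f] by metis
  have le: "\<bar>v2 p * (q (fst p) * adv_potential f p)\<bar> \<le> Bv * c * ?g p" if "fst p \<noteq> 0" "fst p \<noteq> e" for p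
  proof -
    have nn: "0 \<le> Bv * c * ?g p" using P1.Bv_nonneg c weighted_q_nonneg by simp
    consider "snd p < norm (fst p)" | "snd p \<ge> T" | "norm (fst p) \<le> snd p" "snd p < T" by linarith
    then show ?thesis
    proof cases
      case 1
      then show ?thesis using goursat_solution_eq_0[OF P2.gs] nn by simp
    next
      case 2
      then show ?thesis using adv_potential_eq_0_time[OF B 2] nn by simp
    next
      case 3
      have "\<bar>v2 p\<bar> * \<bar>q (fst p) * adv_potential f p\<bar> \<le> Bv * (c * ?g p)"
        using P2.Bv[of p] b[OF that 3] 3 P1.Bv_nonneg by (intro mult_mono) auto
      then show ?thesis by (simp only: abs_mult mult.assoc)
    qed
  qed
  have AE: "AE p in lborel. norm (v2 p * (q (fst p) * adv_potential f p)) \<le> Bv * c * ?g p"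
    using AE_fst_neq[of 0] AE_fst_neq[of e] by eventually_elim (unfold real_norm_def, rule le)
  have "\<bar>LBINT p. v2 p * (q (fst p) * adv_potential f p)\<bar>
     \<le> (LBINT p. norm (v2 p * (q (fst p) * adv_potential f p)))"
    using integral_norm_bound[of lborel "\<lambda>p. v2 p * (q (fst p) * adv_potential f p)"] by (simp only: real_norm_def)
  also have "\<dots> \<le> (LBINT p. Bv * c * ?g p)"
    by (intro integral_mono_AE AE integrable_norm integrable_source_terms f integrable_mult_right ti')
  also have "\<dots> = Bv * c * L * (LBINT x. weighted_q x)"
    unfolding integral_mult_right_zero ti'(2) by simp
  finally show ?thesis .
qed

lemma singular_source_term_bound:
  assumes f: "admissible T f" and c: "c \<ge> 0"
    and b: "\<And>x. x \<noteq> 0 \<Longrightarrow> x \<noteq> e \<Longrightarrow> norm x < T \<Longrightarrow>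
       \<bar>q x * adv_potential f (x, norm x)\<bar> * newton_kernel x \<le> c * weighted_q x"
  shows "\<bar>LBINT x. q x * adv_potential f (x, norm x) * newton_kernel x\<bar> \<le> c * (LBINT x. weighted_q x)"
proof -
  obtain B where B: "\<And>p. snd p \<ge> T \<Longrightarrow> f p = 0" using admissibleE[OF f] by metis
  have le: "\<bar>q x * adv_potential f (x, norm x) * newton_kernel x\<bar> \<le> c * weighted_q x" if "x \<noteq> 0" "x \<noteq> e" for x
  proof (cases "norm x < T")
    case True
    then show ?thesis using b[OF that True] by (simp add: abs_mult)
  next
    case False
    then have "T \<le> snd (x, norm x)" by simp
    then show ?thesis using adv_potential_eq_0_time[OF B] c weighted_q_nonneg by simp
  qed
  have AE: "AE x in lborel. norm (q x * adv_potential f (x, norm x) * newton_kernel x) \<le> c * weighted_q x"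
    using AE_lborel_singleton[of 0] AE_lborel_singleton[of e] by eventually_elim (unfold real_norm_def, rule le)
  have "\<bar>LBINT x. q x * adv_potential f (x, norm x) * newton_kernel x\<bar>
     \<le> (LBINT x. norm (q x * adv_potential f (x, norm x) * newton_kernel x))"
    using integral_norm_bound[of lborel "\<lambda>x. q x * adv_potential f (x, norm x) * newton_kernel x"] by (simp only: real_norm_def)
  also have "\<dots> \<le> (LBINT x. c * weighted_q x)"
    by (intro integral_mono_AE AE integrable_norm integrable_source_terms f integrable_mult_right integrable_weighted_q)
  finally show ?thesis by simp
qed

text \<open>Inside the ellipsoid both distances are below \<open>T\<close>, so missing factors 1 /
  |x| or 1 / |x - e| can be inserted at the price of a factor \<open>T\<close> each.\<close>

lemma q_le_weighted_q:
  assumes x: "x \<noteq> 0" "x \<noteq> e" and E: "x \<in> ellipsoid e \<tau>"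
  shows "q x \<le> T\<^sup>2 * weighted_q x" and "q x / norm x \<le> T * weighted_q x" and "q x / norm (x - e) \<le> T * weighted_q x"
proof -
  have n: "norm x > 0" "norm (x - e) > 0" using x by auto
  have "norm x + norm (x - e) < T" using E \<tau>(2) by (simp add: ellipsoid_def)
  then have T: "norm x \<le> T" "norm (x - e) \<le> T" using n by linarith+
  have wq: "weighted_q x = q x / (norm x * norm (x - e))" using E by (simp add: weighted_q_def)
  have "norm x * norm (x - e) \<le> T\<^sup>2" unfolding power2_eq_square using T P1.T by (intro mult_mono) auto
  then have "1 \<le> T\<^sup>2 / (norm x * norm (x - e))" using n by simp
  then have "q x * 1 \<le> q x * (T\<^sup>2 / (norm x * norm (x - e)))" by (rule mult_left_mono[OF _ q_nonneg])
  then show "q x \<le> T\<^sup>2 * weighted_q x" by (simp add: wq mult.commute)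
  have "q x / norm x * 1 \<le> q x / norm x * (T / norm (x - e))"
    using T n q_nonneg by (intro mult_left_mono) auto
  then show "q x / norm x \<le> T * weighted_q x" by (simp add: wq mult.commute)
  have "q x / norm (x - e) * 1 \<le> q x / norm (x - e) * (T / norm x)"
    using T n q_nonneg by (intro mult_left_mono) auto
  then show "q x / norm (x - e) \<le> T * weighted_q x" by (simp add: wq mult.commute)
qed

lemma newton_kernel_le: "newton_kernel x \<le> 1 / norm x"
  using pi_gt3 by (cases "x = 0") (auto simp: newton_kernel_def field_simps)

text \<open>Where \<open>q\<close> is nonzero and t >= |x|, the support hypothesis bounds the gap
  \<tau> - t - |x - e| by \<open>d\<close>, so the small bound on the potential applies. In the
  final factor, T^3 is T^2 from inserting both distances times the time length \<open>T\<close>; the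
  summand \<open>T\<close> comes from the term on the cone.\<close>

lemma source_term_iterate_bound:
  assumes d: "\<And>a s. 0 < s \<Longrightarrow> s \<le> T \<Longrightarrow> s - norm a \<le> d \<Longrightarrow> integral\<^sup>L lborel (ellipsoid_potential a s) \<le> \<epsilon>"
    and \<epsilon>: "\<epsilon> \<ge> 0" and supp: "\<And>x. q x \<noteq> 0 \<Longrightarrow> \<tau> \<le> norm x + norm (x - e) + d"
  shows "\<bar>source_term (iterate (Suc n))\<bar>
     \<le> Bq * (18 * ball3_vol) * \<epsilon> * exp (l * T) * (Bv * T ^ 3 + T) * (LBINT x. weighted_q x) * (1 / 2) ^ n"
proof -
  define A where "A = Bq * (18 * ball3_vol) * \<epsilon> * (1 / 2) ^ n * exp (l * T)"
  have A: "A \<ge> 0" using P1.Bq_nonneg \<epsilon> by (simp add: A_def)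
  let ?F = "adv_potential (iterate (Suc n))"
  have key: "\<bar>q (fst p) * ?F p\<bar> \<le> A * (q (fst p) * indicator (ellipsoid e \<tau>) (fst p))" if p: "norm (fst p) \<le> snd p" for p
  proof (cases "q (fst p) = 0 \<or> snd p + norm (fst p - e) \<ge> \<tau>")
    case True
    have "snd p \<ge> 0" using p norm_ge_zero order_trans by blast
    then have "q (fst p) * ?F p = 0" using True iterate_eq_0[of p "Suc n"] by auto
    moreover have "0 \<le> A * (q (fst p) * indicator (ellipsoid e \<tau>) (fst p))"
      using A q_nonneg by (intro mult_nonneg_nonneg) auto
    ultimately show ?thesis by (simp only: abs_zero)
  next
    case False
    have p0: "snd p \<ge> 0" using p norm_ge_zero order_trans by blast
    have "\<tau> - snd p - norm (fst p - e) \<le> d" using supp[of "fst p"] False p by linarith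
    then have "\<bar>?F p\<bar> \<le> Bq * (18 * ball3_vol) * \<epsilon> * (1 / 2) ^ n * exp (l * (T - snd p))"
      by (intro potential_iterate_bound[OF d \<epsilon> p0])
    also have "\<dots> \<le> A"
      unfolding A_def using p0 l P1.Bq_nonneg \<epsilon> by (intro mult_left_mono) (auto simp: mult_left_mono)
    finally have "q (fst p) * \<bar>?F p\<bar> \<le> q (fst p) * A" by (rule mult_left_mono[OF _ q_nonneg])
    moreover have "fst p \<in> ellipsoid e \<tau>" using False p by (simp add: ellipsoid_def)
    ultimately show ?thesis using q_nonneg[of "fst p"] by (simp add: abs_mult mult.commute)
  qed
  let ?G = "LBINT x. weighted_q x"
  have "\<bar>LBINT p. v2 p * (q (fst p) * ?F p)\<bar> \<le> Bv * (A * T\<^sup>2) * T * ?G"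
  proof (rule regular_source_term_bound[OF admissible_iterate])
    fix p :: spacetime assume p: "fst p \<noteq> 0" "fst p \<noteq> e" "norm (fst p) \<le> snd p" "snd p < T"
    have "q (fst p) * indicator (ellipsoid e \<tau>) (fst p) \<le> T\<^sup>2 * weighted_q (fst p)"
      using q_le_weighted_q(1)[OF p(1,2)] weighted_q_nonneg[of "fst p"] by (auto simp: indicator_def)
    then have "\<bar>q (fst p) * ?F p\<bar> \<le> A * (T\<^sup>2 * weighted_q (fst p))"
      using key[OF p(3)] mult_left_mono[OF _ A] order_trans by blast
    moreover have "snd p < norm (fst p) + T" using p(4) norm_ge_zero[of "fst p"] by linarith
    then have "snd p \<in> {norm (fst p)..<norm (fst p) + T}" using p(3) by simp
    ultimately show "\<bar>q (fst p) * ?F p\<bar>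
       \<le> A * T\<^sup>2 * (weighted_q (fst p) * indicator {norm (fst p)..<norm (fst p) + T} (snd p))"
      by (simp add: mult.assoc)
  qed (use A P1.T in auto)
  moreover have "\<bar>LBINT x. q x * ?F (x, norm x) * newton_kernel x\<bar> \<le> (A * T) * ?G"
  proof (rule singular_source_term_bound[OF admissible_iterate])
    fix x :: space assume x: "x \<noteq> 0" "x \<noteq> e"
    have "\<bar>q x * ?F (x, norm x)\<bar> * newton_kernel x \<le> A * (q x * indicator (ellipsoid e \<tau>) x) * (1 / norm x)"
      using key[of "(x, norm x)"] newton_kernel_le[of x] A q_nonneg by (intro mult_mono) auto
    also have "\<dots> = A * (q x / norm x * indicator (ellipsoid e \<tau>) x)" by simp
    also have "\<dots> \<le> A * (T * weighted_q x)"
      using q_le_weighted_q(2)[OF x] weighted_q_nonneg[of x] P1.T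
      by (intro mult_left_mono[OF _ A]) (auto simp: indicator_def)
    finally show "\<bar>q x * ?F (x, norm x)\<bar> * newton_kernel x \<le> A * T * weighted_q x" by (simp add: mult.assoc)
  qed (use A P1.T in auto)
  ultimately have "\<bar>source_term (iterate (Suc n))\<bar> \<le> Bv * (A * T\<^sup>2) * T * ?G + (A * T) * ?G"
    unfolding source_term_def by linarith
  also have "\<dots> = A * (Bv * T ^ 3 + T) * ?G" by (simp add: power2_eq_square power3_eq_cube algebra_simps)
  also have "\<dots> = Bq * (18 * ball3_vol) * \<epsilon> * exp (l * T) * (Bv * T ^ 3 + T) * ?G * (1 / 2) ^ n"
    unfolding A_def by (simp only: mult_ac)
  finally show ?thesis .
qed

text \<open>The finite expansion is solved for the singular part \<open>S\<close> of the zeroth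
  source term. Its regular part \<open>R\<close> sees only times |x| <= t < |x| + d: the potential
  vanishes once t + |x - e| >= \<tau>, and |x| + |x - e| >= \<tau> - d wherever \<open>q\<close> is
  nonzero. The later source terms are dominated by a geometric series, whence the factor 2.\<close>

lemma singular_source_term_upper:
  assumes d: "\<And>a s. 0 < s \<Longrightarrow> s \<le> T \<Longrightarrow> s - norm a \<le> d \<Longrightarrow> integral\<^sup>L lborel (ellipsoid_potential a s) \<le> \<epsilon>"
    and \<epsilon>: "\<epsilon> \<ge> 0" and d0: "d \<ge> 0" and supp: "\<And>x. q x \<noteq> 0 \<Longrightarrow> \<tau> \<le> norm x + norm (x - e) + d"
  shows "(LBINT x. q x * adv_potential (source_average e \<tau> r) (x, norm x) * newton_kernel x)
     \<le> \<bar>LBINT p. w p * source_average e \<tau> r p\<bar>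
       + (Bv * (18 * ball3_vol * T) * d + 2 * (Bq * (18 * ball3_vol) * \<epsilon> * exp (l * T) * (Bv * T ^ 3 + T)))
         * (LBINT x. weighted_q x)"
proof -
  let ?G = "LBINT x. weighted_q x"
  let ?F = "adv_potential (iterate 0)"
  define K where "K = Bq * (18 * ball3_vol) * \<epsilon> * exp (l * T) * (Bv * T ^ 3 + T) * ?G"
  have G0: "?G \<ge> 0" by (intro Bochner_Integration.integral_nonneg weighted_q_nonneg)
  have K0: "K \<ge> 0" unfolding K_def using P1.Bq_nonneg P1.Bv_nonneg P1.T \<epsilon> G0 by simp
  define S where "S = (LBINT x. q x * ?F (x, norm x) * newton_kernel x)"
  define R where "R = (LBINT p. v2 p * (q (fst p) * ?F p))"
  have R: "\<bar>R\<bar> \<le> Bv * (18 * ball3_vol * T) * d * ?G"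
    unfolding R_def
  proof (rule regular_source_term_bound[OF admissible_iterate])
    fix p :: spacetime assume p: "fst p \<noteq> 0" "fst p \<noteq> e" "norm (fst p) \<le> snd p" "snd p < T"
    show "\<bar>q (fst p) * ?F p\<bar>
       \<le> 18 * ball3_vol * T * (weighted_q (fst p) * indicator {norm (fst p)..<norm (fst p) + d} (snd p))"
    proof (cases "q (fst p) = 0 \<or> snd p + norm (fst p - e) \<ge> \<tau>")
      case True
      have "snd p \<ge> 0" using p(3) norm_ge_zero order_trans by blast
      then have "q (fst p) * ?F p = 0" using True iterate_eq_0[of p 0] by auto
      moreover have "0 \<le> 18 * ball3_vol * T * (weighted_q (fst p) * indicator {norm (fst p)..<norm (fst p) + d} (snd p))"
        using P1.T weighted_q_nonneg by (intro mult_nonneg_nonneg) auto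
      ultimately show ?thesis by (simp only: abs_zero)
    next
      case False
      have E: "fst p \<in> ellipsoid e \<tau>" using False p by (simp add: ellipsoid_def)
      have I: "snd p \<in> {norm (fst p)..<norm (fst p) + d}" using supp[of "fst p"] False p by auto
      have "\<bar>q (fst p) * ?F p\<bar> \<le> q (fst p) * (18 * ball3_vol / norm (fst p - e))"
        unfolding abs_mult abs_of_nonneg[OF q_nonneg] iterate_0
        by (intro mult_left_mono q_nonneg adv_potential_source_average_le r p)
      also have "\<dots> = 18 * ball3_vol * (q (fst p) / norm (fst p - e))" by simp
      also have "\<dots> \<le> 18 * ball3_vol * (T * weighted_q (fst p))"
        by (intro mult_left_mono q_le_weighted_q(3) p E) simp
      finally show ?thesis using I by (simp add: mult.assoc)
    qed
  qed (use d0 P1.T in auto)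
  have bound: "S \<le> \<bar>LBINT p. w p * iterate 0 p\<bar> + \<bar>LBINT p. w p * iterate (Suc N) p\<bar> + \<bar>R\<bar> + 2 * K" for N
  proof -
    have "(LBINT p. w p * iterate 0 p)
       = (LBINT p. w p * iterate (Suc N) p) + (\<Sum>n<Suc N. source_term (iterate n))"
      using duhamel_difference_iterate[OF admissible_iterate[of 0], of "Suc N"] by (simp add: iterate_def)
    also have "(\<Sum>n<Suc N. source_term (iterate n)) = source_term (iterate 0) + (\<Sum>n<N. source_term (iterate (Suc n)))"
      by (rule sum.lessThan_Suc_shift)
    finally have eq: "S = (LBINT p. w p * iterate 0 p) - (LBINT p. w p * iterate (Suc N) p) - R
       - (\<Sum>n<N. source_term (iterate (Suc n)))"
      unfolding S_def R_def source_term_def[of "iterate 0"] by simp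
    have "\<bar>\<Sum>n<N. source_term (iterate (Suc n))\<bar> \<le> (\<Sum>n<N. K * (1 / 2) ^ n)"
      by (intro order_trans[OF sum_abs] sum_mono)
        (unfold K_def, rule source_term_iterate_bound[OF d \<epsilon> supp])
    also have "\<dots> = K * (\<Sum>n<N. (1 / 2) ^ n)" by (simp add: sum_distrib_left)
    also have "\<dots> \<le> K * 2"
    proof (rule mult_left_mono[OF _ K0])
      have "(\<Sum>n<N. (1 / 2) ^ n) \<le> (\<Sum>n. (1 / 2) ^ n :: real)"
        by (intro sum_le_suminf) auto
      then show "(\<Sum>n<N. (1 / 2) ^ n) \<le> (2 :: real)" by (simp add: suminf_geometric)
    qed
    finally show ?thesis unfolding eq by linarith
  qed
  \<comment> \<open>Only the remainder depends on \<open>N\<close>, so it can be sent to 0 on the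
    right while \<open>S\<close> stays fixed.\<close>
  have "(\<lambda>N. \<bar>LBINT p. w p * iterate 0 p\<bar> + \<bar>LBINT p. w p * iterate (Suc N) p\<bar> + \<bar>R\<bar> + 2 * K)
     \<longlonglongrightarrow> \<bar>LBINT p. w p * iterate 0 p\<bar> + \<bar>0\<bar> + \<bar>R\<bar> + 2 * K"
    by (intro tendsto_intros LIMSEQ_Suc integral_w_iterate_tendsto_0)
  then have "S \<le> \<bar>LBINT p. w p * iterate 0 p\<bar> + \<bar>0\<bar> + \<bar>R\<bar> + 2 * K"
    by (rule LIMSEQ_le_const) (use bound in blast)
  then have "S \<le> \<bar>LBINT p. w p * iterate 0 p\<bar> + Bv * (18 * ball3_vol * T) * d * ?G + 2 * K"
    using R by linarith
  then show ?thesis unfolding S_def iterate_0 K_def by (simp add: distrib_right mult.assoc)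
qed

text \<open>The constant is \<open>ball3_vol\<close> / (8 * pi) from the lower bound of the
  potential times 1 / (4 * pi) from the Newton kernel. Outside the region where that lower bound
  holds, the integrand is still nonnegative, which uses the sign of \<open>q\<close>.\<close>

lemma singular_source_term_lower:
  "ball3_vol / (32 * pi\<^sup>2) * (LBINT x. weighted_q x * indicator {x. norm (x - e) \<ge> r \<and> norm x + norm (x - e) < \<tau> - 2 * r} x)
   \<le> (LBINT x. q x * adv_potential (source_average e \<tau> r) (x, norm x) * newton_kernel x)"
proof -
  let ?A = "{x. norm (x - e) \<ge> r \<and> norm x + norm (x - e) < \<tau> - 2 * r}"
  have "?A = {x. r \<le> norm (x - e)} \<inter> {x. norm x + norm (x - e) < \<tau> - 2 * r}" by auto
  moreover have "closed {x. r \<le> norm (x - e)}" by (intro closed_Collect_le continuous_intros)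
  moreover have "open {x. norm x + norm (x - e) < \<tau> - 2 * r}" by (intro open_Collect_less continuous_intros)
  ultimately have A: "?A \<in> sets borel" by (auto intro: borel_closed borel_open)
  have i: "integrable lborel (\<lambda>x. ball3_vol / (32 * pi\<^sup>2) * (weighted_q x * indicator ?A x))"
    using A by (intro integrable_mult_right integrable_real_mult_indicator integrable_weighted_q) simp
  have "(LBINT x. ball3_vol / (32 * pi\<^sup>2) * (weighted_q x * indicator ?A x))
     \<le> (LBINT x. q x * adv_potential (source_average e \<tau> r) (x, norm x) * newton_kernel x)"
  proof (intro integral_mono i)
    show "integrable lborel (\<lambda>x. q x * adv_potential (source_average e \<tau> r) (x, norm x) * newton_kernel x)"
      using integrable_source_terms(3)[OF admissible_iterate[of 0]] by (simp add: iterate_0)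
    fix x
    have "adv_potential (source_average e \<tau> r) (x, norm x) \<ge> 0"
      by (intro adv_potential_nonneg source_average_nonneg r)
    then have nn: "0 \<le> q x * adv_potential (source_average e \<tau> r) (x, norm x) * newton_kernel x"
      using q_nonneg by simp
    show "ball3_vol / (32 * pi\<^sup>2) * (weighted_q x * indicator ?A x)
      \<le> q x * adv_potential (source_average e \<tau> r) (x, norm x) * newton_kernel x"
    proof (cases "x \<in> ?A")
      case True
      then have "x \<in> ellipsoid e \<tau>" using r by (simp add: ellipsoid_def)
      then have "ball3_vol / (32 * pi\<^sup>2) * weighted_q x
         = q x * (ball3_vol / (8 * pi * norm (x - e))) * newton_kernel x"
        by (simp add: weighted_q_def newton_kernel_def power2_eq_square mult_ac)
      also have "\<dots> \<le> q x * adv_potential (source_average e \<tau> r) (x, norm x) * newton_kernel x"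
        using True adv_potential_source_average_ge[OF r \<tau>(1), of "(x, norm x)" e] q_nonneg
        by (intro mult_right_mono mult_left_mono) auto
      finally show ?thesis using True by simp
    qed (use nn in simp)
  qed
  then show ?thesis unfolding integral_mult_right_zero .
qed

end

section \<open>Uniqueness\<close>

context two_point_sources
begin

lemma w_continuous_on: "continuous_on {p. norm (fst p) \<le> snd p} w"
  unfolding w_def[abs_def]
  by (intro continuous_on_diff goursat_solution_continuous_on[OF P1.gs] goursat_solution_continuous_on[OF P2.gs])

text \<open>\<open>w\<close> may jump across the light cone, so the data at \<open>e\<close> give no
  smallness near time |e|. Times within \<open>\<sigma>\<close> of |e| are paid for by their short
  duration, earlier ones have \<open>w\<close> = 0, and at later ones uniform continuity transfers
  the vanishing at \<open>e\<close> to nearby points.\<close>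

lemma integral_w_source_average_small:
  assumes \<tau>: "\<tau> > 0" "\<tau> \<le> T" and data: "\<And>t. 0 \<le> t \<Longrightarrow> t \<le> T \<Longrightarrow> w (e, t) = 0" and \<eta>: "\<eta> > 0"
  obtains r0 where "r0 > 0" "\<And>r. 0 < r \<Longrightarrow> r < r0 \<Longrightarrow> \<bar>LBINT p. w p * source_average e \<tau> r p\<bar> \<le> \<eta>"
proof -
  have T: "T > 0" by (rule P1.T)
  have V: "ball3_vol > 0" by simp
  have Bw: "2 * Bv + 1 > 0" using P1.Bv_nonneg by simp
  \<comment> \<open>Makes (2 * Bv + 1) * 2 * \<sigma> * \<open>ball3_vol\<close> equal to \<eta> /
    2; the summand 1 keeps the denominator positive. Likewise \<open>\<eta>'\<close> is chosen so
    that the later times contribute \<eta> / 2.\<close>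
  define \<sigma> where "\<sigma> = \<eta> / (4 * ball3_vol * (2 * Bv + 1))"
  have \<sigma>: "\<sigma> > 0" using \<eta> V Bw by (simp add: \<sigma>_def)
  define \<eta>' where "\<eta>' = \<eta> / (2 * ball3_vol * T)"
  have \<eta>': "\<eta>' > 0" using \<eta> V T by (simp add: \<eta>'_def)
  \<comment> \<open>For x within \<sigma> / 2 of \<open>e\<close> and t >= |e| + \<sigma> one has
    |x| <= t, so this compact set stays in the closed cone, where \<open>w\<close> is
    continuous.\<close>
  define K where "K = cball e (\<sigma> / 2) \<times> {norm e + \<sigma>..T}"
  have Kc: "K \<subseteq> {p. norm (fst p) \<le> snd p}"
  proof
    fix p assume "p \<in> K"
    then have "norm (e - fst p) \<le> \<sigma> / 2" "norm e + \<sigma> \<le> snd p" by (auto simp: K_def dist_norm)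
    then have "norm (fst p) \<le> snd p" using norm_triangle_ineq4[of e "e - fst p"] \<sigma> by simp
    then show "p \<in> {p. norm (fst p) \<le> snd p}" by simp
  qed
  have "compact K" unfolding K_def by (intro compact_Times) auto
  then have "uniformly_continuous_on K w"
    by (rule compact_uniformly_continuous[OF continuous_on_subset[OF w_continuous_on Kc]])
  then obtain r1 where r1: "r1 > 0" "\<And>p p'. p \<in> K \<Longrightarrow> p' \<in> K \<Longrightarrow> dist p' p < r1 \<Longrightarrow> dist (w p') (w p) < \<eta>'"
    using \<eta>' unfolding uniformly_continuous_on_def by metis
  define r0 where "r0 = min (\<sigma> / 2) r1"
  have r0: "r0 > 0" using \<sigma> r1 by (simp add: r0_def)
  have "\<bar>LBINT p. w p * source_average e \<tau> r p\<bar> \<le> \<eta>" if r: "0 < r" "r < r0" for r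
  proof -
    define g where "g = (\<lambda>x. indicator (ball e r) x / r ^ 3 :: real)"
    have gi: "integrable lborel g"
      unfolding g_def by (intro integrable_divide integrable_real_indicator emeasure_bounded_finite) auto
    have gV: "(LBINT x. g x) = ball3_vol"
      unfolding g_def using content_ball[of r e] r by simp
    let ?I1 = "\<lambda>p. g (fst p) * indicator {norm e - \<sigma>..<norm e - \<sigma> + 2 * \<sigma>} (snd p)"
    let ?I2 = "\<lambda>p. g (fst p) * indicator {0..<0 + T} (snd p)"
    have i1: "integrable lborel ?I1" "(LBINT p. ?I1 p) = 2 * \<sigma> * ball3_vol"
      using integral_time_interval[OF gi, of "\<lambda>_. norm e - \<sigma>" "2 * \<sigma>"] \<sigma> by (simp_all only: gV) auto
    have i2: "integrable lborel ?I2" "(LBINT p. ?I2 p) = T * ball3_vol"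
      using integral_time_interval[OF gi, of "\<lambda>_. 0" T] T by (simp_all only: gV) auto
    have g0: "g x \<ge> 0" for x using r by (simp add: g_def)
    have le: "\<bar>w p * source_average e \<tau> r p\<bar> \<le> 2 * Bv * ?I1 p + \<eta>' * ?I2 p" for p
    proof (cases "fst p \<in> ball e r \<and> snd p < \<tau> - r")
      case False
      then have "source_average e \<tau> r p = 0" by (auto simp: source_average_def)
      moreover have "0 \<le> 2 * Bv * ?I1 p + \<eta>' * ?I2 p"
        using P1.Bv_nonneg \<eta>' g0 by (intro add_nonneg_nonneg mult_nonneg_nonneg) auto
      ultimately show ?thesis by simp
    next
      case True
      then have sa: "source_average e \<tau> r p = g (fst p)" by (simp add: source_average_def g_def)
      have pT: "snd p < T" using True r \<tau> by simp
      have n: "norm (e - fst p) < r" using True by (simp add: dist_norm)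
      have rs: "r < \<sigma> / 2" "r < r1" using r by (auto simp: r0_def)
      consider "snd p < norm e - \<sigma>" | "norm e - \<sigma> \<le> snd p" "snd p < norm e + \<sigma>" | "norm e + \<sigma> \<le> snd p" by linarith
      then have "\<bar>w p\<bar> \<le> 2 * Bv * indicator {norm e - \<sigma>..<norm e - \<sigma> + 2 * \<sigma>} (snd p) + \<eta>' * indicator {0..<0 + T} (snd p)"
      proof cases
        case 1
        have "snd p < norm (fst p)" using norm_triangle_ineq[of "fst p" "e - fst p"] n rs 1 \<sigma> by simp
        then show ?thesis using w_eq_0[of p] P1.Bv_nonneg \<eta>' by simp
      next
        case 2
        then have "snd p \<in> {norm e - \<sigma>..<norm e - \<sigma> + 2 * \<sigma>}" by simp
        then show ?thesis using w_le[of p] pT \<eta>' by (auto simp: indicator_def)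
      next
        case 3
        have p0: "0 \<le> snd p" using 3 \<sigma> norm_ge_zero[of e] by linarith
        have pK: "p \<in> K" "(e, snd p) \<in> K"
          using 3 n rs pT \<sigma> by (auto simp: K_def dist_norm mem_Times_iff)
        have "dist p (e, snd p) = norm (e - fst p)"
          by (simp add: dist_prod_def dist_norm norm_minus_commute)
        then have "dist (w p) (w (e, snd p)) < \<eta>'" using r1(2)[OF pK(2,1)] n rs by simp
        then have "\<bar>w p\<bar> < \<eta>'" using data[of "snd p"] p0 pT by (simp add: dist_real_def)
        then show ?thesis using p0 pT P1.Bv_nonneg by (simp add: indicator_def)
      qed
      then have "\<bar>w p\<bar> * g (fst p) \<le> (2 * Bv * indicator {norm e - \<sigma>..<norm e - \<sigma> + 2 * \<sigma>} (snd p) + \<eta>' * indicator {0..<0 + T} (snd p)) * g (fst p)"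
        by (rule mult_right_mono) (rule g0)
      also have "\<dots> = 2 * Bv * ?I1 p + \<eta>' * ?I2 p"
        by (subst distrib_right) (simp only: mult_ac)
      finally show ?thesis by (simp only: sa abs_mult abs_of_nonneg[OF g0])
    qed
    have bi: "integrable lborel (\<lambda>p. 2 * Bv * ?I1 p + \<eta>' * ?I2 p)"
      by (intro Bochner_Integration.integrable_add integrable_mult_right i1 i2)
    have "w \<in> borel_measurable borel" unfolding w_def[abs_def] by (intro borel_measurable_diff P1.v_measurable P2.v_measurable)
    then have "(\<lambda>p. w p * source_average e \<tau> r p) \<in> borel_measurable lborel"
      using source_average_measurable by simp
    then have wi: "integrable lborel (\<lambda>p. w p * source_average e \<tau> r p)"
      by (rule Bochner_Integration.integrable_bound[OF bi]) (intro AE_I2 abs_le_imp_norm_le le)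
    have "\<bar>LBINT p. w p * source_average e \<tau> r p\<bar> \<le> (LBINT p. 2 * Bv * ?I1 p + \<eta>' * ?I2 p)"
      using Bochner_Integration.integral_norm_bound_integral[OF wi bi] le unfolding real_norm_def by blast
    also have "\<dots> = 2 * Bv * (2 * \<sigma> * ball3_vol) + \<eta>' * (T * ball3_vol)"
      by (simp only: Bochner_Integration.integral_add[OF integrable_mult_right integrable_mult_right, OF i1(1) i2(1)]
          integral_mult_right_zero i1(2) i2(2))
    also have "2 * Bv * (2 * \<sigma> * ball3_vol) \<le> (2 * Bv + 1) * (2 * \<sigma> * ball3_vol)"
      using \<sigma> V by (intro mult_right_mono) auto
    also have "(2 * Bv + 1) * (2 * \<sigma> * ball3_vol) = \<eta> / 2"
    proof -
      have "B * (2 * (\<eta> / (4 * V * B)) * V) = \<eta> / 2" if "B > 0" "V > 0" for B V :: real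
        using that by (simp add: field_simps)
      then show ?thesis using Bw V unfolding \<sigma>_def by blast
    qed
    also have "\<eta>' * (T * ball3_vol) = \<eta> / 2"
      using T V unfolding \<eta>'_def by (simp add: less_imp_neq[symmetric])
    finally show ?thesis by simp
  qed
  then show ?thesis using that r0 by blast
qed

lemma cancel_divide: "k \<noteq> 0 \<Longrightarrow> k * (c / (m * k)) = c / (m :: real)"
  by simp

text \<open>If the supporting ellipsoid of \<open>q\<close> is close to the ellipsoid of size \<open>\<tau>\<close>, then everything
  but the leading term is smaller than the leading term.\<close>

lemma weighted_q_integral_eq_0:
  assumes data: "\<And>t. 0 \<le> t \<Longrightarrow> t \<le> T \<Longrightarrow> w (e, t) = 0"
  obtains d where "d > 0"
    "\<And>\<tau>. 0 < \<tau> \<Longrightarrow> \<tau> \<le> T \<Longrightarrow> (\<And>x. q x \<noteq> 0 \<Longrightarrow> \<tau> \<le> norm x + norm (x - e) + d) \<Longrightarrow>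
       integrable lborel (\<lambda>x. q x * ellipsoid_potential e \<tau> x) \<and> (LBINT x. q x * ellipsoid_potential e \<tau> x) = 0"
proof -
  have T: "T > 0" by (rule P1.T)
  have V: "ball3_vol > 0" by simp
  have "0 < 1 / (2 * (Bq + 1))" using P1.Bq_nonneg by simp
  then obtain l where l: "l \<ge> 0" "weighted_mass T l \<le> 1 / (2 * (Bq + 1))"
    using weighted_mass_small[OF T] by metis
  have wm0: "weighted_mass T l \<ge> 0"
    unfolding weighted_mass_def by (intro Bochner_Integration.integral_nonneg) simp
  have "Bq * weighted_mass T l \<le> (Bq + 1) * weighted_mass T l"
    using wm0 by (intro mult_right_mono) auto
  also have "\<dots> \<le> (Bq + 1) * (1 / (2 * (Bq + 1)))"
    using l P1.Bq_nonneg by (intro mult_left_mono) auto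
  also have "\<dots> = 1 / 2" using P1.Bq_nonneg by simp
  finally have l2: "Bq * weighted_mass T l \<le> 1 / 2" .
  define c where "c = ball3_vol / (32 * pi\<^sup>2)"
  have c: "c > 0" using V by (simp add: c_def)
  define K1 where "K1 = Bq * (18 * ball3_vol) * exp (l * T) * (Bv * T ^ 3 + T)"
  define K2 where "K2 = Bv * (18 * ball3_vol * T)"
  have K1: "K1 \<ge> 0" and K2: "K2 \<ge> 0"
    using P1.Bq_nonneg P1.Bv_nonneg T by (auto simp: K1_def K2_def)
  \<comment> \<open>The budget for all non-leading terms is c / 2, a quarter of \<open>c\<close> for
    the Neumann terms and a quarter for the term with \<open>v2\<close>. Here 2 * K1 * \<epsilon> <=
    c / 4; adding 1 to \<open>K1\<close> avoids division by 0.\<close>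
  define \<epsilon> where "\<epsilon> = c / (8 * (K1 + 1))"
  have \<epsilon>: "\<epsilon> > 0" using c K1 by (simp add: \<epsilon>_def)
  have e1: "2 * (K1 * \<epsilon>) \<le> c / 4"
  proof -
    have "K1 * \<epsilon> \<le> (K1 + 1) * \<epsilon>" using \<epsilon> by simp
    also have "\<dots> = c / 8" unfolding \<epsilon>_def using K1 by (intro cancel_divide) linarith
    finally show ?thesis by simp
  qed
  obtain d0 where d0: "d0 > 0"
    "\<And>a s. 0 < s \<Longrightarrow> s \<le> T \<Longrightarrow> s - norm a \<le> d0 \<Longrightarrow> integral\<^sup>L lborel (ellipsoid_potential a s) \<le> \<epsilon>"
    using ellipsoid_potential_small[OF T \<epsilon>] by blast
  \<comment> \<open>The second entry makes K2 * d <= c / 4. This \<open>d\<close> is fixed before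
    \<open>\<tau>\<close> and depends only on \<open>T\<close> and the bounds, so the same step
    width works at every size of the ellipsoid.\<close>
  define d where "d = min d0 (c / (4 * (K2 + 1)))"
  have d: "d > 0" using d0 c K2 by (simp add: d_def)
  have dI: "integral\<^sup>L lborel (ellipsoid_potential a s) \<le> \<epsilon>" if "0 < s" "s \<le> T" "s - norm a \<le> d" for a s
    using d0(2)[OF that(1,2)] that(3) by (simp add: d_def)
  have e2: "K2 * d \<le> c / 4"
  proof -
    have "K2 * d \<le> (K2 + 1) * (c / (4 * (K2 + 1)))"
      using K2 d by (intro mult_mono) (auto simp: d_def)
    also have "\<dots> = c / 4" using K2 by (intro cancel_divide) linarith
    finally show ?thesis .
  qed
  have "integrable lborel (\<lambda>x. q x * ellipsoid_potential e \<tau> x) \<and> (LBINT x. q x * ellipsoid_potential e \<tau> x) = 0"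
    if \<tau>: "0 < \<tau>" "\<tau> \<le> T" and supp: "\<And>x. q x \<noteq> 0 \<Longrightarrow> \<tau> \<le> norm x + norm (x - e) + d" for \<tau>
  proof -
    have as: "averaged_source q1 q2 v1 v2 T Bv Bq u1 u2 \<tau> r l" if "r > 0" for r
      by (intro averaged_source.intro averaged_source_axioms.intro two_point_sources_axioms that \<tau> l l2)
    define g where "g = (\<lambda>x. q x * ellipsoid_potential e \<tau> x)"
    have wq: "averaged_source.weighted_q q1 q2 e \<tau> = g"
      using averaged_source.weighted_q_def[OF as[of 1]] by (auto simp: g_def)
    have gi: "integrable lborel g" using averaged_source.integrable_weighted_q[OF as[of 1], of e] wq by simp
    have g0: "g x \<ge> 0" for x unfolding g_def using q_nonneg by simp
    define G where "G = (LBINT x. g x)"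
    have G0: "G \<ge> 0" unfolding G_def by (intro Bochner_Integration.integral_nonneg g0)
    let ?A = "\<lambda>r. {x. norm (x - e) \<ge> r \<and> norm x + norm (x - e) < \<tau> - 2 * r}"
    have ineq: "c * (LBINT x. g x * indicator (?A r) x)
       \<le> \<bar>LBINT p. w p * source_average e \<tau> r p\<bar> + c / 2 * G" if r: "r > 0" for r
    proof -
      have "c * (LBINT x. g x * indicator (?A r) x)
         \<le> (LBINT x. q x * adv_potential (source_average e \<tau> r) (x, norm x) * newton_kernel x)"
        using averaged_source.singular_source_term_lower[OF as[OF r], of e] unfolding wq c_def .
      also have "\<dots> \<le> \<bar>LBINT p. w p * source_average e \<tau> r p\<bar>
         + (K2 * d + 2 * (Bq * (18 * ball3_vol) * \<epsilon> * exp (l * T) * (Bv * T ^ 3 + T))) * G"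
        using averaged_source.singular_source_term_upper[OF as[OF r] dI _ _ supp] \<epsilon> d
        unfolding wq G_def K2_def by simp
      also have "Bq * (18 * ball3_vol) * \<epsilon> * exp (l * T) * (Bv * T ^ 3 + T) = K1 * \<epsilon>"
        unfolding K1_def by simp
      also have "(K2 * d + 2 * (K1 * \<epsilon>)) * G \<le> c / 2 * G"
        using e1 e2 G0 by (intro mult_right_mono) auto
      finally show ?thesis by simp
    qed
    \<comment> \<open>As the radius of the averaging ball tends to 0, the regions \<open>?A\<close>
      exhaust the ellipsoid except for the point \<open>e\<close>.\<close>
    have conv: "(\<lambda>n. LBINT x. g x * indicator (?A (1 / real (Suc n))) x) \<longlonglongrightarrow> G"
      unfolding G_def
    proof (rule integral_dominated_convergence[OF _ _ gi])
      show "g \<in> borel_measurable lborel" by (rule borel_measurable_integrable[OF gi])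
      show "(\<lambda>x. g x * indicator (?A (1 / real (Suc n))) x) \<in> borel_measurable lborel" for n
      proof -
        have "?A s = {x. s \<le> norm (x - e)} \<inter> {x. norm x + norm (x - e) < \<tau> - 2 * s}" for s by auto
        moreover have "closed {x. s \<le> norm (x - e)}" for s by (intro closed_Collect_le continuous_intros)
        moreover have "open {x. norm x + norm (x - e) < \<tau> - 2 * s}" for s by (intro open_Collect_less continuous_intros)
        ultimately have "?A s \<in> sets borel" for s by (auto intro: borel_closed borel_open)
        then show ?thesis
          by (intro borel_measurable_times borel_measurable_integrable[OF gi] borel_measurable_indicator) simp
      qed
      show "AE x in lborel. norm (g x * indicator (?A (1 / real (Suc n))) x) \<le> g x" for n
        by (intro AE_I2) (use g0 in \<open>auto simp: indicator_def\<close>)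
      show "AE x in lborel. (\<lambda>n. g x * indicator (?A (1 / real (Suc n))) x) \<longlonglongrightarrow> g x"
        using AE_lborel_singleton[of e]
      proof eventually_elim
        case (elim x)
        show ?case
        proof (cases "x \<in> ellipsoid e \<tau>")
          case False
          then show ?thesis by (simp add: g_def)
        next
          case True
          have l0: "(\<lambda>n. 1 / real (Suc n)) \<longlonglongrightarrow> 0" using LIMSEQ_inverse_real_of_nat by (simp add: inverse_eq_divide)
          have m: "0 < min (norm (x - e)) ((\<tau> - norm x - norm (x - e)) / 2)"
            using True elim by (simp add: ellipsoid_def)
          have "\<forall>\<^sub>F n in sequentially. 1 / real (Suc n) < min (norm (x - e)) ((\<tau> - norm x - norm (x - e)) / 2)"
            by (rule order_tendstoD(2)[OF l0 m])
          then have "\<forall>\<^sub>F n in sequentially. g x * indicator (?A (1 / real (Suc n))) x = g x"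
          proof eventually_elim
            case (elim n)
            have "x \<in> ?A s" if "s < min (norm (x - e)) ((\<tau> - norm x - norm (x - e)) / 2)" for s
              using that by simp
            from this[OF elim] have "x \<in> ?A (1 / real (Suc n))" .
            then show ?case by simp
          qed
          then show ?thesis by (rule tendsto_eventually)
        qed
      qed
    qed
    have "c * G \<le> c / 2 * G + \<eta>" if \<eta>: "\<eta> > 0" for \<eta>
    proof -
      obtain r0 where r0: "r0 > 0" "\<And>r. 0 < r \<Longrightarrow> r < r0 \<Longrightarrow> \<bar>LBINT p. w p * source_average e \<tau> r p\<bar> \<le> \<eta>"
        using integral_w_source_average_small[OF \<tau> data \<eta>] by metis
      have l0: "(\<lambda>n. 1 / real (Suc n)) \<longlonglongrightarrow> 0" using LIMSEQ_inverse_real_of_nat by (simp add: inverse_eq_divide)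
      have "\<forall>\<^sub>F n in sequentially. 1 / real (Suc n) < r0" by (rule order_tendstoD(2)[OF l0 r0(1)])
      then have ev: "\<forall>\<^sub>F n in sequentially. c * (LBINT x. g x * indicator (?A (1 / real (Suc n))) x) \<le> \<eta> + c / 2 * G"
      proof eventually_elim
        case (elim n)
        have pos: "0 < 1 / real (Suc n)" by simp
        show ?case using ineq[OF pos] r0(2)[OF pos elim] by linarith
      qed
      show ?thesis
        using tendsto_upperbound[OF tendsto_mult_left[OF conv] ev] by (simp add: add.commute)
    qed
    \<comment> \<open>The data term has disappeared with the radius, and half of the leading term
      now bounds the whole of it.\<close>
    then have "c * G \<le> c / 2 * G" by (rule field_le_epsilon)
    then have "c * G \<le> 0" by (simp add: mult.commute)
    then have "G \<le> 0" using c by (simp add: mult_le_0_iff)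
    then show ?thesis using G0 gi unfolding G_def g_def by simp
  qed
  then show ?thesis using that d by blast
qed

text \<open>The growth of the zero set is condensed into one contradiction: \<open>\<tau>0\<close>
  is the infimum of |x| + |x - e| over the points where \<open>q\<close> is nonzero, and a step of
  uniform width beyond \<open>\<tau>0\<close> still finds \<open>q\<close> vanishing.\<close>

lemma q_eq_0_inside:
  assumes data: "\<And>t. 0 \<le> t \<Longrightarrow> t \<le> T \<Longrightarrow> w (e, t) = 0"
    and x: "norm x + norm (x - e) < T"
  shows "q x = 0"
proof (rule ccontr)
  assume qx: "q x \<noteq> 0"
  obtain d where d: "d > 0"
    "\<And>\<tau>. 0 < \<tau> \<Longrightarrow> \<tau> \<le> T \<Longrightarrow> (\<And>x. q x \<noteq> 0 \<Longrightarrow> \<tau> \<le> norm x + norm (x - e) + d) \<Longrightarrow>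
       integrable lborel (\<lambda>x. q x * ellipsoid_potential e \<tau> x) \<and> (LBINT x. q x * ellipsoid_potential e \<tau> x) = 0"
    using weighted_q_integral_eq_0[OF data] by blast
  define S where "S = (\<lambda>x. norm x + norm (x - e)) ` {x. q x \<noteq> 0}"
  have Sne: "S \<noteq> {}" using qx by (auto simp: S_def)
  have Slow: "norm e \<le> s" if "s \<in> S" for s
    using that norm_triangle_ineq4[of y "y - e" for y] by (auto simp: S_def)
  have Sbdd: "bdd_below S" using Slow by (rule bdd_belowI)
  define \<tau>0 where "\<tau>0 = Inf S"
  have \<tau>0T: "\<tau>0 < T" unfolding \<tau>0_def
    by (rule le_less_trans[OF cInf_lower[OF _ Sbdd] x]) (use qx in \<open>auto simp: S_def\<close>)
  have \<tau>0: "\<tau>0 \<ge> norm e" unfolding \<tau>0_def by (rule cInf_greatest[OF Sne Slow])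
  \<comment> \<open>Large enough to exceed \<open>\<tau>0\<close>, and small enough for the support
    hypothesis, since \<open>q\<close> vanishes wherever |x| + |x - e| < \<tau>0.\<close>
  define \<tau> where "\<tau> = min T (\<tau>0 + d)"
  have "0 < \<tau>0 + d" using \<tau>0 d(1) norm_ge_zero[of e] by linarith
  then have \<tau>: "0 < \<tau>" "\<tau> \<le> T" "\<tau>0 < \<tau>" using \<tau>0T d(1) P1.T by (simp_all add: \<tau>_def)
  have supp: "\<tau> \<le> norm y + norm (y - e) + d" if "q y \<noteq> 0" for y
  proof -
    have "\<tau>0 \<le> norm y + norm (y - e)" unfolding \<tau>0_def
      by (rule cInf_lower[OF _ Sbdd]) (use that in \<open>auto simp: S_def\<close>)
    then show ?thesis by (simp add: \<tau>_def)
  qed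
  have i: "integrable lborel (\<lambda>x. q x * ellipsoid_potential e \<tau> x)"
    and z: "(LBINT x. q x * ellipsoid_potential e \<tau> x) = 0"
    using d(2)[OF \<tau>(1,2) supp] by auto
  have "AE x in lborel. q x * ellipsoid_potential e \<tau> x = 0"
    using z integral_nonneg_eq_0_iff_AE[OF i] q_nonneg by simp
  \<comment> \<open>At 0 and \<open>e\<close> the weight is 0 by the convention x / 0 = 0, so these
    two points are discarded before concluding that \<open>q\<close> itself vanishes.\<close>
  then have AE: "AE x in lborel. x \<notin> {x. 0 < q x} \<inter> {x. norm x + norm (x - e) < \<tau>}"
    using AE_lborel_singleton[of 0] AE_lborel_singleton[of e]
    by eventually_elim (auto simp: ellipsoid_def)
  let ?U = "{x. 0 < q x} \<inter> {x. norm x + norm (x - e) < \<tau>}"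
  have oU: "open ?U" by (intro open_Int open_Collect_less continuous_intros q_continuous)
  \<comment> \<open>By the choice of \<open>\<tau>0\<close> the open set \<open>?U\<close> is
    nonempty, hence not a null set.\<close>
  obtain s where "s \<in> S" "s < \<tau>" using cInf_lessD[OF Sne, of \<tau>] \<tau>(3) by (auto simp: \<tau>0_def)
  then obtain y where "q y \<noteq> 0" "norm y + norm (y - e) < \<tau>" by (auto simp: S_def)
  then have "y \<in> ?U" using q_nonneg[of y] by auto
  then have "\<not> negligible ?U" using open_not_negligible[OF oU] by blast
  moreover have "?U \<in> null_sets lborel"
    using AE oU by (subst AE_iff_null_sets) auto
  then have "negligible ?U" by (simp add: negligible_iff_null_sets null_sets_completionI)
  ultimately show False by blast
qed

end

lemma point_source_problemI:
  assumes sol: "ivp_solution q u v" and q: "continuous_on UNIV q" and T: "T > 0"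
    and Bv: "\<And>p. snd p \<le> T \<Longrightarrow> \<bar>v p\<bar> \<le> Bv" and Bq: "\<And>x. norm x \<le> T \<Longrightarrow> \<bar>q x\<bar> \<le> Bq"
  shows "point_source_problem q v T Bv Bq u"
  using assms by (intro point_source_problem.intro goursat_problem.intro point_source_problem_axioms.intro)
    (auto simp: ivp_solution_def)

theorem theorem1p1:
  fixes e :: "real^3" and T :: real
    and q1 q2 :: "real^3 \<Rightarrow> real"
    and u1 u2 :: "(((real^3) \<times> real) \<Rightarrow> real) \<Rightarrow> real"
    and v1 v2 :: "(real^3) \<times> real \<Rightarrow> real"
  assumes e: "e = vector [1, 0, 0]"
    and T: "T > 1"
    and q1: "Ck_on 3 q1 UNIV" and q2: "Ck_on 3 q2 UNIV"
    and ge: "\<And>x. q1 x \<ge> q2 x"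
    and u1: "ivp_solution q1 u1 v1" and u2: "ivp_solution q2 u2 v2"
    and data: "\<And>t. t \<in> {0..T} \<Longrightarrow> v1 (e, t) = v2 (e, t)"
  shows "\<forall>x. norm (e - x) + norm x \<le> T \<longrightarrow> q1 x = q2 x"
proof (intro allI impI)
  fix x assume x: "norm (e - x) + norm x \<le> T"
  have c1: "continuous_on UNIV q1" and c2: "continuous_on UNIV q2"
    using q1 q2 by (auto intro: Ck_on_imp_continuous_on)
  have gs: "goursat_solution q1 v1" "goursat_solution q2 v2" using u1 u2 by (auto simp: ivp_solution_def)
  obtain A1 where A1: "\<And>p. snd p \<le> T \<Longrightarrow> \<bar>v1 p\<bar> \<le> A1" using goursat_solution_bounded[OF gs(1)] by metis
  obtain A2 where A2: "\<And>p. snd p \<le> T \<Longrightarrow> \<bar>v2 p\<bar> \<le> A2" using goursat_solution_bounded[OF gs(2)] by metis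
  obtain B1 where B1: "\<And>x. norm x \<le> T \<Longrightarrow> \<bar>q1 x\<bar> \<le> B1" using continuous_bounded_ball[OF c1] by metis
  obtain B2 where B2: "\<And>x. norm x \<le> T \<Longrightarrow> \<bar>q2 x\<bar> \<le> B2" using continuous_bounded_ball[OF c2] by metis
  have T0: "T > 0" using T by simp
  have "point_source_problem q1 v1 T (max A1 A2) (max B1 B2) u1"
    by (rule point_source_problemI[OF u1 c1 T0]) (simp_all add: A1 B1 le_max_iff_disj)
  moreover have "point_source_problem q2 v2 T (max A1 A2) (max B1 B2) u2"
    by (rule point_source_problemI[OF u2 c2 T0]) (simp_all add: A2 B2 le_max_iff_disj)
  ultimately interpret two_point_sources q1 q2 v1 v2 T "max A1 A2" "max B1 B2" u1 u2
    using ge by (intro two_point_sources.intro two_point_sources_axioms.intro)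
  have e1: "norm e = 1" by (simp add: e norm_vec_def L2_set_def sum_3)
  have w0: "w (e, t) = 0" if "0 \<le> t" "t \<le> T" for t using data[of t] that by (simp add: w_def)
  \<comment> \<open>Points on the boundary of the ellipsoid are reached by continuity of
    \<open>q\<close>. Along the segment towards \<open>e\<close>, the convex function |y| + |y - e|
    drops strictly below \<open>T\<close>, because its value at \<open>e\<close> is 1 < T.\<close>
  have "q ((1 - s) *\<^sub>R x + s *\<^sub>R e) = 0" if s: "0 < s" "s \<le> 1" for s
  proof (rule q_eq_0_inside[OF w0])
    let ?y = "(1 - s) *\<^sub>R x + s *\<^sub>R e"
    have "norm ?y \<le> (1 - s) * norm x + s"
      using norm_triangle_ineq[of "(1 - s) *\<^sub>R x" "s *\<^sub>R e"] s e1 by simp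
    moreover have "?y - e = (1 - s) *\<^sub>R (x - e)" by (simp add: algebra_simps)
    then have "norm (?y - e) = (1 - s) * norm (e - x)" using s by (simp add: norm_minus_commute)
    ultimately have "norm ?y + norm (?y - e) \<le> (1 - s) * (norm (e - x) + norm x) + s"
      by (simp add: distrib_left)
    also have "\<dots> \<le> (1 - s) * T + s" using x s by (intro add_right_mono mult_left_mono) auto
    also have "\<dots> < T" using s T mult_strict_left_mono[of 1 T s] by (simp add: algebra_simps)
    finally show "norm ?y + norm (?y - e) < T" .
  qed auto
  then have ev: "\<forall>\<^sub>F s in at_right 0. q ((1 - s) *\<^sub>R x + s *\<^sub>R e) = 0"
    using eventually_at_right_real[of 0 1] by (auto elim!: eventually_mono)
  have "isCont q x" using q_continuous by (simp add: continuous_on_eq_continuous_at)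
  moreover have "((\<lambda>s. (1 - s) *\<^sub>R x + s *\<^sub>R e) \<longlongrightarrow> x) (at_right 0)"
    by (auto intro!: tendsto_eq_intros)
  ultimately have "((\<lambda>s. q ((1 - s) *\<^sub>R x + s *\<^sub>R e)) \<longlongrightarrow> q x) (at_right 0)"
    by (rule isCont_tendsto_compose)
  moreover have "((\<lambda>s. q ((1 - s) *\<^sub>R x + s *\<^sub>R e)) \<longlongrightarrow> 0) (at_right (0::real))"
    using ev by (rule tendsto_eventually)
  ultimately have "q x = 0" using tendsto_unique trivial_limit_at_right_real by blast
  then show "q1 x = q2 x" by (simp add: q_def)
qed

end
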